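(* Let $d\ge1$ be an integer and $s\in(0,d)$. There are constants $\alpha\in(0,\frac12)$, $T\in(1,\frac1{2\alpha})$ and $c,C>0$, depending only on $d$ and $s$, such that for every $n\ge1$ and all positive numbers $\sigma_1,\dots,\sigma_n$ with $2\sigma_{j+1}\le\sigma_j$, $1\le j\le n-1$, the corresponding regularized Cantor set $E_n$ (built with the parameters $\alpha,T$), its regularized lengths $\ell_1,\dots,\ell_n$ and its uniform probability measure $\mu$ satisfy, with $\theta_j=2^{-dj}/\ell_j^s$, $$c\Big[\sum_{j=1}^n\theta_j^2\Big]^{1/2}\le\|R_\mu^s\|_{L^2(\mu)}\le C\Big[\sum_{j=1}^n\theta_j^2\Big]^{1/2}$$ and $$c\Big[\sum_{j=1}^n\theta_j^2\Big]^{1/2}\le|\!|\!|\mathfrak R_\mu^s|\!|\!|\le C\Big[\sum_{j=1}^n\theta_j^2\Big]^{1/2}.$$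
   Context: **Riesz transforms.** For a finite nonnegative Borel measure $\nu$ on $\mathbb R^d$, $\varepsilon>0$: $K^s(x)=x/|x|^{s+1}$, $R_{\nu,\varepsilon}^s(x)=\int_{|y-x|>\varepsilon}K^s(y-x)\,d\nu(y)$, $R_\nu^s(x)=\lim_{\varepsilon\to0+}R_{\nu,\varepsilon}^s(x)$ when the limit exists; $\mathfrak R_{\nu,\varepsilon}^sf(x)=\int_{|y-x|>\varepsilon}K^s(y-x)f(y)\,d\nu(y)$ for $f\in L^2(\nu)$, and $|\!|\!|\mathfrak R_\nu^s|\!|\!|=\sup_{\varepsilon>0}\|\mathfrak R_{\nu,\varepsilon}^s\|_{L^2(\nu)\to L^2(\nu)}$. Norms of vector-valued functions are norms of their Euclidean lengths. **Regularized lengths.** Let $\alpha\in(0,\frac12)$, $T\in(1,\frac1{2\alpha})$ and $\sigma_1,\dots,\sigma_n>0$ with $2\sigma_{j+1}\le\sigma_j$. Define indices $1=j_1<j_2<\dots<j_m=n$ inductively: $j_1=1$; if $j_p<n$ and $\sigma_n\le\alpha2^{-(n-j_p)}\sigma_{j_p}$, then $j_{p+1}$ is the least $j>j_p$ with $\sigma_j\le\alpha2^{-(j-j_p)}\sigma_{j_p}$; if $j_p<n$ and $\sigma_n>\alpha2^{-(n-j_p)}\sigma_{j_p}$, then $j_{p+1}=n$. Set $\ell_j=2^{-(j-j_p)}\sigma_{j_p}$ for $j_p\le j<j_{p+1}$, $p=1,\dots,m-1$, and $\ell_n=\min\{\sigma_n,\alpha2^{-(n-j_{m-1})}\sigma_{j_{m-1}}\}$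 (if $n=1$, $\ell_1=\sigma_1$). **Regularized Cantor set.** $Q(w,\ell)$ denotes the closed cube with center $w$, edge length $\ell$ and edges parallel to the axes. The $2^d$ corner cubes of edge length $\ell'$ of a cube $Q$ are the distinct closed axis-parallel cubes of edge length $\ell'$ contained in $Q$ and containing a vertex of $Q$. Put $E_0=Q_{1,1}=Q(0,2T\ell_1)$ and let $E_{1,k}$, $1\le k\le2^d$, be the corner cubes of edge length $\ell_1$ of $Q_{1,1}$. Given the $2^{dj_p}$ cubes $E_{j_p,k}$ of edge length $\ell_{j_p}$, $j_p<n$: for $j_p<j\le j_{p+1}-1$ split each cube of generation $j-1$ dyadically into $2^d$ equal cubes $E_{j,i}$ of edge length $\ell_j$. Let $w_{p+1,i}$, $1\le i\le2^{d(j_{p+1}-1)}$, be the centers of the resulting cubes of generation $j_{p+1}-1$, let $Q_{p+1,i}=Q(w_{p+1,i},2T\ell_{j_{p+1}})$, and let the cubes $E_{j_{p+1},k}$, $1\le k\le2^{dj_{p+1}}$, be all the corner cubes of edge length $\ell_{j_{p+1}}$ of the cubes $Q_{p+1,i}$. Finally $E_n=\bigcup_{k=1}^{2^{dn}}E_{n,k}$. The measure $\mu$ is the probability measure on $E_n$ which is uniformly distributed (a constant multiple of Lebesgue measure) on each cube $E_{n,k}$ with $\mu(E_{n,k})=2^{-dn}$. *)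

theory Defs
  imports "HOL-Analysis.Analysis"
begin

section \<open>Riesz transforms\<close>

text \<open>The \<open>L\<^sup>2\<close>-norm is extended-valued, so that no junk value arises when
  \<open>\<integral> |f|\<^sup>2 d\<nu> = \<infinity>\<close>. Vector-valued functions enter through their Euclidean length.\<close>

definition L2_enorm :: "'a measure \<Rightarrow> ('a \<Rightarrow> 'b::real_normed_vector) \<Rightarrow> ennreal" where
  "L2_enorm \<nu> f =
     (let I = (\<integral>\<^sup>+ x. ennreal ((norm (f x))\<^sup>2) \<partial>\<nu>)
      in if I = \<infinity> then \<infinity> else ennreal (sqrt (enn2real I)))"

definition riesz_kernel :: "real \<Rightarrow> real ^ 'd \<Rightarrow> real ^ 'd" where
  "riesz_kernel s x = (1 / norm x powr (s + 1)) *\<^sub>R x"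

definition riesz_trunc_op ::
    "real \<Rightarrow> (real ^ 'd) measure \<Rightarrow> real \<Rightarrow> (real ^ 'd \<Rightarrow> real) \<Rightarrow> real ^ 'd \<Rightarrow> real ^ 'd" where
  "riesz_trunc_op s \<nu> \<epsilon> f x = (LINT y:{y. norm (y - x) > \<epsilon>}|\<nu>. f y *\<^sub>R riesz_kernel s (y - x))"

definition riesz_trunc :: "real \<Rightarrow> (real ^ 'd) measure \<Rightarrow> real \<Rightarrow> real ^ 'd \<Rightarrow> real ^ 'd" where
  "riesz_trunc s \<nu> \<epsilon> x = (LINT y:{y. norm (y - x) > \<epsilon>}|\<nu>. riesz_kernel s (y - x))"

definition riesz_defined_at :: "real \<Rightarrow> (real ^ 'd) measure \<Rightarrow> real ^ 'd \<Rightarrow> bool" where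
  "riesz_defined_at s \<nu> x \<longleftrightarrow> (\<exists>l. ((\<lambda>\<epsilon>. riesz_trunc s \<nu> \<epsilon> x) \<longlongrightarrow> l) (at_right 0))"

text \<open>Meaningful only at points \<open>x\<close> with \<open>riesz_defined_at s \<nu> x\<close>.\<close>

definition riesz :: "real \<Rightarrow> (real ^ 'd) measure \<Rightarrow> real ^ 'd \<Rightarrow> real ^ 'd" where
  "riesz s \<nu> x = Lim (at_right 0) (\<lambda>\<epsilon>. riesz_trunc s \<nu> \<epsilon> x)"

definition riesz_opnorm :: "real \<Rightarrow> (real ^ 'd) measure \<Rightarrow> ennreal" where
  "riesz_opnorm s \<nu> =
     (SUP \<epsilon>\<in>{0<..}. SUP f\<in>{f. f \<in> borel_measurable \<nu> \<and> L2_enorm \<nu> f \<le> 1}.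
        L2_enorm \<nu> (riesz_trunc_op s \<nu> \<epsilon> f))"

section \<open>Regularized lengths\<close>

text \<open>The indices are numbered from \<open>0\<close>: \<open>reg_index \<alpha> n \<sigma> p\<close> is \<open>j\<^bsub>p+1\<^esub>\<close>, and the sequence
  stays at \<open>n\<close> once it has reached it.\<close>

primrec reg_index :: "real \<Rightarrow> nat \<Rightarrow> (nat \<Rightarrow> real) \<Rightarrow> nat \<Rightarrow> nat" where
  "reg_index \<alpha> n \<sigma> 0 = 1"
| "reg_index \<alpha> n \<sigma> (Suc p) =
     (let j = reg_index \<alpha> n \<sigma> p in
      if j < n then
        (if \<sigma> n \<le> \<alpha> * (1/2) ^ (n - j) * \<sigma> j
         then (LEAST i. j < i \<and> \<sigma> i \<le> \<alpha> * (1/2) ^ (i - j) * \<sigma> j)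
         else n)
      else n)"

text \<open>The index \<open>j\<^sub>p\<close> with \<open>j\<^sub>p \<le> j < j\<^bsub>p+1\<^esub>\<close>, for \<open>1 \<le> j < n\<close>. For \<open>j = n - 1\<close> it is
  \<open>j\<^bsub>m-1\<^esub>\<close>.\<close>

definition reg_block_start :: "real \<Rightarrow> nat \<Rightarrow> (nat \<Rightarrow> real) \<Rightarrow> nat \<Rightarrow> nat" where
  "reg_block_start \<alpha> n \<sigma> j =
     reg_index \<alpha> n \<sigma> (THE p. reg_index \<alpha> n \<sigma> p \<le> j \<and> j < reg_index \<alpha> n \<sigma> (Suc p))"

definition reg_length :: "real \<Rightarrow> nat \<Rightarrow> (nat \<Rightarrow> real) \<Rightarrow> nat \<Rightarrow> real" where
  "reg_length \<alpha> n \<sigma> j =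
     (if j < n then
        (let i = reg_block_start \<alpha> n \<sigma> j in (1/2) ^ (j - i) * \<sigma> i)
      else if n = 1 then \<sigma> 1
      else
        (let i = reg_block_start \<alpha> n \<sigma> (n - 1) in min (\<sigma> n) (\<alpha> * (1/2) ^ (n - i) * \<sigma> i)))"

section \<open>Regularized Cantor set\<close>

definition cube :: "real ^ 'd \<Rightarrow> real \<Rightarrow> (real ^ 'd) set" where
  "cube w l = cbox (\<chi> i. w $ i - l / 2) (\<chi> i. w $ i + l / 2)"

definition cube_vertices :: "real ^ 'd \<Rightarrow> real \<Rightarrow> (real ^ 'd) set" where
  "cube_vertices w l = {v. \<forall>i. v $ i = w $ i - l / 2 \<or> v $ i = w $ i + l / 2}"

text \<open>The corner cubes of edge length \<open>l'\<close> of \<open>cube w l\<close>.\<close>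

definition corner_cubes :: "real ^ 'd \<Rightarrow> real \<Rightarrow> real \<Rightarrow> (real ^ 'd) set set" where
  "corner_cubes w l l' =
     {cube u l' | u. cube u l' \<subseteq> cube w l \<and> (\<exists>v\<in>cube_vertices w l. v \<in> cube u l')}"

text \<open>The \<open>2\<^sup>d\<close> equal closed cubes into which \<open>cube w l\<close> is split dyadically.\<close>

definition dyadic_cubes :: "real ^ 'd \<Rightarrow> real \<Rightarrow> (real ^ 'd) set set" where
  "dyadic_cubes w l =
     {cube u (l / 2) | u. \<forall>i. u $ i = w $ i - l / 4 \<or> u $ i = w $ i + l / 4}"

text \<open>The family of cubes \<open>E\<^bsub>j,k\<^esub>\<close> of generation \<open>j\<close>; generation \<open>0\<close> consists of \<open>E\<^sub>0\<close> alone.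
  The set of \<open>w\<close> with \<open>cube w l\<close> in the preceding generation, where \<open>l\<close> is the edge length
  of that generation, is the set of centers of its cubes.\<close>

fun cantor_cubes :: "real \<Rightarrow> real \<Rightarrow> nat \<Rightarrow> (nat \<Rightarrow> real) \<Rightarrow> nat \<Rightarrow> (real ^ 'd) set set" where
  "cantor_cubes \<alpha> T n \<sigma> 0 = {cube 0 (2 * T * reg_length \<alpha> n \<sigma> 1)}"
| "cantor_cubes \<alpha> T n \<sigma> (Suc 0) =
     corner_cubes 0 (2 * T * reg_length \<alpha> n \<sigma> 1) (reg_length \<alpha> n \<sigma> 1)"
| "cantor_cubes \<alpha> T n \<sigma> (Suc (Suc j)) =
     (let l = reg_length \<alpha> n \<sigma> (Suc j); l' = reg_length \<alpha> n \<sigma> (Suc (Suc j)) in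
      \<Union>w\<in>{w. cube w l \<in> cantor_cubes \<alpha> T n \<sigma> (Suc j)}.
        if Suc (Suc j) \<in> range (reg_index \<alpha> n \<sigma>)
        then corner_cubes w (2 * T * l') l'
        else dyadic_cubes w l)"

definition cantor_set :: "real \<Rightarrow> real \<Rightarrow> nat \<Rightarrow> (nat \<Rightarrow> real) \<Rightarrow> (real ^ 'd) set" where
  "cantor_set \<alpha> T n \<sigma> = \<Union> (cantor_cubes \<alpha> T n \<sigma> n)"

text \<open>The \<open>2\<^bsup>dn\<^esup>\<close> cubes of generation \<open>n\<close> are pairwise disjoint, because \<open>n\<close> is one of the
  indices \<open>j\<^sub>p\<close>, so the density below gives mass \<open>2\<^bsup>-dn\<^esup>\<close> to each of them and is supported
  on \<open>cantor_set\<close>.\<close>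

definition cantor_measure :: "real \<Rightarrow> real \<Rightarrow> nat \<Rightarrow> (nat \<Rightarrow> real) \<Rightarrow> (real ^ 'd) measure" where
  "cantor_measure \<alpha> T n \<sigma> =
     density lborel (\<lambda>x. \<Sum>Q\<in>cantor_cubes \<alpha> T n \<sigma> n.
       ennreal ((1/2) ^ (CARD('d) * n) / measure lborel Q) * indicator Q x)"

definition cantor_theta :: "nat \<Rightarrow> real \<Rightarrow> (nat \<Rightarrow> real) \<Rightarrow> nat \<Rightarrow> real" where
  "cantor_theta d s l j = (1/2) ^ (d * j) / l j powr s"

end

theory Submission
  imports Defs
begin

text \<open>The jump generations \<open>j\<^sub>p\<close> split the Riesz kernel into antisymmetric pieces \<open>k\<^sub>p\<close>, where
  \<open>k\<^sub>p(x, y)\<close> lives on pairs of points in the same cube \<open>Q\<^bsub>p,i\<^esub>\<close> but in different cubes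
  \<open>Q\<^bsub>p+1,i\<^esub>\<close>. Each piece satisfies a Schur bound by \<open>C \<theta>\<^sub>j\<close> with \<open>j = j\<^sub>p\<close> and is almost constant in \<open>x\<close>
  on the cubes of later levels, with an error that decays like a power of \<open>\<alpha>\<close>. Antisymmetry
  gives \<open>k\<^sub>p 1\<close> mean zero on every cube of level \<open>p\<close>, so the functions \<open>k\<^sub>p 1\<close> are almost
  orthogonal, and for small \<open>\<alpha>\<close> the norm of \<open>R\<^sub>\<mu>\<close> is comparable to the square root of the sum of
  \<open>\<parallel>k\<^sub>p 1\<parallel>\<^sup>2\<close>. A lower bound for \<open>\<parallel>k\<^sub>p 1\<parallel>\<close> comes from integrating one component over the left halves
  of the cubes: the interaction of a half with itself cancels, and the interaction of the two
  halves has a sign. For the operator norm, let \<open>T\<^sub>q\<close> be the sum of the first \<open>q\<close> pieces. In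
  \<open>\<parallel>T\<^bsub>q+1\<^esub> f\<parallel>\<^sup>2 - \<parallel>T\<^sub>q f\<parallel>\<^sup>2\<close> the cross term \<open>\<langle>T\<^sub>q f, k\<^sub>q f\<rangle>\<close> is a small error plus
  \<open>- \<langle>g\<^sub>q k\<^sub>q 1, f\<rangle>\<close>, with \<open>g\<^sub>q\<close> the value of \<open>T\<^sub>q f\<close> at the center of the cube, and the functions
  \<open>g\<^sub>q k\<^sub>q 1\<close> are almost orthogonal again. A truncation at scale \<open>\<epsilon>\<close> cuts through only one level.\<close>

section \<open>Towers of antisymmetric kernels\<close>

text \<open>The obstacle is that the pieces are not almost orthogonal as operators. A piece applied
  to 1 need not vanish, so the product of two pieces does not decay with the distance of their
  levels, and a Cotlar-Stein argument fails. What survives is a paraproduct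
  \<open>g q * u q\<close>, where \<open>u q\<close> is the piece applied to 1. The pointwise bound
  of \<open>u q\<close> by \<open>a q\<close> makes it summable, but at the price of the L2 norm of
  \<open>g q\<close>, which is again a norm of partial sums. Hence a strong induction, a weight
  chosen for absorption, and a constant that solves a fixed point equation. For this upper bound
  \<kappa> \<le> 1/2 suffices; further smallness of \<alpha> serves the lower bound, where the cross
  terms must lose against the diagonal. Two features of the set produce the pieces. Between jumps
  cubes are filled without gaps, so mass grows with exponent d > s and row sums are multiples of
  \<theta>. At a jump a gap comparable to the preceding edge opens, which makes a piece smooth at
  the scale of later cubes. The last piece has no gap and is singular on the diagonal; for arbitrary
  f it is only estimated by Schur's test. Generations between jumps cost a constant, since \<theta>
  decays geometrically there.\<close>

lemma Schur_test_nn_integral: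
  fixes s :: "'a \<Rightarrow> 'a \<Rightarrow> ennreal" and f :: "'a \<Rightarrow> ennreal"
  assumes "sigma_finite_measure M"
    and s[measurable]: "(\<lambda>(x, y). s x y) \<in> borel_measurable (M \<Otimes>\<^sub>M M)"
    and f[measurable]: "f \<in> borel_measurable M"
    and row: "\<And>x. x \<in> space M \<Longrightarrow> (\<integral>\<^sup>+ y. s x y \<partial>M) \<le> a"
    and col: "\<And>y. y \<in> space M \<Longrightarrow> (\<integral>\<^sup>+ x. s x y \<partial>M) \<le> a"
  shows "(\<integral>\<^sup>+ x. (\<integral>\<^sup>+ y. s x y * f y \<partial>M)^2 \<partial>M) \<le> a^2 * (\<integral>\<^sup>+ y. (f y)^2 \<partial>M)"
proof -
  interpret sigma_finite_measure M by fact
  interpret P: pair_sigma_finite M M ..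
  have "(\<integral>\<^sup>+ y. s x y * f y \<partial>M)^2 \<le> a * (\<integral>\<^sup>+ y. s x y * (f y)^2 \<partial>M)" if x: "x \<in> space M" for x
  proof -
    have [measurable]: "s x \<in> borel_measurable M" using measurable_compose_Pair1[OF x s] by simp
    define D where "D = density M (s x)"
    have [measurable]: "f \<in> borel_measurable D" by (simp add: D_def)
    have "(\<integral>\<^sup>+ y. s x y * f y \<partial>M)^2 = (\<integral>\<^sup>+ y. 1 * f y \<partial>D)^2"
      unfolding D_def by (subst nn_integral_density) auto
    also have "\<dots> \<le> (\<integral>\<^sup>+ y. 1 ^ 2 \<partial>D) * (\<integral>\<^sup>+ y. f y ^ 2 \<partial>D)"
      by (rule Cauchy_Schwarz_nn_integral) auto
    also have "\<dots> = (\<integral>\<^sup>+ y. s x y \<partial>M) * (\<integral>\<^sup>+ y. s x y * (f y)^2 \<partial>M)"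
      unfolding D_def by (subst (1 2) nn_integral_density) auto
    also have "\<dots> \<le> a * (\<integral>\<^sup>+ y. s x y * (f y)^2 \<partial>M)"
      using row[OF x] by (rule mult_right_mono) simp
    finally show ?thesis .
  qed
  then have "(\<integral>\<^sup>+ x. (\<integral>\<^sup>+ y. s x y * f y \<partial>M)^2 \<partial>M)
      \<le> (\<integral>\<^sup>+ x. a * (\<integral>\<^sup>+ y. s x y * (f y)^2 \<partial>M) \<partial>M)"
    by (intro nn_integral_mono) auto
  also have "\<dots> = a * (\<integral>\<^sup>+ x. (\<integral>\<^sup>+ y. s x y * (f y)^2 \<partial>M) \<partial>M)"
    by (rule nn_integral_cmult) measurable
  also have "(\<integral>\<^sup>+ x. (\<integral>\<^sup>+ y. s x y * (f y)^2 \<partial>M) \<partial>M) = (\<integral>\<^sup>+ y. (\<integral>\<^sup>+ x. s x y * (f y)^2 \<partial>M) \<partial>M)"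
    by (subst P.Fubini'[symmetric]) auto
  also have "\<dots> = (\<integral>\<^sup>+ y. (\<integral>\<^sup>+ x. s x y \<partial>M) * (f y)^2 \<partial>M)"
    by (rule nn_integral_cong, rule nn_integral_multc) (use measurable_Pair1[OF s] in simp)
  also have "\<dots> \<le> (\<integral>\<^sup>+ y. a * (f y)^2 \<partial>M)"
    by (intro nn_integral_mono mult_right_mono col) auto
  also have "\<dots> = a * (\<integral>\<^sup>+ y. (f y)^2 \<partial>M)" by (rule nn_integral_cmult) measurable
  finally show ?thesis
    by (simp add: power2_eq_square mult.assoc mult_left_mono)
qed

text \<open>AM-GM splits each product into squares, and both marginal sums of the weights start at
  exponent 1. The prefactor \<kappa> is what later lets a small \<alpha> suppress the off-diagonal
  terms.\<close>

lemma geometric_schur_sum: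
  fixes a :: "nat \<Rightarrow> real"
  assumes k: "0 \<le> \<kappa>" "\<kappa> \<le> 1/2"
  shows "(\<Sum>q<Q. \<Sum>p<q. \<kappa> ^ (q - p) * (a p * a q)) \<le> 2 * \<kappa> * (\<Sum>p<Q. (a p)^2)"
proof -
  have geo: "(\<Sum>i\<in>{1..m}. \<kappa> ^ i) \<le> 2 * \<kappa>" for m
  proof -
    have "(\<Sum>i<m. \<kappa> ^ i) \<le> 2"
    proof -
      have "(\<Sum>i<m. \<kappa> ^ i) \<le> (\<Sum>i<m. (1/2) ^ i)" by (intro sum_mono power_mono k)
      also have "\<dots> \<le> 2" by (simp add: sum_gp_strict)
      finally show ?thesis .
    qed
    moreover have "(\<Sum>i\<in>{1..m}. \<kappa> ^ i) = \<kappa> * (\<Sum>i<m. \<kappa> ^ i)" unfolding sum_distrib_left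
      by (rule sum.reindex_bij_witness[of _ Suc "\<lambda>i. i - 1"]) (auto simp: power_eq_if)
    ultimately show ?thesis using mult_left_mono[of "(\<Sum>i<m. \<kappa> ^ i)" 2 \<kappa>] k by (simp add: mult.commute)
  qed
  have "(\<Sum>q<Q. \<Sum>p<q. \<kappa> ^ (q - p) * (a p * a q))
      \<le> (\<Sum>q<Q. \<Sum>p<q. \<kappa> ^ (q - p) * ((a p)^2 / 2 + (a q)^2 / 2))"
  proof (intro sum_mono mult_left_mono)
    fix p q show "a p * a q \<le> (a p)^2 / 2 + (a q)^2 / 2" using sum_squares_bound[of "a p" "a q"] by simp
  qed (use k in auto)
  also have "\<dots> = (\<Sum>q<Q. \<Sum>p<q. \<kappa> ^ (q - p) * ((a p)^2 / 2)) + (\<Sum>q<Q. (\<Sum>p<q. \<kappa> ^ (q - p)) * ((a q)^2 / 2))"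
    unfolding distrib_left sum.distrib sum_distrib_right by (rule refl)
  also have "(\<Sum>q<Q. \<Sum>p<q. \<kappa> ^ (q - p) * ((a p)^2 / 2)) = (\<Sum>p<Q. \<Sum>q\<in>{p<..<Q}. \<kappa> ^ (q - p) * ((a p)^2 / 2))"
  proof -
    have "(\<Sum>q<Q. \<Sum>p<q. \<kappa> ^ (q - p) * ((a p)^2 / 2))
        = (\<Sum>q<Q. \<Sum>p | p \<in> {..<Q} \<and> p < q. \<kappa> ^ (q - p) * ((a p)^2 / 2))"
      by (intro sum.cong) auto
    also have "\<dots> = (\<Sum>p<Q. \<Sum>q | q \<in> {..<Q} \<and> p < q. \<kappa> ^ (q - p) * ((a p)^2 / 2))"
      by (rule sum.swap_restrict) auto
    also have "\<dots> = (\<Sum>p<Q. \<Sum>q\<in>{p<..<Q}. \<kappa> ^ (q - p) * ((a p)^2 / 2))" by (intro sum.cong) auto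
    finally show ?thesis .
  qed
  also have "\<dots> = (\<Sum>p<Q. (\<Sum>q\<in>{p<..<Q}. \<kappa> ^ (q - p)) * ((a p)^2 / 2))"
    unfolding sum_distrib_right by (rule refl)
  also have "\<dots> \<le> (\<Sum>p<Q. 2 * \<kappa> * ((a p)^2 / 2))"
  proof (intro sum_mono mult_right_mono)
    fix p
    have "(\<Sum>q\<in>{p<..<Q}. \<kappa> ^ (q - p)) = (\<Sum>i\<in>{1..Q - p - 1}. \<kappa> ^ i)"
      by (rule sum.reindex_bij_witness[of _ "\<lambda>i. i + p" "\<lambda>q. q - p"]) auto
    then show "(\<Sum>q\<in>{p<..<Q}. \<kappa> ^ (q - p)) \<le> 2 * \<kappa>" using geo by simp
  qed auto
  also have "(\<Sum>q<Q. (\<Sum>p<q. \<kappa> ^ (q - p)) * ((a q)^2 / 2)) \<le> (\<Sum>q<Q. 2 * \<kappa> * ((a q)^2 / 2))"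
  proof (intro sum_mono mult_right_mono)
    fix q
    have "(\<Sum>p<q. \<kappa> ^ (q - p)) = (\<Sum>i\<in>{1..q}. \<kappa> ^ i)"
      by (rule sum.reindex_bij_witness[of _ "\<lambda>i. q - i" "\<lambda>p. q - p"]) auto
    then show "(\<Sum>p<q. \<kappa> ^ (q - p)) \<le> 2 * \<kappa>" using geo by simp
  qed auto
  finally show ?thesis unfolding sum_distrib_left[symmetric] sum_divide_distrib[symmetric] by simp
qed

lemma sum_square_expand:
  fixes b :: "nat \<Rightarrow> real"
  shows "(\<Sum>q<Q. b q)^2 = (\<Sum>q<Q. (b q)^2) + 2 * (\<Sum>q<Q. \<Sum>p<q. b p * b q)"
proof (induction Q)
  case (Suc Q)
  have "(\<Sum>p<Q. b p * b Q) = (\<Sum>p<Q. b p) * b Q" by (simp add: sum_distrib_right)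
  then show ?case using Suc by (simp add: power2_sum)
qed simp

lemma integral_sum_square:
  fixes b :: "nat \<Rightarrow> 'a \<Rightarrow> real"
  assumes i: "\<And>p q. p < Q \<Longrightarrow> q < Q \<Longrightarrow> integrable M (\<lambda>x. b p x * b q x)"
  shows "(LINT x|M. (\<Sum>q<Q. b q x)^2)
    = (\<Sum>q<Q. \<integral>x. (b q x)^2 \<partial>M) + 2 * (\<Sum>q<Q. \<Sum>p<q. \<integral>x. b p x * b q x \<partial>M)"
proof -
  have i1: "integrable M (\<lambda>x. (b p x)^2)" if "p < Q" for p
    using i[OF that that] by (simp add: power2_eq_square)
  have I1: "integrable M (\<lambda>x. \<Sum>p<Q. (b p x)^2)" by (intro Bochner_Integration.integrable_sum i1) auto
  have I2: "integrable M (\<lambda>x. \<Sum>q<Q. \<Sum>p<q. b p x * b q x)"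
    by (intro Bochner_Integration.integrable_sum i) auto
  have "(LINT x|M. (\<Sum>q<Q. b q x)^2) = (LINT x|M. (\<Sum>q<Q. (b q x)^2)) + 2 * (LINT x|M. (\<Sum>q<Q. \<Sum>p<q. b p x * b q x))"
    unfolding sum_square_expand using I1 I2 by simp
  also have "(LINT x|M. (\<Sum>q<Q. (b q x)^2)) = (\<Sum>q<Q. \<integral>x. (b q x)^2 \<partial>M)"
    by (intro Bochner_Integration.integral_sum i1) auto
  also have "(LINT x|M. (\<Sum>q<Q. \<Sum>p<q. b p x * b q x)) = (\<Sum>q<Q. \<integral>x. (\<Sum>p<q. b p x * b q x) \<partial>M)"
    by (intro Bochner_Integration.integral_sum Bochner_Integration.integrable_sum i) auto
  also have "\<dots> = (\<Sum>q<Q. \<Sum>p<q. \<integral>x. b p x * b q x \<partial>M)"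
    by (intro sum.cong refl Bochner_Integration.integral_sum i) auto
  finally show ?thesis .
qed

text \<open>The kernels \<open>k p\<close> are dominated by the symmetric kernels \<open>s p\<close>, whose row sums are at most
  \<open>a p\<close>, and \<open>z p\<close> sends each point to the center of its cube of level \<open>p\<close>.\<close>

locale kernel_tower = finite_measure M for M :: "'a measure" +
  fixes k s :: "nat \<Rightarrow> 'a \<Rightarrow> 'a \<Rightarrow> real" and z :: "nat \<Rightarrow> 'a \<Rightarrow> 'a"
    and a :: "nat \<Rightarrow> real" and N :: nat and L \<kappa> :: real
  assumes space_UNIV: "space M = UNIV"
    and k_measurable: "\<And>p. p < N \<Longrightarrow> (\<lambda>(x, y). k p x y) \<in> borel_measurable (M \<Otimes>\<^sub>M M)"
    and s_measurable: "\<And>p. p < N \<Longrightarrow> (\<lambda>(x, y). s p x y) \<in> borel_measurable (M \<Otimes>\<^sub>M M)"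
    and z_measurable: "\<And>p. p < N \<Longrightarrow> z p \<in> M \<rightarrow>\<^sub>M M"
    and k_le_s: "\<And>p x y. p < N \<Longrightarrow> \<bar>k p x y\<bar> \<le> s p x y"
    and k_antisym: "\<And>p x y. p < N \<Longrightarrow> k p y x = - k p x y"
    and s_sym: "\<And>p x y. p < N \<Longrightarrow> s p y x = s p x y"
    and row: "\<And>p x. p < N \<Longrightarrow> (\<integral>\<^sup>+ y. s p x y \<partial>M) \<le> ennreal (a p)"
    and a_nonneg: "\<And>p. 0 \<le> a p"
    and z_const: "\<And>p q x y. p \<le> q \<Longrightarrow> q < N \<Longrightarrow> k q x y \<noteq> 0 \<Longrightarrow> z p x = z p y"
    and smooth: "\<And>p q. p < q \<Longrightarrow> q < N \<Longrightarrow>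
      AE x in M. \<forall>y. \<bar>k p x y - k p (z q x) y\<bar> \<le> L * \<kappa> ^ (q - p) * s p x y"
    and L_nonneg: "0 \<le> L" and \<kappa>_nonneg: "0 \<le> \<kappa>" and \<kappa>_le: "\<kappa> \<le> 1/2"
begin

lemma s_nonneg: "p < N \<Longrightarrow> 0 \<le> s p x y" using k_le_s[of p x y] by linarith

lemma sections [measurable]:
  assumes "p < N"
  shows "k p x \<in> borel_measurable M" "s p x \<in> borel_measurable M"
    "(\<lambda>x. k p x y) \<in> borel_measurable M" "(\<lambda>x. s p x y) \<in> borel_measurable M"
  using measurable_Pair2[OF k_measurable[OF assms], of x]
    measurable_Pair2[OF s_measurable[OF assms], of x]
    measurable_Pair1[OF k_measurable[OF assms], of y]
    measurable_Pair1[OF s_measurable[OF assms], of y]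
  by (auto simp: space_UNIV)

lemma integrable_s: "p < N \<Longrightarrow> integrable M (s p x)" using row[of p x] s_nonneg
  by (intro integrableI_nonneg) (auto simp: le_less_trans ennreal_less_top)

lemma integral_s_le: "p < N \<Longrightarrow> (LINT y|M. s p x y) \<le> a p"
  using row[of p x] s_nonneg[of p] nn_integral_eq_integral[OF integrable_s, of p x] a_nonneg[of p]
  by (auto simp: ennreal_le_iff)

lemma integrable_k: "p < N \<Longrightarrow> integrable M (k p x)"
  by (rule Bochner_Integration.integrable_bound[OF integrable_s[of p x]])
     (use k_le_s s_nonneg in \<open>auto simp: abs_of_nonneg\<close>)

section \<open>Cancellation from antisymmetry\<close>

definition U :: "nat \<Rightarrow> ('a \<Rightarrow> real) \<Rightarrow> 'a \<Rightarrow> real" where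
  "U p f x = (LINT y|M. k p x y * f y)"

definition u :: "nat \<Rightarrow> 'a \<Rightarrow> real" where
  "u p x = (LINT y|M. k p x y)"

lemma U_measurable [measurable]:
  assumes [measurable]: "p < N" "f \<in> borel_measurable M"
  shows "U p f \<in> borel_measurable M"
proof -
  note k_measurable[OF assms(1), measurable]
  show ?thesis unfolding U_def by measurable
qed

lemma u_measurable [measurable]: "p < N \<Longrightarrow> u p \<in> borel_measurable M"
  using U_measurable[of p "\<lambda>_. 1"] unfolding U_def u_def by simp

lemma abs_u_le: "p < N \<Longrightarrow> \<bar>u p x\<bar> \<le> a p"
proof -
  assume p: "p < N"
  have "\<bar>u p x\<bar> \<le> (LINT y|M. \<bar>k p x y\<bar>)" unfolding u_def by (rule integral_abs_bound)
  also have "\<dots> \<le> (LINT y|M. s p x y)"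
    by (intro integral_mono integrable_abs integrable_k integrable_s k_le_s p)
  finally show ?thesis using integral_s_le[OF p, of x] by linarith
qed

text \<open>Supplies absolute integrability for Fubini. Integrating over x first, symmetry of
  \<open>s p\<close> turns the row bound into a column bound.\<close>

lemma integrable_pair:
  assumes p: "p < N" and g: "integrable M g" and \<phi>: "\<phi> \<in> borel_measurable M" "\<And>x. \<bar>\<phi> x\<bar> \<le> B"
  shows "integrable (M \<Otimes>\<^sub>M M) (\<lambda>(x, y). \<phi> x * k p x y * g y)"
    and "integrable (M \<Otimes>\<^sub>M M) (\<lambda>(x, y). \<phi> y * k p x y * g y)"
proof -
  interpret P: pair_sigma_finite M M ..
  note [measurable] = k_measurable[OF p] s_measurable[OF p] \<phi>(1) borel_measurable_integrable[OF g]
  have B: "0 \<le> B" using \<phi>(2)[of undefined] by linarith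
  have I: "integrable (M \<Otimes>\<^sub>M M) (\<lambda>(x, y). s p x y * \<bar>g y\<bar>)"
  proof (rule integrableI_nonneg)
    have "(\<integral>\<^sup>+ w. ennreal (case w of (x, y) \<Rightarrow> s p x y * \<bar>g y\<bar>) \<partial>(M \<Otimes>\<^sub>M M))
        = (\<integral>\<^sup>+ y. (\<integral>\<^sup>+ x. ennreal (s p x y * \<bar>g y\<bar>) \<partial>M) \<partial>M)"
      by (subst P.nn_integral_snd[symmetric]) auto
    also have "\<dots> = (\<integral>\<^sup>+ y. (\<integral>\<^sup>+ x. ennreal (s p y x) \<partial>M) * ennreal \<bar>g y\<bar> \<partial>M)"
      using s_nonneg[OF p] p by (intro nn_integral_cong)
        (simp add: ennreal_mult nn_integral_multc s_sym[of p])
    also have "\<dots> \<le> (\<integral>\<^sup>+ y. ennreal (a p) * ennreal \<bar>g y\<bar> \<partial>M)"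
      by (intro nn_integral_mono mult_right_mono row p) auto
    also have "\<dots> = ennreal (a p) * (\<integral>\<^sup>+ y. ennreal \<bar>g y\<bar> \<partial>M)"
      by (rule nn_integral_cmult) measurable
    also have "\<dots> < \<infinity>" using g by (simp add: integrable_iff_bounded ennreal_mult_less_top)
    finally show "(\<integral>\<^sup>+ w. ennreal (case w of (x, y) \<Rightarrow> s p x y * \<bar>g y\<bar>) \<partial>(M \<Otimes>\<^sub>M M)) < \<infinity>" .
  qed (use s_nonneg[OF p] in auto)
  have J: "integrable (M \<Otimes>\<^sub>M M) (\<lambda>w. B * (case w of (x, y) \<Rightarrow> s p x y * \<bar>g y\<bar>))"
    using I by simp
  have le: "\<bar>\<phi> v * k p x y * g y\<bar> \<le> B * (s p x y * \<bar>g y\<bar>)" for v x y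
    using mult_mono[OF \<phi>(2)[of v] k_le_s[OF p, of x y] B] mult_right_mono[of _ _ "\<bar>g y\<bar>"]
    by (simp add: abs_mult mult.assoc[symmetric])
  show "integrable (M \<Otimes>\<^sub>M M) (\<lambda>(x, y). \<phi> x * k p x y * g y)" using le B s_nonneg[OF p]
    by (intro Bochner_Integration.integrable_bound[OF J]) (auto simp: split_beta abs_mult)
  show "integrable (M \<Otimes>\<^sub>M M) (\<lambda>(x, y). \<phi> y * k p x y * g y)" using le B s_nonneg[OF p]
    by (intro Bochner_Integration.integrable_bound[OF J]) (auto simp: split_beta abs_mult)
qed

text \<open>Since \<phi> takes equal values wherever \<open>k q\<close> is nonzero, it can be moved
  from x to y; Fubini and antisymmetry then turn the inner integral into \<open>- u q y\<close>. For
  \<open>g = 1\<close> this is the mean zero property, localized by \<phi>.\<close>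

lemma integral_U_eq:
  assumes q: "q < N" and g: "integrable M g" and \<phi>: "\<phi> \<in> borel_measurable M" "\<And>x. \<bar>\<phi> x\<bar> \<le> B"
    and const: "\<And>x y. k q x y \<noteq> 0 \<Longrightarrow> \<phi> x = \<phi> y"
  shows "(LINT x|M. \<phi> x * U q g x) = - (LINT x|M. \<phi> x * u q x * g x)"
proof -
  interpret P: pair_sigma_finite M M ..
  have "(LINT x|M. \<phi> x * U q g x) = (LINT x|M. (LINT y|M. \<phi> x * k q x y * g y))"
    by (simp add: U_def mult.assoc)
  also have "\<dots> = (LINT x|M. (LINT y|M. \<phi> y * k q x y * g y))"
    using const by (intro Bochner_Integration.integral_cong refl) (metis mult_zero_left mult_zero_right)
  also have "\<dots> = (LINT y|M. (LINT x|M. \<phi> y * k q x y * g y))"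
    by (rule P.Fubini_integral[symmetric]) (rule integrable_pair(2)[OF q g \<phi>])
  also have "\<dots> = (LINT y|M. - (\<phi> y * u q y * g y))"
  proof (intro Bochner_Integration.integral_cong refl)
    fix y
    have "(LINT x|M. k q x y) = (LINT x|M. - k q y x)" by (intro Bochner_Integration.integral_cong refl k_antisym q)
    then have "(LINT x|M. k q x y) = - u q y" by (simp add: u_def)
    then show "(LINT x|M. \<phi> y * k q x y * g y) = - (\<phi> y * u q y * g y)" by simp
  qed
  finally show ?thesis by simp
qed


text \<open>With \<open>u p\<close> sampled at the center \<open>z q x\<close>, the whole factor in
  front of \<open>u q\<close> is constant on the support of \<open>k q\<close>, so that integral
  vanishes; the error is the oscillation of \<open>u p\<close> over cubes of level q. The weight
  \<phi> is 1 in the lower bound and \<open>g p * g q\<close> in the operator estimate.\<close>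

lemma cross_bound:
  assumes pq: "p < q" "q < N" and \<phi>: "\<phi> \<in> borel_measurable M" "\<And>x. \<bar>\<phi> x\<bar> \<le> B"
    and const: "\<And>x y. k q x y \<noteq> 0 \<Longrightarrow> \<phi> x = \<phi> y"
  shows "\<bar>\<integral>x. \<phi> x * u p x * u q x \<partial>M\<bar> \<le> L * \<kappa> ^ (q - p) * (a p * a q) * (LINT x|M. \<bar>\<phi> x\<bar>)"
proof -
  have p: "p < N" using pq by simp
  note [measurable] = \<phi>(1) z_measurable[OF pq(2)]
  have [measurable]: "(\<lambda>x. u p (z q x)) \<in> borel_measurable M"
    using measurable_compose[OF z_measurable[OF pq(2)] u_measurable[OF p]] .
  have B: "0 \<le> B" using \<phi>(2)[of undefined] by linarith
  have b1: "\<bar>\<phi> x * u p (z q x)\<bar> \<le> B * a p" for x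
    unfolding abs_mult by (intro mult_mono \<phi> abs_u_le p B) auto
  have b2: "\<bar>\<phi> x * u p x * u q x\<bar> \<le> B * a p * a q" for x
    unfolding abs_mult by (intro mult_mono \<phi> abs_u_le p pq B) (auto simp: B a_nonneg)
  have b3: "\<bar>\<phi> x * u p (z q x) * u q x\<bar> \<le> B * a p * a q" for x
    unfolding abs_mult by (intro mult_mono \<phi> abs_u_le p pq B) (auto simp: B a_nonneg)
  have "(LINT x|M. (\<phi> x * u p (z q x)) * U q (\<lambda>_. 1) x) = - (LINT x|M. (\<phi> x * u p (z q x)) * u q x * 1)"
  proof (rule integral_U_eq[OF pq(2) _ _ b1])
    fix x y assume "k q x y \<noteq> 0"
    then show "\<phi> x * u p (z q x) = \<phi> y * u p (z q y)"
      using const[of x y] z_const[OF order_refl pq(2), of x y] by simp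
  qed auto
  \<comment> \<open>The identity above equates the integral with its own negative.\<close>
  then have zero: "(LINT x|M. \<phi> x * u p (z q x) * u q x) = 0" by (simp add: U_def u_def[symmetric])
  have i1: "integrable M (\<lambda>x. \<phi> x * u p x * u q x)"
    by (rule integrable_const_bound[where B="B * a p * a q"]) (use b2 p pq in auto)
  have i2: "integrable M (\<lambda>x. \<phi> x * u p (z q x) * u q x)"
    by (rule integrable_const_bound[where B="B * a p * a q"]) (use b3 p pq in auto)
  have i3: "integrable M (\<lambda>x. \<bar>\<phi> x\<bar>)"
    by (rule integrable_const_bound[where B=B]) (use \<phi> in auto)
  have osc: "AE x in M. \<bar>u p x - u p (z q x)\<bar> \<le> L * \<kappa> ^ (q - p) * a p" using smooth[OF pq]
  proof eventually_elim
    case (elim x)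
    have "\<bar>u p x - u p (z q x)\<bar> = \<bar>\<integral>y. k p x y - k p (z q x) y \<partial>M\<bar>"
      unfolding u_def by (simp add: integrable_k p)
    also have "\<dots> \<le> (LINT y|M. \<bar>k p x y - k p (z q x) y\<bar>)" by (rule integral_abs_bound)
    also have "\<dots> \<le> (LINT y|M. L * \<kappa> ^ (q - p) * s p x y)"
      by (intro integral_mono integrable_abs Bochner_Integration.integrable_diff integrable_k p
          integrable_mult_right integrable_s elim[rule_format])
    also have "\<dots> = L * \<kappa> ^ (q - p) * (LINT y|M. s p x y)" by simp
    also have "\<dots> \<le> L * \<kappa> ^ (q - p) * a p"
      by (intro mult_left_mono integral_s_le p) (simp add: L_nonneg \<kappa>_nonneg)
    finally show ?case .
  qed
  have "\<bar>\<integral>x. \<phi> x * u p x * u q x \<partial>M\<bar> = \<bar>\<integral>x. \<phi> x * u p x * u q x - \<phi> x * u p (z q x) * u q x \<partial>M\<bar>"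
    using i1 i2 zero by simp
  also have "\<dots> \<le> (LINT x|M. \<bar>\<phi> x * u p x * u q x - \<phi> x * u p (z q x) * u q x\<bar>)"
    by (rule integral_abs_bound)
  also have "\<dots> \<le> (LINT x|M. L * \<kappa> ^ (q - p) * (a p * a q) * \<bar>\<phi> x\<bar>)"
  proof (rule integral_mono_AE)
    show "AE x in M. \<bar>\<phi> x * u p x * u q x - \<phi> x * u p (z q x) * u q x\<bar> \<le> L * \<kappa> ^ (q - p) * (a p * a q) * \<bar>\<phi> x\<bar>"
      using osc
    proof eventually_elim
      case (elim x)
      have "\<bar>\<phi> x * u p x * u q x - \<phi> x * u p (z q x) * u q x\<bar> = \<bar>\<phi> x\<bar> * (\<bar>u p x - u p (z q x)\<bar> * \<bar>u q x\<bar>)"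
        by (simp add: abs_mult[symmetric] algebra_simps)
      also have "\<dots> \<le> \<bar>\<phi> x\<bar> * ((L * \<kappa> ^ (q - p) * a p) * a q)"
        by (intro mult_left_mono mult_mono elim abs_u_le pq) (auto simp: L_nonneg \<kappa>_nonneg a_nonneg)
      finally show ?case by (simp add: algebra_simps)
    qed
  qed (use i1 i2 i3 in auto)
  also have "\<dots> = L * \<kappa> ^ (q - p) * (a p * a q) * (LINT x|M. \<bar>\<phi> x\<bar>)" by simp
  finally show ?thesis .
qed

text \<open>The 4 is the 2 of the expanded square times the 2 of
  \<open>geometric_schur_sum\<close>.\<close>

lemma integral_sum_u_square_ge:
  assumes low: "\<And>p. p < N \<Longrightarrow> b p \<le> (LINT x|M. (u p x)^2)" and mass: "measure M UNIV \<le> 1"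
  shows "(\<Sum>p<N. b p) - 4 * L * \<kappa> * (\<Sum>p<N. (a p)^2) \<le> (LINT x|M. (\<Sum>p<N. u p x)^2)"
proof -
  have i: "integrable M (\<lambda>x. u p x * u q x)" if "p < N" "q < N" for p q
    by (rule integrable_const_bound[where B="a p * a q"])
      (use that in \<open>auto simp: abs_mult a_nonneg intro!: mult_mono abs_u_le\<close>)
  have cross: "\<bar>\<integral>x. u p x * u q x \<partial>M\<bar> \<le> L * (\<kappa> ^ (q - p) * (a p * a q))" if "p < q" "q < N" for p q
  proof -
    have "\<bar>\<integral>x. 1 * u p x * u q x \<partial>M\<bar> \<le> L * \<kappa> ^ (q - p) * (a p * a q) * (LINT x|M. \<bar>1\<bar>)"
      by (rule cross_bound[OF that, where B=1]) auto
    also have "\<dots> \<le> L * \<kappa> ^ (q - p) * (a p * a q) * 1"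
      by (intro mult_left_mono) (use mass in \<open>auto simp: space_UNIV L_nonneg \<kappa>_nonneg a_nonneg\<close>)
    finally show ?thesis by (simp add: mult.assoc)
  qed
  have "(LINT x|M. (\<Sum>p<N. u p x)^2)
      = (\<Sum>p<N. \<integral>x. (u p x)^2 \<partial>M) + 2 * (\<Sum>q<N. \<Sum>p<q. \<integral>x. u p x * u q x \<partial>M)"
    by (rule integral_sum_square) (rule i)
  moreover have "- (L * (\<Sum>q<N. \<Sum>p<q. \<kappa> ^ (q - p) * (a p * a q))) \<le> (\<Sum>q<N. \<Sum>p<q. \<integral>x. u p x * u q x \<partial>M)"
    unfolding sum_distrib_left sum_negf[symmetric]
  proof (intro sum_mono)
    fix q p assume "q \<in> {..<N}" "p \<in> {..<q}"
    then show "- (L * (\<kappa> ^ (q - p) * (a p * a q))) \<le> (LINT x|M. u p x * u q x)" using cross[of p q] by auto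
  qed
  moreover have "L * (\<Sum>q<N. \<Sum>p<q. \<kappa> ^ (q - p) * (a p * a q)) \<le> L * (2 * \<kappa> * (\<Sum>p<N. (a p)^2))"
    by (intro mult_left_mono geometric_schur_sum L_nonneg \<kappa>_nonneg \<kappa>_le)
  moreover have "(\<Sum>p<N. b p) \<le> (\<Sum>p<N. \<integral>x. (u p x)^2 \<partial>M)" by (intro sum_mono low) auto
  ultimately show ?thesis by simp
qed

end

section \<open>Upper bound for partial sums of the pieces applied to a square integrable
  function\<close>

lemma integral_Cauchy_Schwarz:
  fixes f g :: "'a \<Rightarrow> real"
  assumes [measurable]: "f \<in> borel_measurable M" "g \<in> borel_measurable M"
    and f: "integrable M (\<lambda>x. (f x)^2)" and g: "integrable M (\<lambda>x. (g x)^2)"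
  shows "integrable M (\<lambda>x. f x * g x)"
    and "(LINT x|M. \<bar>f x * g x\<bar>)^2 \<le> (LINT x|M. (f x)^2) * (LINT x|M. (g x)^2)"
proof -
  have "(\<integral>\<^sup>+ x. ennreal \<bar>f x * g x\<bar> \<partial>M)^2 = (\<integral>\<^sup>+ x. ennreal \<bar>f x\<bar> * ennreal \<bar>g x\<bar> \<partial>M)^2"
    by (simp add: abs_mult ennreal_mult)
  also have "\<dots> \<le> (\<integral>\<^sup>+ x. ennreal \<bar>f x\<bar> ^ 2 \<partial>M) * (\<integral>\<^sup>+ x. ennreal \<bar>g x\<bar> ^ 2 \<partial>M)"
    by (rule Cauchy_Schwarz_nn_integral) measurable
  also have "\<dots> = ennreal (LINT x|M. (f x)^2) * ennreal (LINT x|M. (g x)^2)"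
    by (simp add: ennreal_power nn_integral_eq_integral f g)
  finally have *: "(\<integral>\<^sup>+ x. ennreal \<bar>f x * g x\<bar> \<partial>M)^2 \<le> ennreal ((LINT x|M. (f x)^2) * (LINT x|M. (g x)^2))"
    by (simp add: ennreal_mult)
  have "(\<integral>\<^sup>+ x. ennreal \<bar>f x * g x\<bar> \<partial>M) < \<infinity>"
  proof (rule ccontr)
    assume "\<not> ?thesis"
    then have "(\<integral>\<^sup>+ x. ennreal \<bar>f x * g x\<bar> \<partial>M) = \<infinity>" by (metis infinity_ennreal_def less_top)
    with * show False by (simp add: power2_eq_square ennreal_top_mult top_unique)
  qed
  then show I: "integrable M (\<lambda>x. f x * g x)" by (intro integrableI_bounded) auto
  have "(\<integral>\<^sup>+ x. ennreal \<bar>f x * g x\<bar> \<partial>M) = ennreal (LINT x|M. \<bar>f x * g x\<bar>)"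
    by (rule nn_integral_eq_integral) (use I in auto)
  with * show "(LINT x|M. \<bar>f x * g x\<bar>)^2 \<le> (LINT x|M. (f x)^2) * (LINT x|M. (g x)^2)"
    by (simp add: ennreal_power ennreal_le_iff)
qed

text \<open>Cauchy-Schwarz in p; the squared weights sum to at most 1. It turns the oscillation
  bound \<open>t_osc\<close> into a sum of squares that can be integrated level by level.\<close>

lemma sum_power_mult_square_le:
  fixes v :: "nat \<Rightarrow> real"
  assumes "0 \<le> \<kappa>" "\<kappa> \<le> 1/2"
  shows "(\<Sum>p<q. \<kappa> ^ (q - p) * v p)^2 \<le> (\<Sum>p<q. (v p)^2)"
proof -
  have "(\<Sum>p<q. (\<kappa> ^ (q - p))^2) = (\<Sum>i<q. (\<kappa> ^ Suc i)^2)"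
    by (rule sum.reindex_bij_witness[of _ "\<lambda>i. q - Suc i" "\<lambda>p. q - Suc p"]) (auto simp: Suc_diff_Suc)
  also have "\<dots> \<le> (\<Sum>i<q. (1/2) ^ Suc i)"
  proof (intro sum_mono)
    fix i
    have "(\<kappa> ^ Suc i)^2 \<le> ((1/2) ^ Suc i)^2" using assms by (intro power_mono) auto
    also have "\<dots> \<le> (1/2 :: real) ^ Suc i * 1"
      unfolding power2_eq_square by (intro mult_left_mono power_le_one) auto
    finally show "(\<kappa> ^ Suc i)^2 \<le> (1/2) ^ Suc i" by simp
  qed
  also have "\<dots> \<le> 1" by (simp add: sum_divide_distrib[symmetric] sum_gp_strict)
  finally have "(\<Sum>p<q. (\<kappa> ^ (q - p))^2) \<le> 1" .
  then have "(\<Sum>p<q. (\<kappa> ^ (q - p))^2) * (\<Sum>p<q. (v p)^2) \<le> 1 * (\<Sum>p<q. (v p)^2)"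
    by (intro mult_right_mono sum_nonneg) auto
  with Cauchy_Schwarz_ineq_sum[of "\<lambda>p. \<kappa> ^ (q - p)" v "{..<q}"] show ?thesis by linarith
qed

context finite_measure
begin

text \<open>The bound is required at every point, because functions are later evaluated at the
  centers \<open>z q x\<close>, which may form a null set. Closure under the algebraic operations
  settles the integrability goals.\<close>

definition bdd_fun :: "('a \<Rightarrow> real) \<Rightarrow> bool" where
  "bdd_fun g \<longleftrightarrow> g \<in> borel_measurable M \<and> (\<exists>B. \<forall>x. \<bar>g x\<bar> \<le> B)"

lemma bdd_funI: "g \<in> borel_measurable M \<Longrightarrow> (\<And>x. \<bar>g x\<bar> \<le> B) \<Longrightarrow> bdd_fun g"
  unfolding bdd_fun_def by blast

lemma bdd_fun_integrable: "bdd_fun g \<Longrightarrow> integrable M g"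
  unfolding bdd_fun_def by (elim conjE exE, rule integrable_const_bound) auto

lemma bdd_fun_measurable [measurable_dest]: "bdd_fun g \<Longrightarrow> g \<in> borel_measurable M"
  unfolding bdd_fun_def by blast

lemma bdd_fun_mult: "bdd_fun g \<Longrightarrow> bdd_fun h \<Longrightarrow> bdd_fun (\<lambda>x. g x * h x)"
proof -
  assume "bdd_fun g" "bdd_fun h"
  then obtain A B where AB: "g \<in> borel_measurable M" "h \<in> borel_measurable M" "\<And>x. \<bar>g x\<bar> \<le> A" "\<And>x. \<bar>h x\<bar> \<le> B"
    unfolding bdd_fun_def by blast
  have "\<bar>g x * h x\<bar> \<le> A * B" for x
    unfolding abs_mult using AB(3)[of x] AB(4)[of x] by (intro mult_mono) auto
  with AB show ?thesis by (intro bdd_funI[of _ "A * B"]) auto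
qed

lemma bdd_fun_diff: "bdd_fun g \<Longrightarrow> bdd_fun h \<Longrightarrow> bdd_fun (\<lambda>x. g x - h x)"
proof -
  assume "bdd_fun g" "bdd_fun h"
  then obtain A B where AB: "g \<in> borel_measurable M" "h \<in> borel_measurable M" "\<And>x. \<bar>g x\<bar> \<le> A" "\<And>x. \<bar>h x\<bar> \<le> B"
    unfolding bdd_fun_def by blast
  have "\<bar>g x - h x\<bar> \<le> A + B" for x
    using AB(3)[of x] AB(4)[of x] by linarith
  with AB show ?thesis by (intro bdd_funI[of _ "A + B"]) auto
qed

lemma bdd_fun_sum: "finite I \<Longrightarrow> (\<And>i. i \<in> I \<Longrightarrow> bdd_fun (g i)) \<Longrightarrow> bdd_fun (\<lambda>x. \<Sum>i\<in>I. g i x)"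
proof (induction I rule: finite_induct)
  case empty show ?case by (intro bdd_funI[of _ 0]) auto
next
  case (insert j I)
  then have "bdd_fun (\<lambda>x. g j x - - 1 * (\<Sum>i\<in>I. g i x))"
    by (intro bdd_fun_diff bdd_fun_mult bdd_funI[of "\<lambda>_. - 1" 1]) auto
  with insert show ?case by simp
qed

lemma bdd_fun_power2: "bdd_fun g \<Longrightarrow> bdd_fun (\<lambda>x. (g x)^2)"
  unfolding power2_eq_square by (rule bdd_fun_mult)

lemmas bdd_fun_intros = bdd_fun_mult bdd_fun_diff bdd_fun_sum bdd_fun_power2

end

text \<open>The bound \<open>b\<close> is qualitative: it makes \<open>U p f\<close> finite at every
  point, centers included, for f merely square integrable. The constants of the estimates do not
  depend on it.\<close>

locale bounded_kernel_tower = kernel_tower +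
  fixes b :: real
  assumes s_le: "\<And>p x y. p < N \<Longrightarrow> s p x y \<le> b"
begin

context
  fixes f :: "'a \<Rightarrow> real" and E :: real
  assumes f_measurable [measurable]: "f \<in> borel_measurable M"
    and f_sq: "integrable M (\<lambda>x. (f x)^2)" and f_le_1: "(LINT x|M. (f x)^2) \<le> 1"
    and E_pos: "0 < E" and E: "(\<Sum>p<N. (a p)^2) \<le> E"
begin

lemma integrable_f: "integrable M f" using integral_Cauchy_Schwarz(1)[of f M "\<lambda>_. 1"] f_sq by simp

text \<open>Positive majorant of \<open>U p f\<close>. It controls both the size of
  \<open>U p f\<close> and its variation over later cubes, and Schur's test bounds its L2 norm by
  \<open>a p\<close>.\<close>

definition V :: "nat \<Rightarrow> 'a \<Rightarrow> real" where
  "V p x = (LINT y|M. s p x y * \<bar>f y\<bar>)"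

lemma integrable_s_f: "p < N \<Longrightarrow> integrable M (\<lambda>y. s p x y * \<bar>f y\<bar>)"
proof -
  assume p: "p < N"
  have "integrable M (\<lambda>y. b * f y)" using integrable_f by simp
  then show ?thesis
  proof (rule Bochner_Integration.integrable_bound)
    show "AE y in M. norm (s p x y * \<bar>f y\<bar>) \<le> norm (b * f y)" using s_le[OF p] s_nonneg[OF p]
      by (intro always_eventually allI) (simp add: abs_mult mult_right_mono order.trans[of 0 "s p x _" b])
  qed (use p in measurable)
qed

lemma integrable_k_f: "p < N \<Longrightarrow> integrable M (\<lambda>y. k p x y * f y)"
  by (rule Bochner_Integration.integrable_bound[OF integrable_s_f[of p x]])
    (use k_le_s s_nonneg in \<open>auto simp: abs_mult mult_right_mono abs_of_nonneg\<close>)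

lemma abs_U_le_V: "p < N \<Longrightarrow> \<bar>U p f x\<bar> \<le> V p x"
proof -
  assume p: "p < N"
  have "\<bar>U p f x\<bar> \<le> (LINT y|M. \<bar>k p x y * f y\<bar>)" unfolding U_def by (rule integral_abs_bound)
  also have "\<dots> \<le> V p x" unfolding V_def using p k_le_s[OF p]
    by (intro integral_mono integrable_abs integrable_k_f integrable_s_f) (auto simp: abs_mult mult_right_mono)
  finally show ?thesis .
qed

lemma V_bounded: "p < N \<Longrightarrow> bdd_fun (V p)"
proof (rule bdd_funI)
  assume p: "p < N"
  note [measurable] = s_measurable[OF p]
  show "V p \<in> borel_measurable M" unfolding V_def by measurable
  fix x
  have "0 \<le> V p x" unfolding V_def using s_nonneg[OF p] by (intro integral_nonneg_AE) auto
  moreover have "V p x \<le> (LINT y|M. b * \<bar>f y\<bar>)" unfolding V_def using integrable_f s_le[OF p] p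
    by (intro integral_mono integrable_s_f) (auto intro: mult_right_mono)
  ultimately show "\<bar>V p x\<bar> \<le> (LINT y|M. b * \<bar>f y\<bar>)" by simp
qed

lemma V_nonneg: "p < N \<Longrightarrow> 0 \<le> V p x" using abs_U_le_V[of p x] by linarith

lemma U_bounded: "p < N \<Longrightarrow> bdd_fun (U p f)"
proof -
  assume p: "p < N"
  then obtain B where "\<And>x. \<bar>V p x\<bar> \<le> B" using V_bounded unfolding bdd_fun_def by blast
  then show ?thesis using abs_U_le_V[OF p] p
    by (intro bdd_funI[of _ B]) (auto intro: order_trans[OF _ order_trans[OF abs_ge_self]])
qed

lemma integral_V_sq: "p < N \<Longrightarrow> (LINT x|M. (V p x)^2) \<le> (a p)^2"
proof -
  assume p: "p < N"
  note [measurable] = s_measurable[OF p] V_bounded[OF p]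
  have "ennreal (LINT x|M. (V p x)^2) = (\<integral>\<^sup>+ x. ennreal ((V p x)^2) \<partial>M)"
    by (rule nn_integral_eq_integral[symmetric]) (auto intro!: bdd_fun_integrable bdd_fun_intros V_bounded p)
  also have "\<dots> = (\<integral>\<^sup>+ x. (\<integral>\<^sup>+ y. ennreal (s p x y) * ennreal \<bar>f y\<bar> \<partial>M)^2 \<partial>M)"
  proof (intro nn_integral_cong)
    fix x
    have "(\<integral>\<^sup>+ y. ennreal (s p x y) * ennreal \<bar>f y\<bar> \<partial>M) = (\<integral>\<^sup>+ y. ennreal (s p x y * \<bar>f y\<bar>) \<partial>M)"
      using s_nonneg[OF p] by (simp add: ennreal_mult)
    also have "\<dots> = ennreal (V p x)"
      unfolding V_def by (rule nn_integral_eq_integral[OF integrable_s_f[OF p]]) (use s_nonneg[OF p] in auto)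
    finally show "ennreal ((V p x)^2) = (\<integral>\<^sup>+ y. ennreal (s p x y) * ennreal \<bar>f y\<bar> \<partial>M)^2"
      using V_nonneg[OF p] by (simp add: ennreal_power)
  qed
  also have "\<dots> \<le> (ennreal (a p))^2 * (\<integral>\<^sup>+ y. (ennreal \<bar>f y\<bar>)^2 \<partial>M)"
    by (rule Schur_test_nn_integral) (use row[OF p] in \<open>auto simp: s_sym[OF p] intro: sigma_finite_measure_axioms\<close>)
  also have "(\<integral>\<^sup>+ y. (ennreal \<bar>f y\<bar>)^2 \<partial>M) = ennreal (LINT y|M. (f y)^2)"
    by (simp add: ennreal_power nn_integral_eq_integral f_sq)
  also have "(ennreal (a p))^2 * \<dots> \<le> ennreal ((a p)^2) * ennreal 1"
    using f_le_1 by (intro mult_mono) (auto simp: ennreal_power a_nonneg ennreal_le_1)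
  finally show ?thesis by (simp add: ennreal_le_iff)
qed

lemma integral_V_mult: "p < N \<Longrightarrow> q < N \<Longrightarrow> (LINT x|M. V p x * V q x) \<le> a p * a q"
proof -
  assume pq: "p < N" "q < N"
  note b = V_bounded[OF pq(1)] V_bounded[OF pq(2)]
  have "(LINT x|M. V p x * V q x)^2 = (LINT x|M. \<bar>V p x * V q x\<bar>)^2" using V_nonneg pq by simp
  also have "\<dots> \<le> (LINT x|M. (V p x)^2) * (LINT x|M. (V q x)^2)"
    by (intro integral_Cauchy_Schwarz) (auto intro!: bdd_fun_integrable bdd_fun_intros b bdd_fun_measurable)
  also have "\<dots> \<le> (a p)^2 * (a q)^2" by (intro mult_mono integral_V_sq pq) auto
  finally have "(LINT x|M. V p x * V q x)^2 \<le> (a p * a q)^2" by (simp add: power_mult_distrib)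
  then show ?thesis by (rule power2_le_imp_le) (simp add: a_nonneg)
qed

definition t :: "nat \<Rightarrow> 'a \<Rightarrow> real" where
  "t q x = (\<Sum>p<q. U p f x)"

lemma t_bounded: "q \<le> N \<Longrightarrow> bdd_fun (t q)" unfolding t_def by (intro bdd_fun_sum U_bounded) auto

lemma t_z_bounded: "q < N \<Longrightarrow> bdd_fun (\<lambda>x. t q (z q x))"
proof -
  assume q: "q < N"
  have [measurable]: "(\<lambda>x. t q (z q x)) \<in> borel_measurable M"
    using measurable_compose[OF z_measurable[OF q] bdd_fun_measurable[OF t_bounded[of q]]] q by simp
  obtain B where "\<And>x. \<bar>t q x\<bar> \<le> B" using t_bounded[of q] q unfolding bdd_fun_def by auto
  then show ?thesis using q by (intro bdd_funI[of _ B]) auto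
qed

lemma t_osc:
  assumes q: "q < N"
  shows "AE x in M. \<bar>t q x - t q (z q x)\<bar> \<le> L * (\<Sum>p<q. \<kappa> ^ (q - p) * V p x)"
proof -
  have "AE x in M. \<forall>p\<in>{..<q}. \<forall>y. \<bar>k p x y - k p (z q x) y\<bar> \<le> L * \<kappa> ^ (q - p) * s p x y"
    by (rule AE_finite_allI) (use smooth q in auto)
  then show ?thesis
  proof eventually_elim
    case (elim x)
    have "\<bar>U p f x - U p f (z q x)\<bar> \<le> L * (\<kappa> ^ (q - p) * V p x)" if p: "p < q" for p
    proof -
      have pN: "p < N" using p q by simp
      have "\<bar>U p f x - U p f (z q x)\<bar> = \<bar>\<integral>y. k p x y * f y - k p (z q x) y * f y \<partial>M\<bar>"
        unfolding U_def by (subst Bochner_Integration.integral_diff) (auto intro: integrable_k_f pN)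
      also have "\<dots> \<le> (LINT y|M. \<bar>k p x y * f y - k p (z q x) y * f y\<bar>)" by (rule integral_abs_bound)
      also have "\<dots> \<le> (LINT y|M. L * \<kappa> ^ (q - p) * (s p x y * \<bar>f y\<bar>))"
      proof (intro integral_mono integrable_abs Bochner_Integration.integrable_diff integrable_k_f pN
          integrable_mult_right integrable_s_f)
        fix y
        show "\<bar>k p x y * f y - k p (z q x) y * f y\<bar> \<le> L * \<kappa> ^ (q - p) * (s p x y * \<bar>f y\<bar>)"
          using mult_right_mono[of _ _ "\<bar>f y\<bar>", OF elim[rule_format, of p y]] p
          by (simp add: abs_mult[symmetric] left_diff_distrib mult.assoc)
      qed
      also have "\<dots> = L * (\<kappa> ^ (q - p) * V p x)" unfolding V_def by (simp add: mult.assoc)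
      finally show ?thesis .
    qed
    then have "(\<Sum>p<q. \<bar>U p f x - U p f (z q x)\<bar>) \<le> (\<Sum>p<q. L * (\<kappa> ^ (q - p) * V p x))"
      by (intro sum_mono) auto
    moreover have "\<bar>t q x - t q (z q x)\<bar> \<le> (\<Sum>p<q. \<bar>U p f x - U p f (z q x)\<bar>)"
      unfolding t_def sum_subtractf[symmetric] by (rule sum_abs)
    ultimately show ?case by (simp add: sum_distrib_left)
  qed
qed

text \<open>An L2 bound for \<open>t q\<close> says nothing by itself about its values on the
  possibly null set of centers; the oscillation estimate transfers it.\<close>

lemma integral_t_z_sq:
  assumes q: "q < N"
  shows "(LINT x|M. (t q (z q x))^2) \<le> 2 * (LINT x|M. (t q x)^2) + 2 * L^2 * E"
proof -
  have bV: "p < q \<Longrightarrow> bdd_fun (V p)" for p using V_bounded q by auto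
  have bt: "bdd_fun (t q)" using t_bounded q by auto
  have i: "integrable M (\<lambda>x. (t q x)^2)" "integrable M (\<lambda>x. (t q (z q x))^2)"
    "integrable M (\<lambda>x. \<Sum>p<q. (V p x)^2)"
    by (auto intro!: bdd_fun_integrable bdd_fun_intros bt t_z_bounded q bV)
  have "(LINT x|M. (t q (z q x))^2) \<le> (LINT x|M. 2 * (t q x)^2 + 2 * L^2 * (\<Sum>p<q. (V p x)^2))"
  proof (rule integral_mono_AE)
    show "AE x in M. (t q (z q x))^2 \<le> 2 * (t q x)^2 + 2 * L^2 * (\<Sum>p<q. (V p x)^2)" using t_osc[OF q]
    proof eventually_elim
      case (elim x)
      have "(t q (z q x))^2 \<le> 2 * (t q x)^2 + 2 * (t q x - t q (z q x))^2"
        using zero_le_power2[of "2 * t q x - t q (z q x)"] by (simp add: power2_eq_square algebra_simps)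
      moreover have "(t q x - t q (z q x))^2 \<le> (L * (\<Sum>p<q. \<kappa> ^ (q - p) * V p x))^2"
        using elim by (intro power2_le_iff_abs_le[THEN iffD2]) auto
      moreover have "\<dots> \<le> L^2 * (\<Sum>p<q. (V p x)^2)" unfolding power_mult_distrib
        by (intro mult_left_mono sum_power_mult_square_le \<kappa>_nonneg \<kappa>_le) auto
      ultimately show ?case by linarith
    qed
  qed (use i in auto)
  also have "\<dots> = 2 * (LINT x|M. (t q x)^2) + 2 * L^2 * (\<Sum>p<q. \<integral>x. (V p x)^2 \<partial>M)"
    using i bV by (simp add: Bochner_Integration.integral_sum bdd_fun_integrable bdd_fun_intros)
  also have "(\<Sum>p<q. \<integral>x. (V p x)^2 \<partial>M) \<le> E"
  proof -
    have "(\<Sum>p<q. \<integral>x. (V p x)^2 \<partial>M) \<le> (\<Sum>p<q. (a p)^2)"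
      using q by (intro sum_mono integral_V_sq) auto
    also have "\<dots> \<le> (\<Sum>p<N. (a p)^2)" using q by (intro sum_mono2) auto
    finally show ?thesis using E by linarith
  qed
  finally show ?thesis by (simp add: mult_left_mono)
qed

text \<open>Split \<open>t q\<close> into its value at the center and the rest. The rest is
  estimated by products of the majorants \<open>V\<close>; the central value passes through the
  piece by \<open>integral_U_eq\<close> and leaves the paraproduct.\<close>

lemma integral_t_U:
  assumes q: "q < N"
  shows "(LINT x|M. t q x * U q f x)
    \<le> L * (\<Sum>p<q. \<kappa> ^ (q - p) * (a p * a q)) - (LINT x|M. t q (z q x) * u q x * f x)"
proof -
  have bt: "bdd_fun (t q)" "bdd_fun (U q f)" "bdd_fun (\<lambda>x. t q (z q x))" "bdd_fun (V q)"
    "\<And>p. p < q \<Longrightarrow> bdd_fun (V p)"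
    using t_bounded U_bounded t_z_bounded V_bounded q by auto
  have iV: "integrable M (\<lambda>x. V p x * V q x)" if "p < q" for p
    by (intro bdd_fun_integrable bdd_fun_mult bt that)
  have iV': "integrable M (\<lambda>x. L * \<kappa> ^ (q - p) * (V p x * V q x))" if "p \<in> {..<q}" for p
    by (rule integrable_mult_right) (use iV that in auto)
  have const: "t q (z q x) = t q (z q y)" if "k q x y \<noteq> 0" for x y
    using z_const[OF order_refl q that] by simp
  obtain B where B: "\<And>x. \<bar>t q (z q x)\<bar> \<le> B" using bt(3) unfolding bdd_fun_def by auto
  have 1: "(LINT x|M. t q x * U q f x) = (LINT x|M. (t q x - t q (z q x)) * U q f x) + (LINT x|M. t q (z q x) * U q f x)"
    by (subst Bochner_Integration.integral_add[symmetric])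
       (auto intro!: bdd_fun_integrable bdd_fun_intros bt simp: algebra_simps)
  have 2: "(LINT x|M. t q (z q x) * U q f x) = - (LINT x|M. t q (z q x) * u q x * f x)"
    by (rule integral_U_eq[OF q integrable_f _ B const]) (use bt(3) in \<open>auto simp: bdd_fun_measurable\<close>)
  have "(LINT x|M. (t q x - t q (z q x)) * U q f x) \<le> (LINT x|M. (\<Sum>p<q. L * \<kappa> ^ (q - p) * (V p x * V q x)))"
  proof (rule integral_mono_AE)
    show "AE x in M. (t q x - t q (z q x)) * U q f x \<le> (\<Sum>p<q. L * \<kappa> ^ (q - p) * (V p x * V q x))"
      using t_osc[OF q]
    proof eventually_elim
      case (elim x)
      have "(t q x - t q (z q x)) * U q f x \<le> \<bar>t q x - t q (z q x)\<bar> * \<bar>U q f x\<bar>"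
        by (simp add: abs_mult[symmetric])
      also have "\<dots> \<le> (L * (\<Sum>p<q. \<kappa> ^ (q - p) * V p x)) * V q x"
        using elim by (intro mult_mono elim abs_U_le_V q) auto
      also have "\<dots> = (\<Sum>p<q. L * \<kappa> ^ (q - p) * (V p x * V q x))"
        by (simp add: sum_distrib_left sum_distrib_right mult.assoc)
      finally show ?case .
    qed
    show "integrable M (\<lambda>x. (t q x - t q (z q x)) * U q f x)"
      by (intro bdd_fun_integrable bdd_fun_mult bdd_fun_diff bt)
    show "integrable M (\<lambda>x. \<Sum>p<q. L * \<kappa> ^ (q - p) * (V p x * V q x))"
      by (rule Bochner_Integration.integrable_sum[OF iV'])
  qed
  also have "\<dots> = (\<Sum>p<q. \<integral>x. L * \<kappa> ^ (q - p) * (V p x * V q x) \<partial>M)"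
    by (rule Bochner_Integration.integral_sum[OF iV'])
  also have "\<dots> = (\<Sum>p<q. L * \<kappa> ^ (q - p) * (LINT x|M. V p x * V q x))" by simp
  also have "\<dots> \<le> (\<Sum>p<q. L * \<kappa> ^ (q - p) * (a p * a q))"
    using q by (intro sum_mono mult_left_mono integral_V_mult) (auto simp: L_nonneg \<kappa>_nonneg)
  also have "\<dots> = L * (\<Sum>p<q. \<kappa> ^ (q - p) * (a p * a q))" by (simp add: sum_distrib_left mult.assoc)
  finally show ?thesis using 1 2 by linarith
qed


text \<open>The factors \<open>t q (z q x)\<close> with q < Q are bounded by the same estimate for
  shorter sums, hence the strong induction. With C the asserted constant, the terms add up to
  \<open>(5 + 10 * L + L^2 / 2) * E + C / 2 * E\<close>, and C is chosen so that this equals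
  \<open>C * E\<close>.\<close>

theorem integral_sum_U_square_le:
  assumes "Q \<le> N"
  shows "(LINT x|M. (\<Sum>p<Q. U p f x)^2) \<le> (10 + 20 * L + L^2) * E"
  unfolding t_def[symmetric] using assms
proof (induction Q rule: less_induct)
  case (less Q)
  define C where "C = 10 + 20 * L + L^2"
  define G where "G = (2 * C + 2 * L^2) * E"
  define g where "g q x = t q (z q x)" for q x
  define W where "W x = (\<Sum>q<Q. g q x * u q x)" for x
  \<comment> \<open>Weight in Young's inequality for \<open>W * f\<close>: four times the factor of
    \<open>G\<close> in the bound for W, so that \<open>G / 4\<close> remains, which contains only
    half of \<open>C * E\<close>.\<close>
  define c where "c = 4 * (1 + 2 * L) * E"
  have C: "0 \<le> C" using L_nonneg by (simp add: C_def)
  have G0: "0 \<le> G" using C E_pos by (simp add: G_def)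
  have c: "0 < c" using L_nonneg E_pos by (simp add: c_def)
  have bg: "q < Q \<Longrightarrow> bdd_fun (g q)" for q
    unfolding g_def[abs_def] using t_z_bounded less.prems by auto
  have bu: "q < Q \<Longrightarrow> bdd_fun (u q)" for q
    using less.prems abs_u_le by (intro bdd_funI[of _ "a q"]) auto
  have bU: "q < Q \<Longrightarrow> bdd_fun (U q f)" and bt: "q < Q \<Longrightarrow> bdd_fun (t q)" for q
    using less.prems U_bounded t_bounded by auto
  have bW: "bdd_fun W" unfolding W_def[abs_def] by (intro bdd_fun_intros bg bu) auto
  have sumE: "(\<Sum>p<Q. (a p)^2) \<le> E"
    using E sum_mono2[of "{..<N}" "{..<Q}" "\<lambda>p. (a p)^2"] less.prems by auto
  have geo: "L * (\<Sum>q<Q. \<Sum>p<q. \<kappa> ^ (q - p) * (a p * a q)) \<le> L * E"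
  proof (rule mult_left_mono[OF _ L_nonneg])
    have "2 * \<kappa> * (\<Sum>p<Q. (a p)^2) \<le> 1 * (\<Sum>p<Q. (a p)^2)"
      by (intro mult_right_mono sum_nonneg) (use \<kappa>_le in auto)
    then show "(\<Sum>q<Q. \<Sum>p<q. \<kappa> ^ (q - p) * (a p * a q)) \<le> E"
      using geometric_schur_sum[OF \<kappa>_nonneg \<kappa>_le, of a Q] sumE by linarith
  qed
  have gG: "(LINT x|M. (g q x)^2) \<le> G" if q: "q < Q" for q
  proof -
    have "(LINT x|M. (g q x)^2) \<le> 2 * (LINT x|M. (t q x)^2) + 2 * L^2 * E"
      unfolding g_def using q less.prems by (intro integral_t_z_sq) auto
    also have "(LINT x|M. (t q x)^2) \<le> C * E" unfolding C_def using q less.prems by (intro less.IH) auto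
    finally show ?thesis by (simp add: G_def algebra_simps)
  qed
  have W2: "(LINT x|M. (W x)^2) \<le> (1 + 2 * L) * E * G"
  proof -
    have "(LINT x|M. (W x)^2) = (\<Sum>q<Q. \<integral>x. (g q x * u q x)^2 \<partial>M)
        + 2 * (\<Sum>q<Q. \<Sum>p<q. \<integral>x. (g p x * u p x) * (g q x * u q x) \<partial>M)"
      unfolding W_def by (intro integral_sum_square bdd_fun_integrable bdd_fun_mult bg bu)
    also have "(\<Sum>q<Q. \<integral>x. (g q x * u q x)^2 \<partial>M) \<le> (\<Sum>q<Q. (a q)^2 * G)"
    proof (intro sum_mono)
      fix q assume "q \<in> {..<Q}"
      then have q: "q < Q" by simp
      have "(LINT x|M. (g q x * u q x)^2) \<le> (LINT x|M. (a q)^2 * (g q x)^2)"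
      proof (intro integral_mono q integrable_mult_right bdd_fun_integrable bdd_fun_mult bdd_fun_power2 bg bu)
        fix x
        have "(u q x)^2 \<le> (a q)^2"
          using abs_u_le[of q x] q less.prems a_nonneg[of q] by (intro power2_le_iff_abs_le[THEN iffD2]) auto
        then show "(g q x * u q x)^2 \<le> (a q)^2 * (g q x)^2"
          unfolding power_mult_distrib mult.commute[of "(a q)^2"] by (intro mult_left_mono) auto
      qed
      also have "\<dots> \<le> (a q)^2 * G" using gG[OF q] by (simp add: mult_left_mono)
      finally show "(LINT x|M. (g q x * u q x)^2) \<le> (a q)^2 * G" .
    qed
    also have "(\<Sum>q<Q. (a q)^2 * G) \<le> E * G"
      unfolding sum_distrib_right[symmetric] by (intro mult_right_mono sumE G0)
    also have "(\<Sum>q<Q. \<Sum>p<q. \<integral>x. (g p x * u p x) * (g q x * u q x) \<partial>M)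
        \<le> (\<Sum>q<Q. \<Sum>p<q. L * (\<kappa> ^ (q - p) * (a p * a q)) * G)"
    proof (intro sum_mono)
      fix q p assume "q \<in> {..<Q}" "p \<in> {..<q}"
      then have pq: "p < q" "q < Q" "p < Q" "q < N" using less.prems by auto
      have bb: "bdd_fun (\<lambda>x. g p x * g q x)" by (intro bdd_fun_mult bg pq)
      then obtain B where B: "\<And>x. \<bar>g p x * g q x\<bar> \<le> B" unfolding bdd_fun_def by auto
      have "(LINT x|M. (g p x * u p x) * (g q x * u q x)) = (LINT x|M. (g p x * g q x) * u p x * u q x)"
        by (intro Bochner_Integration.integral_cong) (auto simp: ac_simps)
      \<comment> \<open>Both \<open>g p\<close> and \<open>g q\<close> depend on x only through its
        centers of levels p and q, and these agree at x and y wherever \<open>k q x y\<close> is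
        nonzero. So the product is an admissible weight.\<close>
      also have "\<dots> \<le> L * \<kappa> ^ (q - p) * (a p * a q) * (LINT x|M. \<bar>g p x * g q x\<bar>)"
      proof (rule order_trans[OF abs_ge_self], rule cross_bound[OF pq(1,4) _ B])
        fix x y assume k: "k q x y \<noteq> 0"
        show "g p x * g q x = g p y * g q y"
          using z_const[OF order_refl pq(4) k] z_const[OF less_imp_le[OF pq(1)] pq(4) k] by (simp add: g_def)
      qed (rule bdd_fun_measurable[OF bb])
      also have "\<dots> \<le> L * \<kappa> ^ (q - p) * (a p * a q) * G"
      proof (rule mult_left_mono)
        have ii: "integrable M (\<lambda>x. (g p x)^2)" "integrable M (\<lambda>x. (g q x)^2)"
          by (intro bdd_fun_integrable bdd_fun_intros bg pq)+
        have "(LINT x|M. \<bar>g p x * g q x\<bar>) \<le> (LINT x|M. (g p x)^2 / 2 + (g q x)^2 / 2)"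
        proof (rule integral_mono)
          fix x
          show "\<bar>g p x * g q x\<bar> \<le> (g p x)^2 / 2 + (g q x)^2 / 2"
            using sum_squares_bound[of "\<bar>g p x\<bar>" "\<bar>g q x\<bar>"] by (simp add: abs_mult)
        qed (use ii bdd_fun_integrable[OF bb] in auto)
        also have "\<dots> = (LINT x|M. (g p x)^2) / 2 + (LINT x|M. (g q x)^2) / 2" using ii by simp
        finally show "(LINT x|M. \<bar>g p x * g q x\<bar>) \<le> G" using gG[OF pq(2)] gG[OF pq(3)] by linarith
      qed (simp add: L_nonneg \<kappa>_nonneg a_nonneg)
      finally show "(LINT x|M. (g p x * u p x) * (g q x * u q x)) \<le> L * (\<kappa> ^ (q - p) * (a p * a q)) * G"
        by (simp add: mult.assoc)
    qed
    also have "\<dots> = (L * (\<Sum>q<Q. \<Sum>p<q. \<kappa> ^ (q - p) * (a p * a q))) * G"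
      unfolding sum_distrib_left sum_distrib_right by (rule refl)
    also have "\<dots> \<le> (L * E) * G" by (intro mult_right_mono geo G0)
    finally show ?thesis by (simp add: algebra_simps)
  qed
  have Wf: "- 2 * (LINT x|M. W x * f x) \<le> c + (1 + 2 * L) * E * G / c"
  proof -
    have iW: "integrable M (\<lambda>x. (W x)^2)" by (intro bdd_fun_integrable bdd_fun_intros bW)
    have iWf: "integrable M (\<lambda>x. W x * f x)"
      by (intro integral_Cauchy_Schwarz f_sq iW f_measurable bdd_fun_measurable[OF bW])
    have "- 2 * (LINT x|M. W x * f x) = (LINT x|M. - 2 * (W x * f x))" by simp
    also have "\<dots> \<le> (LINT x|M. c * (f x)^2 + (W x)^2 / c)"
    proof (rule integral_mono)
      fix x
      have "0 \<le> (c * f x + W x)^2 / c" using c by simp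
      also have "\<dots> = c * (f x)^2 + 2 * (W x * f x) + (W x)^2 / c"
        using c by (simp add: field_simps power2_eq_square)
      finally show "- 2 * (W x * f x) \<le> c * (f x)^2 + (W x)^2 / c" by simp
    qed (use iW iWf f_sq in auto)
    also have "\<dots> = c * (LINT x|M. (f x)^2) + (LINT x|M. (W x)^2) / c" using iW f_sq by simp
    also have "\<dots> \<le> c * 1 + (1 + 2 * L) * E * G / c"
      using c by (intro add_mono mult_left_mono f_le_1 divide_right_mono W2) auto
    finally show ?thesis by simp
  qed
  have iU: "\<And>q. q < Q \<Longrightarrow> integrable M (\<lambda>x. (U q f x)^2)"
    and itU: "\<And>q. q < Q \<Longrightarrow> integrable M (\<lambda>x. t q x * U q f x)"
    and iU': "integrable M (\<lambda>x. \<Sum>q<Q. (U q f x)^2)"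
    and itU': "integrable M (\<lambda>x. \<Sum>q<Q. t q x * U q f x)"
    by (auto intro!: bdd_fun_integrable bdd_fun_intros bU bt)
  have "(LINT x|M. (t Q x)^2) = (LINT x|M. (\<Sum>q<Q. (U q f x)^2) + 2 * (\<Sum>q<Q. t q x * U q f x))"
    unfolding t_def sum_square_expand sum_distrib_right by (rule refl)
  also have "\<dots> = (LINT x|M. (\<Sum>q<Q. (U q f x)^2)) + 2 * (LINT x|M. (\<Sum>q<Q. t q x * U q f x))"
    using iU' itU' by simp
  also have "(LINT x|M. (\<Sum>q<Q. (U q f x)^2)) = (\<Sum>q<Q. \<integral>x. (U q f x)^2 \<partial>M)"
    by (intro Bochner_Integration.integral_sum iU) auto
  also have "(LINT x|M. (\<Sum>q<Q. t q x * U q f x)) = (\<Sum>q<Q. \<integral>x. t q x * U q f x \<partial>M)"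
    by (intro Bochner_Integration.integral_sum itU) auto
  also have "(\<Sum>q<Q. \<integral>x. (U q f x)^2 \<partial>M) \<le> E"
  proof -
    have "(LINT x|M. (U q f x)^2) \<le> (a q)^2" if q: "q < Q" for q
    proof -
      have qN: "q < N" using q less.prems by simp
      have "(LINT x|M. (U q f x)^2) \<le> (LINT x|M. (V q x)^2)"
        by (intro integral_mono iU q bdd_fun_integrable bdd_fun_intros V_bounded qN
            power2_le_iff_abs_le[THEN iffD2] V_nonneg abs_U_le_V)
      also have "\<dots> \<le> (a q)^2" by (rule integral_V_sq[OF qN])
      finally show ?thesis .
    qed
    then have "(\<Sum>q<Q. \<integral>x. (U q f x)^2 \<partial>M) \<le> (\<Sum>q<Q. (a q)^2)" by (intro sum_mono) auto
    with sumE show ?thesis by linarith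
  qed
  also have "(\<Sum>q<Q. \<integral>x. t q x * U q f x \<partial>M) \<le> L * E - (LINT x|M. W x * f x)"
  proof -
    have iguf: "\<And>q. q < Q \<Longrightarrow> integrable M (\<lambda>x. g q x * u q x * f x)"
      by (intro integral_Cauchy_Schwarz f_sq f_measurable bdd_fun_measurable bdd_fun_integrable
          bdd_fun_intros bg bu)
    have "(\<Sum>q<Q. \<integral>x. t q x * U q f x \<partial>M)
        \<le> (\<Sum>q<Q. L * (\<Sum>p<q. \<kappa> ^ (q - p) * (a p * a q)) - (LINT x|M. g q x * u q x * f x))"
      unfolding g_def using less.prems by (intro sum_mono integral_t_U) auto
    also have "\<dots> = L * (\<Sum>q<Q. \<Sum>p<q. \<kappa> ^ (q - p) * (a p * a q)) - (\<Sum>q<Q. \<integral>x. g q x * u q x * f x \<partial>M)"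
      by (simp add: sum_subtractf sum_distrib_left)
    also have "(\<Sum>q<Q. \<integral>x. g q x * u q x * f x \<partial>M) = (LINT x|M. (\<Sum>q<Q. g q x * u q x * f x))"
      by (intro Bochner_Integration.integral_sum[symmetric] iguf) auto
    also have "(LINT x|M. (\<Sum>q<Q. g q x * u q x * f x)) = (LINT x|M. W x * f x)"
      by (simp add: W_def sum_distrib_right)
    finally show ?thesis using geo by linarith
  qed
  finally have "(LINT x|M. (t Q x)^2) \<le> E + 2 * (L * E) + (c + (1 + 2 * L) * E * G / c)" using Wf by simp
  also have "(1 + 2 * L) * E * G / c = G / 4"
  proof -
    have "(1 + 2 * L) * E * G / c = ((1 + 2 * L) * E) * G / (((1 + 2 * L) * E) * 4)"
      by (simp add: c_def mult.commute mult.left_commute)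
    also have "\<dots> = G / 4" using L_nonneg E_pos by (subst mult_divide_mult_cancel_left) auto
    finally show ?thesis .
  qed
  also have "E + 2 * (L * E) + (c + G / 4) = C * E" by (simp add: G_def C_def c_def algebra_simps)
  finally show ?case by (simp add: C_def)
qed

end
end

section \<open>The Riesz kernel\<close>

lemma L2_enorm_le_iff:
  assumes "0 \<le> c"
  shows "L2_enorm \<nu> f \<le> ennreal c \<longleftrightarrow> (\<integral>\<^sup>+ x. ennreal ((norm (f x))^2) \<partial>\<nu>) \<le> ennreal (c^2)"
proof (cases "(\<integral>\<^sup>+ x. ennreal ((norm (f x))^2) \<partial>\<nu>)")
  case (real r)
  then show ?thesis
    using assms real_sqrt_le_iff[of r "c^2"] by (simp add: L2_enorm_def ennreal_le_iff)
qed (simp add: L2_enorm_def top_unique)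

lemma L2_enorm_ge_iff:
  assumes "0 \<le> c"
  shows "ennreal c \<le> L2_enorm \<nu> f \<longleftrightarrow> ennreal (c^2) \<le> (\<integral>\<^sup>+ x. ennreal ((norm (f x))^2) \<partial>\<nu>)"
proof (cases "(\<integral>\<^sup>+ x. ennreal ((norm (f x))^2) \<partial>\<nu>)")
  case (real r)
  then show ?thesis
    using assms real_sqrt_le_iff[of "c^2" r] by (simp add: L2_enorm_def ennreal_le_iff)
qed (simp add: L2_enorm_def)

lemma norm_riesz_kernel: "norm (riesz_kernel s x) = norm x powr (- s)"
\<comment> \<open>At 0 both sides are 0, as \<open>0 powr _ = 0\<close>: neither the kernel nor its
  majorant is infinite on the diagonal.\<close>
proof (cases "x = 0")
  case False
  then have "norm (riesz_kernel s x) = norm x powr 1 / norm x powr (s + 1)" by (simp add: riesz_kernel_def)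
  also have "\<dots> = norm x powr (1 - (s + 1))" by (rule powr_diff[symmetric])
  finally show ?thesis by simp
qed (simp add: riesz_kernel_def)

lemma riesz_kernel_minus: "riesz_kernel s (- x) = - riesz_kernel s x" by (simp add: riesz_kernel_def)

lemma riesz_kernel_measurable [measurable]: "riesz_kernel s \<in> borel_measurable borel"
  unfolding riesz_kernel_def[abs_def] by measurable

lemma powr_minus_diff_le:
  fixes a b m p :: real
  assumes "0 < m" "m \<le> a" "m \<le> b" "0 \<le> p"
  shows "\<bar>a powr (- p) - b powr (- p)\<bar> \<le> p * m powr (- p - 1) * \<bar>a - b\<bar>"
proof -
  have "norm (b powr (- p) - a powr (- p)) \<le> (p * m powr (- p - 1)) * norm (b - a)"
  proof (rule field_differentiable_bound[of "{m..}" _ "\<lambda>t. - p * t powr (- p - 1)"])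
    fix t assume "t \<in> {m..}"
    then have t: "0 < t" "m \<le> t" using assms by auto
    show "((\<lambda>t. t powr (- p)) has_field_derivative - p * t powr (- p - 1)) (at t within {m..})"
      using t by (auto intro!: derivative_eq_intros)
    have "t powr (- p - 1) \<le> m powr (- p - 1)" using t assms by (intro powr_mono2') auto
    then show "norm (- p * t powr (- p - 1)) \<le> p * m powr (- p - 1)"
      using assms by (simp add: abs_mult mult_left_mono)
  qed (use assms in auto)
  then show ?thesis by (simp add: abs_minus_commute)
qed

text \<open>Lipschitz constant of the kernel K relative to its size. Write K(u) - K(v) as a multiple
  of u - v plus a difference of powers times v. The 1 is the first term; in the second, the mean
  value theorem on radii at least |u|/2 gives \<open>(s + 1) * 2 powr (s + 2)\<close>, and |v| \<le>
  2|u| gives the 2.\<close>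

definition riesz_lip :: "real \<Rightarrow> real" where
  "riesz_lip s = 1 + 2 * (s + 1) * 2 powr (s + 2)"

lemma riesz_kernel_diff_le:
  assumes s: "0 < s" and le: "norm (u - v) \<le> norm u / 2" and u: "u \<noteq> 0"
  shows "norm (riesz_kernel s u - riesz_kernel s v) \<le> riesz_lip s * (norm (u - v) / norm u) * norm u powr (- s)"
proof -
  define a b where "a = norm u" and "b = norm v"
  have a: "0 < a" using u by (simp add: a_def)
  have ab: "\<bar>a - b\<bar> \<le> norm (u - v)" unfolding a_def b_def by (rule norm_triangle_ineq3)
  then have b: "a / 2 \<le> b" "b \<le> 2 * a" using le a by (auto simp: a_def[symmetric] abs_le_iff)
  have K: "riesz_kernel s x = norm x powr (- (s + 1)) *\<^sub>R x" for x :: "real^'d"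
    unfolding riesz_kernel_def powr_minus_divide by simp
  have pw: "a powr (- (s + 1)) = a powr (- s) / a" using a powr_diff[of a "- s" 1] by simp
  have "riesz_kernel s u - riesz_kernel s v
      = a powr (- (s + 1)) *\<^sub>R (u - v) + (a powr (- (s + 1)) - b powr (- (s + 1))) *\<^sub>R v"
    unfolding K a_def b_def by (simp add: algebra_simps)
  then have le: "norm (riesz_kernel s u - riesz_kernel s v)
      \<le> a powr (- (s + 1)) * norm (u - v) + \<bar>a powr (- (s + 1)) - b powr (- (s + 1))\<bar> * b" unfolding b_def
    using norm_triangle_ineq[of "a powr (- (s + 1)) *\<^sub>R (u - v)" "(a powr (- (s + 1)) - norm v powr (- (s + 1))) *\<^sub>R v"]
    by (simp only: norm_scaleR abs_of_nonneg[OF powr_ge_zero])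
  define P X where "P = a powr (- (s + 1))" and "X = 2 powr (s + 2)"
  have PX: "0 \<le> P" "0 \<le> X" by (simp_all add: P_def X_def)
  have half: "(a / 2) powr (- (s + 1) - 1) = X * P / a"
  proof -
    have 1: "- (s + 1) - 1 = - (s + 2)" by simp
    have 2: "a powr (- (s + 2)) = P / a"
      using powr_diff[of a "- (s + 1)" 1] a unfolding P_def 1 by (simp only: powr_one less_imp_le)
    have gen: "P / a / (1 / X) = X * P / a" by simp
    show ?thesis unfolding 1 powr_divide 2 powr_minus_divide[of 2] X_def[symmetric] by (rule gen)
  qed
  have "\<bar>a powr (- (s + 1)) - b powr (- (s + 1))\<bar> \<le> (s + 1) * (a / 2) powr (- (s + 1) - 1) * \<bar>a - b\<bar>"
    using a b s by (intro powr_minus_diff_le) auto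
  then have 1: "\<bar>a powr (- (s + 1)) - b powr (- (s + 1))\<bar> \<le> (s + 1) * (X * P / a) * \<bar>a - b\<bar>"
    unfolding half .
  have nn: "0 \<le> (s + 1) * (X * P / a)" using s a PX by simp
  have "(s + 1) * (X * P / a) * \<bar>a - b\<bar> \<le> (s + 1) * (X * P / a) * norm (u - v)"
    by (rule mult_left_mono[OF ab nn])
  with 1 have "\<bar>a powr (- (s + 1)) - b powr (- (s + 1))\<bar> \<le> (s + 1) * (X * P / a) * norm (u - v)" by linarith
  then have "\<bar>a powr (- (s + 1)) - b powr (- (s + 1))\<bar> * b \<le> (s + 1) * (X * P / a) * norm (u - v) * (2 * a)"
    using b a by (rule_tac mult_mono) (auto intro: mult_nonneg_nonneg[OF nn])
  with le have "norm (riesz_kernel s u - riesz_kernel s v)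
      \<le> P * norm (u - v) + (s + 1) * (X * P / a) * norm (u - v) * (2 * a)" unfolding P_def by linarith
  also have "\<dots> = riesz_lip s * (norm (u - v) / norm u) * norm u powr (- s)"
    using a unfolding riesz_lip_def a_def[symmetric] X_def[symmetric] P_def pw by (simp add: field_simps)
  finally show ?thesis .
qed

text \<open>Dyadic shells: where \<rho> lies between \<open>D / 2 ^ Suc i\<close> and
  \<open>D / 2 ^ i\<close>, the integrand is taken at the inner radius and the mass at the outer
  one. This mismatch costs \<open>2 powr s\<close>, and s < d makes the shells a geometric series of
  ratio \<open>2 powr (s - d)\<close>.\<close>

lemma nn_integral_riesz_shells:
  fixes M :: "'a measure" and \<rho> :: "'a \<Rightarrow> real"
  assumes s: "0 < s" "s < real d" and D: "0 < D" and G: "0 \<le> G"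
    and [measurable]: "\<rho> \<in> borel_measurable M" "A \<in> sets M"
    and \<rho>: "\<And>y. y \<in> A \<Longrightarrow> 0 \<le> \<rho> y \<and> \<rho> y \<le> D"
    and growth: "\<And>r. 0 < r \<Longrightarrow> emeasure M {y\<in>A. \<rho> y \<le> r} \<le> ennreal (G * r ^ d)"
  shows "(\<integral>\<^sup>+ y. ennreal (indicator A y * \<rho> y powr (- s)) \<partial>M)
    \<le> ennreal (2 powr s / (1 - 2 powr (s - d)) * G * D powr (d - s))"
proof -
  define w where "w i = (D / 2 ^ Suc i) powr (- s)" for i
  define S where "S i = {y\<in>A. \<rho> y \<le> D / 2 ^ i}" for i :: nat
  have A: "A \<subseteq> space M" by (rule sets.sets_into_space) measurable
  have S_eq: "S i = A \<inter> {y\<in>space M. \<rho> y \<le> D / 2 ^ i}" for i using A unfolding S_def by auto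
  have [measurable]: "S i \<in> sets M" for i unfolding S_eq by measurable
  have "ennreal (indicator A y * \<rho> y powr (- s)) \<le> (\<Sum>i. ennreal (w i) * indicator (S i) y)" for y
  \<comment> \<open>A point with \<open>\<rho> y = 0\<close> contributes 0 because
    \<open>0 powr _ = 0\<close>, so only positive distances need a shell.\<close>
  proof (cases "y \<in> A \<and> \<rho> y \<noteq> 0")
    case True
    then have y: "y \<in> A" "0 < \<rho> y" "\<rho> y \<le> D" using \<rho>[of y] by auto
    define i where "i = (LEAST i. D / 2 ^ Suc i < \<rho> y)"
    have ex: "\<exists>i. D / 2 ^ Suc i < \<rho> y"
    proof -
      obtain n where "(1/2) ^ n < \<rho> y / D" using real_arch_pow_inv[of "\<rho> y / D" "1/2"] y D by auto
      then have "D / 2 ^ n < \<rho> y" using D by (simp add: field_simps)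
      moreover have "D / 2 ^ Suc n \<le> D / 2 ^ n" using D by (simp add: field_simps)
      ultimately show ?thesis by (intro exI[of _ n]) linarith
    qed
    have i1: "D / 2 ^ Suc i < \<rho> y" unfolding i_def by (rule LeastI_ex[OF ex])
    have i2: "\<rho> y \<le> D / 2 ^ i"
    proof (cases i)
      case (Suc j)
      then show ?thesis using not_less_Least[of j "\<lambda>i. D / 2 ^ Suc i < \<rho> y"] by (auto simp: i_def)
    qed (use y in auto)
    have "\<rho> y powr (- s) \<le> w i" unfolding w_def using i1 D s by (intro powr_mono2') auto
    then have "ennreal (indicator A y * \<rho> y powr (- s)) \<le> ennreal (w i) * indicator (S i) y"
      using y i2 by (simp add: S_def ennreal_leI)
    also have "\<dots> = (\<Sum>j\<in>{i}. ennreal (w j) * indicator (S j) y)"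
        by (subst sum.insert) (simp_all only: sum.empty add_0_right finite.emptyI empty_iff not_False_eq_True)
    also have "\<dots> \<le> (\<Sum>i. ennreal (w i) * indicator (S i) y)" by (intro sum_le_suminf) auto
    finally show ?thesis .
  qed auto
  then have "(\<integral>\<^sup>+ y. ennreal (indicator A y * \<rho> y powr (- s)) \<partial>M)
      \<le> (\<integral>\<^sup>+ y. (\<Sum>i. ennreal (w i) * indicator (S i) y) \<partial>M)"
    by (intro nn_integral_mono) auto
  also have "\<dots> = (\<Sum>i. \<integral>\<^sup>+ y. ennreal (w i) * indicator (S i) y \<partial>M)"
    by (rule nn_integral_suminf) measurable
  also have "\<dots> = (\<Sum>i. ennreal (w i) * emeasure M (S i))" by (simp add: nn_integral_cmult_indicator)
  also have "\<dots> \<le> (\<Sum>i. ennreal (2 powr s * G * D powr (d - s) * (2 powr (s - d)) ^ i))"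
  proof (rule suminf_le)
    fix i :: nat
    have "ennreal (w i) * emeasure M (S i) \<le> ennreal (w i) * ennreal (G * (D / 2 ^ i) ^ d)"
      unfolding S_def using D by (intro mult_left_mono growth) auto
    also have "\<dots> = ennreal (w i * (G * (D / 2 ^ i) ^ d))" using G D by (simp add: ennreal_mult w_def)
    also have "w i * (G * (D / 2 ^ i) ^ d) = 2 powr s * G * D powr (d - s) * (2 powr (s - d)) ^ i"
    proof -
      have two: "(2 ^ k) powr p = (2 powr p) ^ k" for k and p :: real
        by (induction k) (simp_all add: powr_mult)
      have "w i = 2 powr s * ((2 powr s) ^ i) * D powr (- s)" unfolding w_def using D
        by (simp add: powr_divide powr_mult two powr_minus_divide)
      moreover have "(D / 2 ^ i) ^ d = D powr d * ((2 powr (- real d)) ^ i)"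
        using D by (simp add: power_divide powr_realpow powr_minus_divide power_mult[symmetric] mult.commute)
      moreover have "D powr (d - s) = D powr d * D powr (- s)" by (simp add: powr_add[symmetric])
      moreover have "(2 powr (s - d)) ^ i = (2 powr s) ^ i * (2 powr (- real d)) ^ i"
        by (simp add: power_mult_distrib[symmetric] powr_add[symmetric])
      ultimately show ?thesis by simp
    qed
    finally show "ennreal (w i) * emeasure M (S i) \<le> ennreal (2 powr s * G * D powr (d - s) * (2 powr (s - d)) ^ i)" .
  qed auto
  also have "\<dots> = ennreal (\<Sum>i. 2 powr s * G * D powr (d - s) * (2 powr (s - d)) ^ i)"
    using G s by (intro suminf_ennreal2 summable_mult summable_geometric) (auto simp: powr_less_one)
  also have "(\<Sum>i. 2 powr s * G * D powr (d - s) * (2 powr (s - d)) ^ i)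
      = 2 powr s * G * D powr (d - s) * (1 / (1 - 2 powr (s - d)))"
    using s by (subst suminf_mult) (auto intro!: summable_geometric simp: powr_less_one suminf_geometric)
  finally show ?thesis by (simp add: mult.commute mult.left_commute)
qed

section \<open>Regularized lengths\<close>

context
  fixes \<alpha> :: real and n :: nat and \<sigma> :: "nat \<Rightarrow> real"
  assumes n: "1 \<le> n"
begin

lemma reg_index_Suc_bounds:
  assumes "reg_index \<alpha> n \<sigma> p < n"
  shows "reg_index \<alpha> n \<sigma> p < reg_index \<alpha> n \<sigma> (Suc p)" "reg_index \<alpha> n \<sigma> (Suc p) \<le> n"
proof -
  define j where "j = reg_index \<alpha> n \<sigma> p"
  define P where "P i \<longleftrightarrow> j < i \<and> \<sigma> i \<le> \<alpha> * (1/2) ^ (i - j) * \<sigma> j" for i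
  have eq: "reg_index \<alpha> n \<sigma> (Suc p) = (if P n then LEAST i. P i else n)"
    using assms by (auto simp: P_def j_def Let_def)
  have "j < (LEAST i. P i) \<and> (LEAST i. P i) \<le> n" if "P n"
    using LeastI[of P n, OF that] Least_le[of P n, OF that] by (auto simp: P_def)
  then show "reg_index \<alpha> n \<sigma> p < reg_index \<alpha> n \<sigma> (Suc p)" "reg_index \<alpha> n \<sigma> (Suc p) \<le> n"
    using assms unfolding eq j_def by auto
qed

lemma reg_index_le: "reg_index \<alpha> n \<sigma> p \<le> n"
proof (induction p)
  case (Suc p)
  then show ?case
    using reg_index_Suc_bounds(2)[of p] by (cases "reg_index \<alpha> n \<sigma> p < n") auto
qed (use n in simp)

text \<open>Below n the new index was produced by the least-element clause and inherits its
  inequality. At n the corresponding inequality is instead built into the length by the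
  minimum.\<close>

lemma reg_index_jump:
  assumes "reg_index \<alpha> n \<sigma> (Suc p) < n"
  shows "\<sigma> (reg_index \<alpha> n \<sigma> (Suc p))
    \<le> \<alpha> * (1/2) ^ (reg_index \<alpha> n \<sigma> (Suc p) - reg_index \<alpha> n \<sigma> p) * \<sigma> (reg_index \<alpha> n \<sigma> p)"
proof -
  define j where "j = reg_index \<alpha> n \<sigma> p"
  define P where "P i \<longleftrightarrow> j < i \<and> \<sigma> i \<le> \<alpha> * (1/2) ^ (i - j) * \<sigma> j" for i
  have eq: "reg_index \<alpha> n \<sigma> (Suc p) = (if P n then LEAST i. P i else n)"
    using assms by (auto simp: P_def j_def Let_def split: if_splits)
  then have "P n" "reg_index \<alpha> n \<sigma> (Suc p) = (LEAST i. P i)" using assms by (auto split: if_splits)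
  then have "P (reg_index \<alpha> n \<sigma> (Suc p))" using LeastI[of P n] by simp
  then show ?thesis by (simp add: P_def j_def del: reg_index.simps)
qed

lemma reg_index_reaches_n: "\<exists>p. reg_index \<alpha> n \<sigma> p = n"
proof (rule ccontr)
  assume "\<not> ?thesis"
  then have lt: "reg_index \<alpha> n \<sigma> p < n" for p using reg_index_le[of p] by (metis le_neq_implies_less)
  have "p < reg_index \<alpha> n \<sigma> p" for p
  proof (induction p)
    case (Suc p)
    then show ?case using reg_index_Suc_bounds(1)[OF lt[of p]] by linarith
  qed simp
  from this[of n] lt[of n] show False by simp
qed

lemma reg_index_top_level:
  obtains N where "reg_index \<alpha> n \<sigma> N = n" "\<And>p. p < N \<Longrightarrow> reg_index \<alpha> n \<sigma> p < reg_index \<alpha> n \<sigma> (Suc p)"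
    "\<And>p. p < N \<Longrightarrow> reg_index \<alpha> n \<sigma> p < n"
proof
  let ?N = "LEAST p. reg_index \<alpha> n \<sigma> p = n"
  show "reg_index \<alpha> n \<sigma> ?N = n" using reg_index_reaches_n by (rule LeastI_ex)
  show "reg_index \<alpha> n \<sigma> p < n" if "p < ?N" for p
    using not_less_Least[OF that] reg_index_le[of p] by linarith
  then show "reg_index \<alpha> n \<sigma> p < reg_index \<alpha> n \<sigma> (Suc p)" if "p < ?N" for p
    using that by (intro reg_index_Suc_bounds(1))
qed

lemma reg_index_mono: "p \<le> q \<Longrightarrow> reg_index \<alpha> n \<sigma> p \<le> reg_index \<alpha> n \<sigma> q"
proof (rule lift_Suc_mono_le[of "reg_index \<alpha> n \<sigma>"])
  fix p
  show "reg_index \<alpha> n \<sigma> p \<le> reg_index \<alpha> n \<sigma> (Suc p)"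
    using reg_index_Suc_bounds(1)[of p] reg_index_le[of p]
    by (cases "reg_index \<alpha> n \<sigma> p < n") auto
qed

lemma reg_block_start_eq:
  assumes "reg_index \<alpha> n \<sigma> p \<le> j" "j < reg_index \<alpha> n \<sigma> (Suc p)"
  shows "reg_block_start \<alpha> n \<sigma> j = reg_index \<alpha> n \<sigma> p"
proof -
  have "(THE p. reg_index \<alpha> n \<sigma> p \<le> j \<and> j < reg_index \<alpha> n \<sigma> (Suc p)) = p"
  proof (rule the_equality)
    fix q assume q: "reg_index \<alpha> n \<sigma> q \<le> j \<and> j < reg_index \<alpha> n \<sigma> (Suc q)"
    have "\<not> q < p" using reg_index_mono[of "Suc q" p] q assms by (metis Suc_leI leD le_less_trans order_less_le_trans)
    moreover have "\<not> p < q" using reg_index_mono[of "Suc p" q] q assms by (metis Suc_leI leD le_less_trans order_less_le_trans)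
    ultimately show "q = p" by linarith
  qed (use assms in auto)
  then show ?thesis by (simp add: reg_block_start_def)
qed

text \<open>The later geometry sees the lengths only through these facts: halving inside a block, a
  drop at each jump. The drop is \<alpha>/2 rather than \<alpha> because generation
  \<open>r (Suc p) - 1\<close> has been halved one time fewer than the exponent in the definition
  says.\<close>

lemma reg_length_structure:
  assumes \<alpha>: "0 < \<alpha>" and \<sigma>: "\<forall>j\<in>{1..n}. 0 < \<sigma> j"
  obtains N where "reg_index \<alpha> n \<sigma> N = n"
    "\<And>p. p < N \<Longrightarrow> reg_index \<alpha> n \<sigma> p < reg_index \<alpha> n \<sigma> (Suc p)"
    "range (reg_index \<alpha> n \<sigma>) = reg_index \<alpha> n \<sigma> ` {..N}"
    "\<And>j. 1 \<le> j \<Longrightarrow> j \<le> n \<Longrightarrow> 0 < reg_length \<alpha> n \<sigma> j"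
    "\<And>p j. p < N \<Longrightarrow> reg_index \<alpha> n \<sigma> p \<le> j \<Longrightarrow> Suc j < reg_index \<alpha> n \<sigma> (Suc p) \<Longrightarrow>
      reg_length \<alpha> n \<sigma> (Suc j) = reg_length \<alpha> n \<sigma> j / 2"
    "\<And>p. p < N \<Longrightarrow> reg_length \<alpha> n \<sigma> (reg_index \<alpha> n \<sigma> (Suc p))
      \<le> \<alpha> / 2 * reg_length \<alpha> n \<sigma> (reg_index \<alpha> n \<sigma> (Suc p) - 1)"
proof -
  define r where "r = reg_index \<alpha> n \<sigma>"
  define l where "l = reg_length \<alpha> n \<sigma>"
  obtain N where N: "r N = n" "\<And>p. p < N \<Longrightarrow> r p < r (Suc p)" "\<And>p. p < N \<Longrightarrow> r p < n"
    unfolding r_def using reg_index_top_level by blast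
  have r0: "r 0 = 1" by (simp add: r_def)
  have mono: "p \<le> q \<Longrightarrow> r p \<le> r q" for p q unfolding r_def by (rule reg_index_mono)
  have r1: "1 \<le> r p" for p using mono[of 0 p] r0 by simp
  have r_n: "r p \<le> n" for p unfolding r_def by (rule reg_index_le)
  have l_block: "l j = (1/2) ^ (j - r p) * \<sigma> (r p)" if "p < N" "r p \<le> j" "j < r (Suc p)" for p j
    using that r_n[of "Suc p"] reg_block_start_eq[of p j]
    by (auto simp: l_def reg_length_def r_def[symmetric] Let_def)
  have l_n: "l n = min (\<sigma> n) (\<alpha> * (1/2) ^ (n - r p) * \<sigma> (r p))" if "N = Suc p" for p
  proof -
    have "r p < n" using N(3)[of p] that by simp
    then have "1 < n" using r1[of p] by linarith
    moreover have "reg_block_start \<alpha> n \<sigma> (n - 1) = r p"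
      using \<open>r p < n\<close> N(1) that unfolding r_def by (intro reg_block_start_eq) auto
    ultimately show ?thesis by (simp add: l_def reg_length_def Let_def)
  qed
  have range: "range r = r ` {..N}"
  proof -
    have "r p \<in> r ` {..N}" for p
    proof (cases "p \<le> N")
      case False
      then have "r p = r N" using mono[of N p] r_n[of p] N(1) by simp
      then show ?thesis by blast
    qed auto
    then show ?thesis by blast
  qed
  have block: "\<exists>p<N. r p \<le> j \<and> j < r (Suc p)" if "1 \<le> j" "j < n" for j
  proof -
    define q where "q = (LEAST q. j < r q)"
    have q: "j < r q" unfolding q_def by (rule LeastI[of "\<lambda>q. j < r q" N]) (simp add: N(1) that)
    have "q \<le> N" unfolding q_def by (rule Least_le[of "\<lambda>q. j < r q" N]) (simp add: N(1) that)
    moreover have "q \<noteq> 0" using q r0 that by (cases q) auto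
    then obtain p where p: "q = Suc p" using not0_implies_Suc by blast
    moreover have "\<not> j < r p" using not_less_Least[of p "\<lambda>q. j < r q"] p by (simp add: q_def)
    ultimately show ?thesis using q by (intro exI[of _ p]) auto
  qed
  have pos: "0 < l j" if "1 \<le> j" "j \<le> n" for j
  proof (cases "j < n")
    case True
    then obtain p where "p < N" "r p \<le> j" "j < r (Suc p)" using block \<open>1 \<le> j\<close> by blast
    then show ?thesis using l_block \<sigma> r1[of p] r_n[of p] by simp
  next
    case False
    then have j: "j = n" using that by simp
    show ?thesis
    proof (cases N)
      case 0
      then have "n = 1" using N(1) r0 by simp
      then show ?thesis using j \<sigma> by (simp add: l_def reg_length_def)
    next
      case (Suc p)
      then show ?thesis using l_n[OF Suc] j \<sigma> r1[of p] r_n[of p] \<alpha> n by simp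
    qed
  qed
  have half: "l (Suc j) = l j / 2" if "p < N" "r p \<le> j" "Suc j < r (Suc p)" for p j
    using that l_block[of p j] l_block[of p "Suc j"] by (simp add: Suc_diff_le)
  have jump: "l (r (Suc p)) \<le> \<alpha> / 2 * l (r (Suc p) - 1)" if p: "p < N" for p
  proof -
    have lt: "r p < r (Suc p)" using N(2) p by simp
    have "l (r (Suc p) - 1) = (1/2) ^ (r (Suc p) - 1 - r p) * \<sigma> (r p)" using lt p by (intro l_block) auto
    then have "\<alpha> / 2 * l (r (Suc p) - 1) = \<alpha> * ((1/2) ^ Suc (r (Suc p) - 1 - r p)) * \<sigma> (r p)" by simp
    also have "Suc (r (Suc p) - 1 - r p) = r (Suc p) - r p" using lt by simp
    finally have eq: "\<alpha> / 2 * l (r (Suc p) - 1) = \<alpha> * (1/2) ^ (r (Suc p) - r p) * \<sigma> (r p)" .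
    show ?thesis
    proof (cases "Suc p = N")
      case True
      then show ?thesis using l_n[of p] N(1) unfolding eq by simp
    next
      case False
      then have pN: "Suc p < N" using p by simp
      have "l (r (Suc p)) = \<sigma> (r (Suc p))" using l_block[OF pN order_refl N(2)[OF pN]] by simp
      then show ?thesis unfolding eq using reg_index_jump[of p] N(3)[OF pN] by (simp add: r_def)
    qed
  qed
  show thesis
    by (rule that[of N]) (use N(1,2) range pos half jump in \<open>simp_all only: r_def l_def\<close>)
qed

end

section \<open>Cubes and their centers\<close>

lemma mem_cube: "x \<in> cube w l \<longleftrightarrow> (\<forall>i. \<bar>x $ i - w $ i\<bar> \<le> l / 2)"
proof -
  have "w $ i - l / 2 \<le> x $ i \<and> x $ i \<le> w $ i + l / 2 \<longleftrightarrow> \<bar>x $ i - w $ i\<bar> \<le> l / 2" for i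
    by linarith
  then show ?thesis by (simp add: cube_def mem_box_cart)
qed

lemma cube_borel [measurable]: "cube w l \<in> sets borel" by (simp add: cube_def)

lemma emeasure_lborel_cube:
  fixes w :: "real ^ 'd"
  assumes "0 \<le> l"
  shows "emeasure lborel (cube w l) = ennreal (l ^ CARD('d))"
proof -
  have *: "(\<chi> i. w $ i - l / 2) \<bullet> b \<le> (\<chi> i. w $ i + l / 2) \<bullet> b"
    "((\<chi> i. w $ i + l / 2) - (\<chi> i. w $ i - l / 2)) \<bullet> b = l" if "b \<in> Basis" for b :: "real ^ 'd"
    using that assms by (auto simp: Basis_vec_def inner_axis)
  show ?thesis
    unfolding cube_def using * by (subst emeasure_lborel_cbox) (auto simp: prod_constant)
qed

lemma measure_lborel_cube:
  fixes w :: "real ^ 'd"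
  assumes "0 \<le> l"
  shows "measure lborel (cube w l) = l ^ CARD('d)"
  using emeasure_lborel_cube[OF assms, of w] assms by (simp add: measure_def)

lemma cube_fmeasurable: "0 \<le> l \<Longrightarrow> cube w l \<in> fmeasurable lborel"
  by (auto simp: fmeasurable_def emeasure_lborel_cube)

lemma center_mem_cube: "0 \<le> l \<Longrightarrow> w \<in> cube w l" by (simp add: mem_cube)

lemma cube_mono:
  assumes "l \<le> l'"
  shows "cube w l \<subseteq> cube w l'"
proof
  fix x assume "x \<in> cube w l"
  then have "\<bar>x $ i - w $ i\<bar> \<le> l / 2" for i by (simp add: mem_cube)
  with assms have "\<bar>x $ i - w $ i\<bar> \<le> l' / 2" for i
    by (meson divide_right_mono order_trans zero_le_numeral)
  then show "x \<in> cube w l'" by (simp add: mem_cube)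
qed

lemma cube_eq_iff:
  assumes "0 \<le> l"
  shows "cube w l = cube w' l \<longleftrightarrow> w = w'"
proof
  assume eq: "cube w l = cube w' l"
  have "(\<chi> i. w $ i + l / 2) \<in> cube w' l" "(\<chi> i. w $ i - l / 2) \<in> cube w' l"
    unfolding eq[symmetric] using assms by (auto simp: mem_cube)
  then have "\<bar>w $ i + l / 2 - w' $ i\<bar> \<le> l / 2" "\<bar>w $ i - l / 2 - w' $ i\<bar> \<le> l / 2" for i
    by (auto simp: mem_cube)
  then have "w $ i = w' $ i" for i by (smt (verit))
  then show "w = w'" by (simp add: vec_eq_iff)
qed simp

lemma AE_lborel_component_neq: "AE x in lborel. (x :: real ^ 'd) $ i \<noteq> c"
proof -
  have "{x :: real ^ 'd. x $ i = c} \<in> null_sets lebesgue"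
    using negligible_standard_hyperplane[of "axis i 1 :: real ^ 'd" c] by (simp add: negligible_iff_null_sets inner_axis)
  moreover have "{x :: real ^ 'd. x $ i = c} \<in> sets lborel" by simp
  ultimately have "{x :: real ^ 'd. x $ i = c} \<in> null_sets lborel" by (simp add: null_sets_def)
  then show ?thesis by (rule AE_I') auto
qed

text \<open>Closed cubes whose centers are exactly one edge apart may share a face. It lies in the
  hyperplane halfway between the centers, which is a null set.\<close>

lemma AE_lborel_cube_disjoint:
  fixes w w' :: "real ^ 'd"
  assumes "l \<le> \<bar>w $ i - w' $ i\<bar>"
  shows "AE x in lborel. x \<notin> cube w l \<or> x \<notin> cube w' l"
  using AE_lborel_component_neq[of i "(w $ i + w' $ i) / 2"]
proof eventually_elim
  case (elim x)
  show ?case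
  proof (rule ccontr)
    assume "\<not> ?case"
    then have "\<bar>x $ i - w $ i\<bar> \<le> l / 2" "\<bar>x $ i - w' $ i\<bar> \<le> l / 2" by (auto simp: mem_cube)
    with assms elim show False by (auto simp: abs_le_iff abs_if split: if_splits)
  qed
qed

section \<open>Offsets from a cube's center to those of its children\<close>

definition sign_vectors :: "real \<Rightarrow> (real ^ 'd) set" where
  "sign_vectors a = {v. \<forall>i. v $ i = a \<or> v $ i = - a}"

lemma sign_vectors_eq_image: "sign_vectors a = (\<lambda>b. \<chi> i. if b i then a else - a) ` (UNIV :: ('d::finite \<Rightarrow> bool) set)"
proof (intro set_eqI iffI)
  fix v :: "real ^ 'd" assume "v \<in> sign_vectors a"
  then have "v = (\<chi> i. if v $ i = a then a else - a)" by (auto simp: sign_vectors_def vec_eq_iff)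
  then show "v \<in> (\<lambda>b. \<chi> i. if b i then a else - a) ` UNIV" by (rule image_eqI[of _ _ "\<lambda>i. v $ i = a"]) simp
qed (auto simp: sign_vectors_def)

lemma finite_sign_vectors: "finite (sign_vectors a :: (real ^ 'd) set)" unfolding sign_vectors_eq_image by simp

lemma card_sign_vectors:
  assumes "a \<noteq> 0"
  shows "card (sign_vectors a :: (real ^ 'd) set) = 2 ^ CARD('d)"
proof -
  have "inj (\<lambda>b. (\<chi> i. if b i then a else - a) :: real ^ 'd)"
    using assms by (auto simp: inj_def vec_eq_iff fun_eq_iff split: if_splits)
  then have "card (sign_vectors a :: (real ^ 'd) set) = CARD('d \<Rightarrow> bool)"
    unfolding sign_vectors_eq_image by (rule card_image)
  then show ?thesis by (simp add: card_fun)
qed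

text \<open>Containment bounds each coordinate of the offset by \<open>T * l - l / 2\<close>, and
  touching a vertex forces equality in each coordinate.\<close>

lemma corner_cubes_eq:
  fixes w :: "real ^ 'd"
  assumes "1 \<le> T" "0 < l"
  shows "corner_cubes w (2 * T * l) l = (\<lambda>v. cube (w + v) l) ` sign_vectors (T * l - l / 2)"
proof (intro set_eqI iffI)
  fix Q assume "Q \<in> corner_cubes w (2 * T * l) l"
  then obtain u v where Q: "Q = cube u l" and sub: "cube u l \<subseteq> cube w (2 * T * l)"
    and v: "v \<in> cube_vertices w (2 * T * l)" "v \<in> cube u l" unfolding corner_cubes_def by blast
  have "(\<chi> i. u $ i + l / 2) \<in> cube w (2 * T * l)" "(\<chi> i. u $ i - l / 2) \<in> cube w (2 * T * l)"
    by (rule subsetD[OF sub], use assms in \<open>simp add: mem_cube\<close>)+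
  then have "\<bar>u $ i + l / 2 - w $ i\<bar> \<le> T * l" "\<bar>u $ i - l / 2 - w $ i\<bar> \<le> T * l" for i
    by (auto simp: mem_cube)
  moreover have "v $ i = w $ i - T * l \<or> v $ i = w $ i + T * l" "\<bar>v $ i - u $ i\<bar> \<le> l / 2" for i
    using v by (auto simp: mem_cube cube_vertices_def)
  ultimately have "(u - w) $ i = T * l - l / 2 \<or> (u - w) $ i = - (T * l - l / 2)" for i
    unfolding vector_minus_component by (smt (verit) field_sum_of_halves)
  then have "u - w \<in> sign_vectors (T * l - l / 2)" by (simp add: sign_vectors_def)
  then show "Q \<in> (\<lambda>v. cube (w + v) l) ` sign_vectors (T * l - l / 2)"
    by (rule image_eqI[rotated]) (simp add: Q)
next
  fix Q assume "Q \<in> (\<lambda>v. cube (w + v) l) ` sign_vectors (T * l - l / 2)"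
  then obtain v where Q: "Q = cube (w + v) l" and v: "\<And>i. v $ i = T * l - l / 2 \<or> v $ i = - (T * l - l / 2)"
    by (auto simp: sign_vectors_def)
  have Tl: "l \<le> T * l" using assms by simp
  have "cube (w + v) l \<subseteq> cube w (2 * T * l)"
  proof
    fix x assume x: "x \<in> cube (w + v) l"
    have "\<bar>x $ i - w $ i\<bar> \<le> T * l" for i
    proof -
      have "\<bar>x $ i - (w $ i + v $ i)\<bar> \<le> l / 2" using x by (simp add: mem_cube)
      with v[of i] Tl assms(2) show ?thesis by linarith
    qed
    then show "x \<in> cube w (2 * T * l)" by (simp add: mem_cube)
  qed
  moreover define y where "y = (\<chi> i. if v $ i = T * l - l / 2 then w $ i + T * l else w $ i - T * l)"
  have "\<bar>y $ i - (w $ i + v $ i)\<bar> \<le> l / 2" for i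
    using v[of i] assms(2) by (auto simp: y_def)
  then have "y \<in> cube (w + v) l" by (simp add: mem_cube)
  moreover have "y \<in> cube_vertices w (2 * T * l)" by (simp add: cube_vertices_def y_def)
  ultimately show "Q \<in> corner_cubes w (2 * T * l) l" unfolding corner_cubes_def Q by blast
qed

lemma dyadic_cubes_eq: "dyadic_cubes w l = (\<lambda>v. cube (w + v) (l / 2)) ` sign_vectors (l / 4)"
proof (intro set_eqI iffI)
  fix Q assume "Q \<in> dyadic_cubes w l"
  then obtain u where Q: "Q = cube u (l / 2)" and u: "\<And>i. u $ i = w $ i - l / 4 \<or> u $ i = w $ i + l / 4"
    unfolding dyadic_cubes_def by blast
  have "u - w \<in> sign_vectors (l / 4)" unfolding sign_vectors_def
  proof (intro CollectI allI)
    fix i show "(u - w) $ i = l / 4 \<or> (u - w) $ i = - (l / 4)" using u[of i] by auto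
  qed
  then show "Q \<in> (\<lambda>v. cube (w + v) (l / 2)) ` sign_vectors (l / 4)"
    by (rule image_eqI[rotated]) (simp add: Q)
next
  fix Q assume "Q \<in> (\<lambda>v. cube (w + v) (l / 2)) ` sign_vectors (l / 4)"
  then obtain v where Q: "Q = cube (w + v) (l / 2)" and v: "\<And>i. v $ i = l / 4 \<or> v $ i = - (l / 4)"
    by (auto simp: sign_vectors_def)
  have "\<forall>i. (w + v) $ i = w $ i - l / 4 \<or> (w + v) $ i = w $ i + l / 4" using v by (metis add.commute uminus_add_conv_diff vector_add_component)
  then show "Q \<in> dyadic_cubes w l" unfolding dyadic_cubes_def Q by blast
qed

text \<open>Corner placement and dyadic splitting differ only in the size \<delta> of the offset, so
  one recursion on centers covers both.\<close>

primrec centers :: "(nat \<Rightarrow> real) \<Rightarrow> nat \<Rightarrow> (real ^ 'd) set" where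
  "centers \<delta> 0 = {0}"
| "centers \<delta> (Suc j) = (\<lambda>(w, v). w + v) ` (centers \<delta> j \<times> sign_vectors (\<delta> (Suc j)))"

lemma finite_centers: "finite (centers \<delta> j)" by (induction j) (auto simp: finite_sign_vectors)

text \<open>A cube of known nonnegative edge determines its center, so the recursion on sets of
  cubes is a recursion on centers.\<close>

lemma cantor_cubes_eq_centers:
  fixes \<alpha> T :: real and n :: nat and \<sigma> \<delta> :: "nat \<Rightarrow> real"
  defines "l \<equiv> reg_length \<alpha> n \<sigma>" and "J \<equiv> range (reg_index \<alpha> n \<sigma>)"
  assumes T: "1 \<le> T" and pos: "\<And>j. 1 \<le> j \<Longrightarrow> j \<le> n \<Longrightarrow> 0 < l j"
    and half: "\<And>j. 1 \<le> j \<Longrightarrow> Suc j \<le> n \<Longrightarrow> Suc j \<notin> J \<Longrightarrow> l (Suc j) = l j / 2"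
    and \<delta>: "\<And>j. 1 \<le> j \<Longrightarrow> j \<le> n \<Longrightarrow> \<delta> j = (if j \<in> J then T * l j - l j / 2 else l j / 2)"
    and j: "Suc j \<le> n"
  shows "cantor_cubes \<alpha> T n \<sigma> (Suc j) = (\<lambda>w. cube w (l (Suc j))) ` (centers \<delta> (Suc j) :: (real ^ 'd) set)"
  using j
proof (induction j)
  case 0
  have "1 \<in> J" unfolding J_def by (rule range_eqI[of _ _ 0]) simp
  moreover have "centers \<delta> (Suc 0) = (sign_vectors (\<delta> 1) :: (real ^ 'd) set)" by force
  ultimately show ?case using 0 T pos[of 1] \<delta>[of 1]
    by (simp add: corner_cubes_eq l_def[symmetric] del: centers.simps)
next
  case (Suc j)
  have l: "0 < l (Suc j)" "0 < l (Suc (Suc j))" using pos Suc.prems by auto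
  have "{w. cube w (l (Suc j)) \<in> cantor_cubes \<alpha> T n \<sigma> (Suc j)} = (centers \<delta> (Suc j) :: (real ^ 'd) set)"
    using Suc l by (auto simp: cube_eq_iff simp del: centers.simps)
  then have "cantor_cubes \<alpha> T n \<sigma> (Suc (Suc j)) = (\<Union>w\<in>(centers \<delta> (Suc j) :: (real ^ 'd) set).
        if Suc (Suc j) \<in> J then corner_cubes w (2 * T * l (Suc (Suc j))) (l (Suc (Suc j))) else dyadic_cubes w (l (Suc j)))"
    by (simp add: Let_def l_def[symmetric] J_def[symmetric] del: centers.simps cong: if_cong)
  also have "\<dots> = (\<Union>w\<in>(centers \<delta> (Suc j) :: (real ^ 'd) set).
      (\<lambda>v. cube (w + v) (l (Suc (Suc j)))) ` sign_vectors (\<delta> (Suc (Suc j))))"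
  proof (cases "Suc (Suc j) \<in> J")
    case True
    then show ?thesis using T l \<delta>[of "Suc (Suc j)"] Suc.prems by (simp add: corner_cubes_eq del: centers.simps)
  next
    case False
    then have eq: "l (Suc (Suc j)) = l (Suc j) / 2" "\<delta> (Suc (Suc j)) = l (Suc j) / 4"
      using half[of "Suc j"] \<delta>[of "Suc (Suc j)"] Suc.prems by auto
    show ?thesis unfolding eq using False by (simp add: dyadic_cubes_eq del: centers.simps)
  qed
  also have "\<dots> = (\<lambda>w. cube w (l (Suc (Suc j)))) ` (centers \<delta> (Suc (Suc j)))"
    by (auto simp del: centers.simps simp: centers.simps(2)[of _ "Suc j"])
  finally show ?case .
qed

section \<open>Mass and growth of the Cantor measure\<close>

text \<open>The regularized lengths in the case T = 2. The type argument \<open>dim\<close> carries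
  the dimension, which the other parameters do not mention. By \<alpha> \<le> 1/4 an enlarged cube
  of edge \<open>4 * l (r (Suc p))\<close> is at most half as wide as the cube around which it is
  centered.\<close>

locale cantor_tree =
  fixes dim :: "'d::finite itself" and \<alpha> :: real and n N :: nat and r :: "nat \<Rightarrow> nat" and l :: "nat \<Rightarrow> real"
  assumes \<alpha>_pos: "0 < \<alpha>" and \<alpha>_le: "\<alpha> \<le> 1/4"
    and r_0: "r 0 = 1" and r_N: "r N = n" and r_Suc: "\<And>p. p < N \<Longrightarrow> r p < r (Suc p)"
    and l_pos: "\<And>j. 1 \<le> j \<Longrightarrow> j \<le> n \<Longrightarrow> 0 < l j"
    and l_half: "\<And>p j. p < N \<Longrightarrow> r p \<le> j \<Longrightarrow> Suc j < r (Suc p) \<Longrightarrow> l (Suc j) = l j / 2"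
    and l_jump: "\<And>p. p < N \<Longrightarrow> l (r (Suc p)) \<le> \<alpha> / 2 * l (r (Suc p) - 1)"
begin

text \<open>The first cube has edge 2T times \<open>l 1\<close>, and T = 2. With this value
  generation 1 obeys the same inclusions as the later ones.\<close>

definition L :: "nat \<Rightarrow> real" where
  "L j = (if j = 0 then 4 * l 1 else l j)"

text \<open>At a jump the children sit in the corners of a cube of edge \<open>4 * l j\<close>,
  again with T = 2; otherwise they are the dyadic parts of their parent.\<close>

definition \<delta> :: "nat \<Rightarrow> real" where
  "\<delta> j = (if j \<in> r ` {..N} then 2 * l j - l j / 2 else l j / 2)"

abbreviation W :: "nat \<Rightarrow> (real ^ 'd) set" where
  "W \<equiv> centers \<delta>"

lemma r_less: "p < q \<Longrightarrow> q \<le> N \<Longrightarrow> r p < r q"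
proof (induction q)
  case (Suc q)
  then show ?case using r_Suc[of q] by (cases "p = q") auto
qed simp

lemma r_mono: "p \<le> q \<Longrightarrow> q \<le> N \<Longrightarrow> r p \<le> r q"
  using r_less[of p q] by (cases "p = q") auto

lemma r_bounds: "p \<le> N \<Longrightarrow> 1 \<le> r p" "p \<le> N \<Longrightarrow> r p \<le> n"
  using r_mono[of 0 p] r_mono[of p N] r_0 r_N by auto

lemma n_pos: "1 \<le> n" using r_bounds(1)[of N] r_N by simp

lemma block:
  assumes "1 \<le> j" "j < n"
  obtains p where "p < N" "r p \<le> j" "j < r (Suc p)"
proof -
  define q where "q = (LEAST q. j < r q)"
  have q: "j < r q" unfolding q_def by (rule LeastI[of "\<lambda>q. j < r q" N]) (simp add: r_N assms)
  have "q \<le> N" unfolding q_def by (rule Least_le[of "\<lambda>q. j < r q" N]) (simp add: r_N assms)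
  moreover have "q \<noteq> 0" using q r_0 assms by (cases q) auto
  then obtain p where p: "q = Suc p" using not0_implies_Suc by blast
  moreover have "\<not> j < r p" using not_less_Least[of p "\<lambda>q. j < r q"] p by (simp add: q_def)
  ultimately show thesis using q that[of p] by simp
qed

lemma L_pos: "j \<le> n \<Longrightarrow> 0 < L j" using l_pos n_pos by (auto simp: L_def)

lemma jump_le2: "p < N \<Longrightarrow> 8 * l (r (Suc p)) \<le> L (r (Suc p) - 1)"
proof -
  assume p: "p < N"
  then have j: "1 < r (Suc p)" using r_Suc[OF p] r_bounds[of p] by simp
  have "0 < l (r (Suc p) - 1)" using j r_bounds[of "Suc p"] p by (intro l_pos) auto
  then have "\<alpha> / 2 * l (r (Suc p) - 1) \<le> 1 / 8 * l (r (Suc p) - 1)" using \<alpha>_le by (intro mult_right_mono) auto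
  moreover have "L (r (Suc p) - 1) = l (r (Suc p) - 1)" using j by (simp add: L_def)
  ultimately show ?thesis using l_jump[OF p] by linarith
qed

lemma jump_le: "p \<le> N \<Longrightarrow> 4 * l (r p) \<le> L (r p - 1)"
proof (cases p)
  case (Suc q)
  assume "p \<le> N"
  then show ?thesis using Suc jump_le2[of q] l_pos[of "r p"] r_bounds[of p] by simp
qed (simp add: r_0 L_def)

lemma nonjump:
  assumes "Suc j \<le> n" "Suc j \<notin> r ` {..N}"
  shows "1 \<le> j" "l (Suc j) = l j / 2"
proof -
  have "Suc j \<noteq> r 0" "Suc j \<noteq> r N" using assms(2) by auto
  then show j: "1 \<le> j" using r_0 by simp
  have "j < n" using assms(1) by simp
  then obtain p where p: "p < N" "r p \<le> j" "j < r (Suc p)" using block[OF j] by blast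
  then have "Suc j \<noteq> r (Suc p)" using assms(2) by auto
  with p show "l (Suc j) = l j / 2" by (intro l_half[of p]) auto
qed

text \<open>Siblings do not overlap, and children stay inside their parent. The separation of all
  cubes of a generation follows from these inequalities alone.\<close>

lemma child_bounds:
  assumes "Suc j \<le> n"
  shows "0 < \<delta> (Suc j)" "l (Suc j) \<le> 2 * \<delta> (Suc j)" "\<delta> (Suc j) + l (Suc j) / 2 \<le> L j / 2"
proof -
  have l: "0 < l (Suc j)" using assms by (intro l_pos) auto
  then show "0 < \<delta> (Suc j)" "l (Suc j) \<le> 2 * \<delta> (Suc j)" by (auto simp: \<delta>_def)
  show "\<delta> (Suc j) + l (Suc j) / 2 \<le> L j / 2"
  proof (cases "Suc j \<in> r ` {..N}")
    case True
    then obtain p where p: "p \<le> N" "Suc j = r p" by auto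
    then have "4 * l (Suc j) \<le> L j" using jump_le[of p] by (metis diff_Suc_1)
    with True show ?thesis by (simp add: \<delta>_def)
  next
    case False
    then show ?thesis using nonjump[OF assms] by (simp add: \<delta>_def L_def)
  qed
qed

lemma sign_vectors_abs: "v \<in> sign_vectors a \<Longrightarrow> 0 \<le> a \<Longrightarrow> \<bar>v $ i\<bar> = a"
  by (auto simp: sign_vectors_def) (metis abs_minus_cancel abs_of_nonneg)

lemma child_subset:
  assumes "Suc j \<le> n" "v \<in> sign_vectors (\<delta> (Suc j))"
  shows "cube (w + v) (l (Suc j)) \<subseteq> cube w (L j)"
proof
  fix x assume "x \<in> cube (w + v) (l (Suc j))"
  then have x: "\<bar>x $ i - (w $ i + v $ i)\<bar> \<le> l (Suc j) / 2" for i by (simp add: mem_cube)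
  have v: "\<bar>v $ i\<bar> = \<delta> (Suc j)" for i using sign_vectors_abs[OF assms(2)] child_bounds(1)[OF assms(1)] by simp
  have "\<bar>x $ i - w $ i\<bar> \<le> L j / 2" for i
    using x[of i] v[of i] child_bounds(3)[OF assms(1)] by linarith
  then show "x \<in> cube w (L j)" by (simp add: mem_cube)
qed

lemma W_SucE:
  assumes "w \<in> W (Suc j)"
  obtains u v where "u \<in> W j" "v \<in> sign_vectors (\<delta> (Suc j))" "w = u + v" using assms by auto

lemma W_SucI: "u \<in> W j \<Longrightarrow> v \<in> sign_vectors (\<delta> (Suc j)) \<Longrightarrow> u + v \<in> W (Suc j)"
  by auto

declare centers.simps(2) [simp del]

text \<open>Siblings differ by \<open>2 * \<delta>\<close> in some coordinate. For different
  parents, the distance \<open>L j\<close> of the parents loses at most two offsets, and containment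
  of the children leaves \<open>l (Suc j)\<close>.\<close>

lemma W_separated: "j \<le> n \<Longrightarrow> w \<in> W j \<Longrightarrow> w' \<in> W j \<Longrightarrow> w \<noteq> w' \<Longrightarrow> \<exists>i. L j \<le> \<bar>w $ i - w' $ i\<bar>"
proof (induction j arbitrary: w w')
  case (Suc j)
  obtain u v where u: "u \<in> W j" "v \<in> sign_vectors (\<delta> (Suc j))" "w = u + v" using Suc.prems(2) by (rule W_SucE)
  obtain u' v' where u': "u' \<in> W j" "v' \<in> sign_vectors (\<delta> (Suc j))" "w' = u' + v'" using Suc.prems(3) by (rule W_SucE)
  note st = child_bounds[OF Suc.prems(1)]
  have L: "L (Suc j) = l (Suc j)" by (simp add: L_def)
  show ?case
  proof (cases "u = u'")
    case True
    then have "v \<noteq> v'" using u u' Suc.prems by auto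
    then obtain i where i: "v $ i \<noteq> v' $ i" by (auto simp: vec_eq_iff)
    have "v $ i = \<delta> (Suc j) \<or> v $ i = - \<delta> (Suc j)" "v' $ i = \<delta> (Suc j) \<or> v' $ i = - \<delta> (Suc j)"
      using u(2) u'(2) by (auto simp: sign_vectors_def)
    then have "L (Suc j) \<le> \<bar>w $ i - w' $ i\<bar>"
      using i st unfolding u(3) u'(3) True L vector_add_component by linarith
    then show ?thesis by blast
  next
    case False
    then obtain i where "L j \<le> \<bar>u $ i - u' $ i\<bar>" using Suc.IH[OF _ u(1) u'(1)] Suc.prems by auto
    moreover have "\<bar>v $ i\<bar> = \<delta> (Suc j)" "\<bar>v' $ i\<bar> = \<delta> (Suc j)"
      using st(1) by (simp_all add: sign_vectors_abs[OF u(2)] sign_vectors_abs[OF u'(2)])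
    ultimately have "L (Suc j) \<le> \<bar>w $ i - w' $ i\<bar>"
      using st unfolding u(3) u'(3) L vector_add_component by linarith
    then show ?thesis by blast
  qed
qed simp

lemma W_unique_decomposition:
  assumes j: "Suc j \<le> n" and u: "u \<in> W j" "v \<in> sign_vectors (\<delta> (Suc j))"
    and u': "u' \<in> W j" "v' \<in> sign_vectors (\<delta> (Suc j))" and eq: "u + v = u' + v'"
  shows "u = u' \<and> v = v'"
proof -
  have "u = u'"
  proof (rule ccontr)
    assume "u \<noteq> u'"
    then obtain i where i: "L j \<le> \<bar>u $ i - u' $ i\<bar>" using W_separated[OF _ u(1) u'(1)] j by auto
    have "u $ i + v $ i = u' $ i + v' $ i" using eq by (metis vector_add_component)
    moreover have "\<bar>v $ i\<bar> = \<delta> (Suc j)" "\<bar>v' $ i\<bar> = \<delta> (Suc j)"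
      using child_bounds(1)[OF j] by (simp_all add: sign_vectors_abs[OF u(2)] sign_vectors_abs[OF u'(2)])
    moreover have "0 < l (Suc j)" using j by (intro l_pos) auto
    ultimately show False using i child_bounds(3)[OF j] by linarith
  qed
  with eq show ?thesis by simp
qed

lemma card_W: "j \<le> n \<Longrightarrow> card (W j) = 2 ^ (CARD('d) * j)"
proof (induction j)
  case (Suc j)
  have "inj_on (\<lambda>(w, v). w + v) (W j \<times> sign_vectors (\<delta> (Suc j)))"
    using W_unique_decomposition[OF Suc.prems] by (auto simp: inj_on_def)
  then have "card (W (Suc j)) = card (W j) * card (sign_vectors (\<delta> (Suc j)) :: (real ^ 'd) set)"
    unfolding centers.simps(2) by (simp add: card_image card_cartesian_product)
  also have "\<dots> = 2 ^ (CARD('d) * Suc j)"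
    using Suc child_bounds(1)[OF Suc.prems] by (simp add: card_sign_vectors power_add[symmetric] add.commute)
  finally show ?case .
qed simp

lemma ancestor:
  assumes "j \<le> k" "k \<le> n" "w \<in> W k"
  shows "\<exists>w'\<in>W j. cube w (L k) \<subseteq> cube w' (L j)"
  using assms
proof (induction k arbitrary: w rule: dec_induct)
  case (step k)
  obtain u v where u: "u \<in> W k" "v \<in> sign_vectors (\<delta> (Suc k))" "w = u + v" using step.prems(2) by (rule W_SucE)
  have "cube w (L (Suc k)) \<subseteq> cube u (L k)"
    using child_subset[OF step.prems(1) u(2), of u] by (simp add: u(3) L_def)
  moreover obtain w' where "w' \<in> W j" "cube u (L k) \<subseteq> cube w' (L j)" using step.IH[of u] step.prems u(1) by auto
  ultimately show ?case by blast
qed blast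

lemma finite_W: "finite (W j)" by (rule finite_centers)

section \<open>The measure: support, masses of cubes, growth\<close>

definition X :: "nat \<Rightarrow> (real ^ 'd) set" where
  "X j = (\<Union>w\<in>W j. cube w (L j))"

lemma X_decreasing: "j \<le> k \<Longrightarrow> k \<le> n \<Longrightarrow> X k \<subseteq> X j"
  unfolding X_def using ancestor[of j k] by blast

lemma X_measurable [measurable]: "X j \<in> sets borel" unfolding X_def using finite_W by (intro sets.finite_UN) auto

definition \<mu> :: "(real ^ 'd) measure" where
  "\<mu> = density lborel (\<lambda>x. \<Sum>w\<in>W n. ennreal ((1/2) ^ (CARD('d) * n) / l n ^ CARD('d)) * indicator (cube w (l n)) x)"

lemma sets_\<mu> [simp, measurable_cong]: "sets \<mu> = sets borel" by (simp add: \<mu>_def)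

lemma space_\<mu> [simp]: "space \<mu> = UNIV" by (simp add: \<mu>_def)

lemma L_n: "L n = l n" using n_pos by (simp add: L_def)

lemma l_n_pos: "0 < l n" using l_pos n_pos by simp

lemma emeasure_\<mu>:
  assumes [measurable]: "A \<in> sets borel"
  shows "emeasure \<mu> A = (\<Sum>w\<in>W n. ennreal ((1/2) ^ (CARD('d) * n) / l n ^ CARD('d)) * emeasure lborel (cube w (l n) \<inter> A))"
proof -
  let ?c = "ennreal ((1/2) ^ (CARD('d) * n) / l n ^ CARD('d))"
  have "emeasure \<mu> A = (\<integral>\<^sup>+ x. (\<Sum>w\<in>W n. ?c * indicator (cube w (l n)) x) * indicator A x \<partial>lborel)"
    unfolding \<mu>_def by (subst emeasure_density) auto
  also have "\<dots> = (\<integral>\<^sup>+ x. (\<Sum>w\<in>W n. ?c * indicator (cube w (l n) \<inter> A) x) \<partial>lborel)"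
    by (intro nn_integral_cong) (auto simp: sum_distrib_right indicator_inter_arith mult.assoc)
  also have "\<dots> = (\<Sum>w\<in>W n. \<integral>\<^sup>+ x. ?c * indicator (cube w (l n) \<inter> A) x \<partial>lborel)"
    by (intro nn_integral_sum) auto
  finally show ?thesis by (simp add: nn_integral_cmult_indicator)
qed

lemma emeasure_\<mu>_UNIV: "emeasure \<mu> UNIV = 1"
proof -
  have "emeasure \<mu> UNIV = (\<Sum>w\<in>W n. ennreal ((1/2) ^ (CARD('d) * n)))"
    using l_n_pos by (simp add: emeasure_\<mu> emeasure_lborel_cube ennreal_mult[symmetric])
  also have "\<dots> = ennreal (real (card (W n)) * (1/2) ^ (CARD('d) * n))"
    by (simp add: ennreal_mult ennreal_of_nat_eq_real_of_nat)
  also have "real (card (W n)) * (1/2) ^ (CARD('d) * n) = 1" by (simp add: card_W power_one_over)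
  finally show ?thesis by simp
qed

sublocale \<mu>: finite_measure \<mu>
  by (rule finite_measureI) (simp add: emeasure_\<mu>_UNIV)

lemma AE_\<mu>I: "AE x in lborel. P x \<Longrightarrow> AE x in \<mu>. P x"
  unfolding \<mu>_def by (subst AE_density) auto

lemma AE_X: "j \<le> n \<Longrightarrow> AE x in \<mu>. x \<in> X j"
proof -
  assume j: "j \<le> n"
  have zero: "(\<Sum>w\<in>W n. ennreal ((1/2) ^ (CARD('d) * n) / l n ^ CARD('d)) * indicator (cube w (l n)) x) = 0"
    if "x \<notin> X n" for x
    using that by (intro sum.neutral) (auto simp: X_def L_n)
  have "AE x in \<mu>. x \<in> X n"
    unfolding \<mu>_def by (subst AE_density) (use zero in \<open>force intro!: always_eventually\<close>)+
  then show ?thesis using X_decreasing[OF j] by auto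
qed

lemma AE_disjoint:
  assumes "j \<le> n" "w \<in> W j" "w' \<in> W j" "w \<noteq> w'"
  shows "AE x in lborel. x \<notin> cube w (L j) \<or> x \<notin> cube w' (L j)"
  using W_separated[OF assms] AE_lborel_cube_disjoint by blast

text \<open>Backward induction from generation n, where the density gives the mass. Almost
  everywhere a cube agrees with the union of its children, since the measure lives on the next
  generation.\<close>

lemma measure_\<mu>_cube:
  assumes "j \<le> n" "w \<in> W j"
  shows "measure \<mu> (cube w (L j)) = (1/2) ^ (CARD('d) * j)"
  using assms
proof (induction j arbitrary: w rule: inc_induct)
  case base
  let ?c = "(1/2) ^ (CARD('d) * n) / l n ^ CARD('d)"
  have "emeasure lborel (cube w' (l n) \<inter> cube w (L n)) = (if w' = w then ennreal (l n ^ CARD('d)) else 0)" if "w' \<in> W n" for w'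
  proof (cases "w' = w")
    case False
    then have "AE x in lborel. x \<notin> cube w' (L n) \<or> x \<notin> cube w (L n)"
      by (intro AE_disjoint that base) auto
    then have "AE x in lborel. x \<notin> cube w' (l n) \<inter> cube w (L n)" unfolding L_n by auto
    with False show ?thesis by (subst (asm) AE_iff_measurable[OF _ refl]) (auto simp: Int_def)
  qed (use l_n_pos in \<open>simp add: L_n emeasure_lborel_cube\<close>)
  then have "emeasure \<mu> (cube w (L n)) = (\<Sum>w'\<in>W n. if w' = w then ennreal ?c * ennreal (l n ^ CARD('d)) else 0)"
    unfolding emeasure_\<mu>[OF cube_borel] by (intro sum.cong) auto
  also have "\<dots> = ennreal ?c * ennreal (l n ^ CARD('d))" using base finite_W by simp
  also have "\<dots> = ennreal ((1/2) ^ (CARD('d) * n))" using l_n_pos by (simp add: ennreal_mult[symmetric])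
  finally show ?case by (simp add: measure_def)
next
  case (step j)
  let ?S = "sign_vectors (\<delta> (Suc j)) :: (real ^ 'd) set"
  have j: "Suc j \<le> n" using step.hyps by simp
  have L: "L (Suc j) = l (Suc j)" by (simp add: L_def)
  have "AE x in \<mu>. \<forall>w'\<in>W j - {w}. x \<notin> cube w (L j) \<or> x \<notin> cube w' (L j)"
    using step.prems j by (intro AE_finite_allI AE_\<mu>I AE_disjoint) (auto simp: finite_W)
  with AE_X[OF j] have "AE x in \<mu>. x \<in> cube w (L j) \<longleftrightarrow> x \<in> (\<Union>v\<in>?S. cube (w + v) (L (Suc j)))"
  proof eventually_elim
    case (elim x)
    show ?case
    proof
      assume x: "x \<in> cube w (L j)"
      obtain w' where w': "w' \<in> W (Suc j)" "x \<in> cube w' (L (Suc j))" using elim(1) by (auto simp: X_def)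
      obtain u v where u: "u \<in> W j" "v \<in> ?S" "w' = u + v" using w'(1) by (rule W_SucE)
      have "x \<in> cube u (L j)" using child_subset[OF j u(2), of u] w'(2) u(3) L by auto
      then have "u = w" using elim(2) x u(1) by auto
      then show "x \<in> (\<Union>v\<in>?S. cube (w + v) (L (Suc j)))" using u w'(2) by auto
    next
      assume "x \<in> (\<Union>v\<in>?S. cube (w + v) (L (Suc j)))"
      then show "x \<in> cube w (L j)" using child_subset[OF j] L by auto
    qed
  qed
  then have "measure \<mu> (cube w (L j)) = measure \<mu> (\<Union>v\<in>?S. cube (w + v) (L (Suc j)))"
    by (intro measure_eq_AE) (auto intro!: sets.finite_UN finite_sign_vectors)
  also have "\<dots> = (\<Sum>v\<in>?S. measure \<mu> (cube (w + v) (L (Suc j))))"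
  proof (intro measure_UNION_AE finite_sign_vectors)
    show "pairwise (\<lambda>v v'. AE x in \<mu>. x \<notin> cube (w + v) (L (Suc j)) \<or> x \<notin> cube (w + v') (L (Suc j))) ?S"
      using step.prems j by (intro pairwiseI AE_\<mu>I AE_disjoint W_SucI) auto
  qed (simp add: \<mu>.fmeasurable_eq_sets)
  also have "\<dots> = (\<Sum>v\<in>?S. (1/2) ^ (CARD('d) * Suc j))" by (intro sum.cong refl step.IH W_SucI step.prems)
  also have "\<dots> = (1/2) ^ (CARD('d) * j)"
    using child_bounds(1)[OF j] by (simp add: card_sign_vectors power_add power_one_over)
  finally show ?case .
qed

text \<open>Volume packing: the cubes that meet the ball are disjoint almost everywhere and lie in a
  cube of edge \<open>2 * (\<rho> + L j)\<close>, which is at most \<open>6 * \<rho>\<close> because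
  \<open>L j\<close> is at most twice \<rho>.\<close>

lemma growth_coarse:
  assumes j: "j \<le> n" and \<rho>: "L j / 2 \<le> \<rho>"
  shows "measure \<mu> {y. norm (y - x) \<le> \<rho>} \<le> (1/2) ^ (CARD('d) * j) / L j ^ CARD('d) * (6 * \<rho>) ^ CARD('d)"
proof -
  define B where "B = {y. norm (y - x) \<le> \<rho>}"
  define F where "F = {w\<in>W j. cube w (L j) \<inter> B \<noteq> {}}"
  have L: "0 < L j" using j by (rule L_pos)
  have [measurable]: "B \<in> sets borel" unfolding B_def by measurable
  have F: "finite F" "F \<subseteq> W j" using finite_W by (auto simp: F_def)
  have "measure \<mu> B = measure \<mu> (B \<inter> X j)" using AE_X[OF j] by (intro measure_eq_AE) auto
  also have "\<dots> \<le> measure \<mu> (\<Union>w\<in>F. cube w (L j))"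
    using F by (intro \<mu>.finite_measure_mono) (auto simp: X_def F_def intro!: sets.finite_UN)
  also have "\<dots> \<le> (\<Sum>w\<in>F. measure \<mu> (cube w (L j)))"
    using F by (intro \<mu>.finite_measure_subadditive_finite) auto
  also have "\<dots> = real (card F) * (1/2) ^ (CARD('d) * j)" using F j by (simp add: measure_\<mu>_cube subset_iff)
  finally have le: "measure \<mu> B \<le> real (card F) * (1/2) ^ (CARD('d) * j)" .
  have "real (card F) \<le> (6 * \<rho>) ^ CARD('d) / L j ^ CARD('d)"
  proof -
    have "real (card F) * L j ^ CARD('d) = (\<Sum>w\<in>F. measure lborel (cube w (L j)))"
      using L by (simp add: measure_lborel_cube)
    also have "\<dots> = measure lborel (\<Union>w\<in>F. cube w (L j))"
      using F j L by (intro measure_UNION_AE[symmetric] pairwiseI AE_disjoint cube_fmeasurable) auto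
    also have "\<dots> \<le> measure lborel (cube x (2 * (\<rho> + L j)))"
    proof (intro measure_mono_fmeasurable cube_fmeasurable)
      show "(\<Union>w\<in>F. cube w (L j)) \<subseteq> cube x (2 * (\<rho> + L j))"
      proof
        fix z assume "z \<in> (\<Union>w\<in>F. cube w (L j))"
        then obtain w y where w: "z \<in> cube w (L j)" "y \<in> cube w (L j)" "y \<in> B" by (auto simp: F_def)
        have "\<bar>z $ i - x $ i\<bar> \<le> \<rho> + L j" for i
        proof -
          have "\<bar>z $ i - w $ i\<bar> \<le> L j / 2" "\<bar>y $ i - w $ i\<bar> \<le> L j / 2" using w by (auto simp: mem_cube)
          moreover have "\<bar>y $ i - x $ i\<bar> \<le> \<rho>"
            using component_le_norm_cart[of "y - x" i] w(3) by (simp add: B_def)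
          ultimately show ?thesis by linarith
        qed
        moreover have "2 * (\<rho> + L j) / 2 = \<rho> + L j" by simp
        ultimately show "z \<in> cube x (2 * (\<rho> + L j))" by (auto simp only: mem_cube)
      qed
      show "(\<Union>w\<in>F. cube w (L j)) \<in> sets lborel" using F by (auto intro!: sets.finite_UN)
    qed (use L \<rho> in auto)
    also have "\<dots> = (2 * (\<rho> + L j)) ^ CARD('d)" using L \<rho> by (simp add: measure_lborel_cube)
    also have "\<dots> \<le> (6 * \<rho>) ^ CARD('d)" using L \<rho> by (intro power_mono) auto
    finally show ?thesis using L by (simp add: pos_le_divide_eq)
  qed
  then have "real (card F) * (1/2) ^ (CARD('d) * j) \<le> (6 * \<rho>) ^ CARD('d) / L j ^ CARD('d) * (1/2) ^ (CARD('d) * j)"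
    by (rule mult_right_mono) simp
  with le have "measure \<mu> B \<le> (6 * \<rho>) ^ CARD('d) / L j ^ CARD('d) * (1/2) ^ (CARD('d) * j)" by linarith
  also have "\<dots> = (1/2) ^ (CARD('d) * j) / L j ^ CARD('d) * (6 * \<rho>) ^ CARD('d)" by simp
  finally show ?thesis by (simp only: B_def)
qed

text \<open>Below the smallest scale the density itself bounds the mass. The 6 is kept so that the
  bound has the shape of \<open>growth_coarse\<close>.\<close>

lemma growth_fine:
  assumes "0 < \<rho>"
  shows "measure \<mu> {y. norm (y - x) \<le> \<rho>} \<le> (1/2) ^ (CARD('d) * n) / l n ^ CARD('d) * (6 * \<rho>) ^ CARD('d)"
proof -
  define B where "B = {y. norm (y - x) \<le> \<rho>}"
  define c where "c = (1/2) ^ (CARD('d) * n) / l n ^ CARD('d)"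
  have c: "0 \<le> c" using l_n_pos by (simp add: c_def)
  have [measurable]: "B \<in> sets borel" unfolding B_def by measurable
  have fm: "cube w (l n) \<inter> B \<in> fmeasurable lborel" for w
    by (rule fmeasurable_Int_fmeasurable) (use l_n_pos in \<open>auto intro: cube_fmeasurable\<close>)
  have "emeasure \<mu> B = (\<Sum>w\<in>W n. ennreal c * ennreal (measure lborel (cube w (l n) \<inter> B)))"
    unfolding c_def by (simp add: emeasure_\<mu> emeasure_eq_measure2 fm)
  also have "\<dots> = ennreal (\<Sum>w\<in>W n. c * measure lborel (cube w (l n) \<inter> B))"
    using c by (subst sum_ennreal[symmetric]) (auto simp: ennreal_mult[OF c])
  also have "(\<Sum>w\<in>W n. c * measure lborel (cube w (l n) \<inter> B)) = c * (\<Sum>w\<in>W n. measure lborel (cube w (l n) \<inter> B))"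
    by (simp add: sum_distrib_left)
  also have "(\<Sum>w\<in>W n. measure lborel (cube w (l n) \<inter> B)) = measure lborel (\<Union>w\<in>W n. cube w (l n) \<inter> B)"
  proof (intro measure_UNION_AE[symmetric] pairwiseI finite_W fm)
    fix w w' assume "w \<in> W n" "w' \<in> W n" "w \<noteq> w'"
    from AE_disjoint[OF order_refl this]
    show "AE x in lborel. x \<notin> cube w (l n) \<inter> B \<or> x \<notin> cube w' (l n) \<inter> B" unfolding L_n by auto
  qed
  finally have "measure \<mu> B = c * measure lborel (\<Union>w\<in>W n. cube w (l n) \<inter> B)"
    using c by (simp add: measure_def)
  also have "\<dots> \<le> c * measure lborel (cube x (2 * \<rho>))"
  proof (intro mult_left_mono c measure_mono_fmeasurable cube_fmeasurable)
    have "B \<subseteq> cube x (2 * \<rho>)"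
    proof
      fix y assume "y \<in> B"
      then have "\<bar>(y - x) $ i\<bar> \<le> \<rho>" for i
        using component_le_norm_cart[of "y - x" i] by (simp add: B_def)
      then show "y \<in> cube x (2 * \<rho>)" by (simp add: mem_cube)
    qed
    then show "(\<Union>w\<in>W n. cube w (l n) \<inter> B) \<subseteq> cube x (2 * \<rho>)" by auto
    show "(\<Union>w\<in>W n. cube w (l n) \<inter> B) \<in> sets lborel" using finite_W by (auto intro!: sets.finite_UN)
  qed (use assms in auto)
  also have "\<dots> \<le> c * (6 * \<rho>) ^ CARD('d)"
    using assms c by (intro mult_left_mono) (auto simp: measure_lborel_cube intro: power_mono)
  finally show ?thesis by (simp add: B_def c_def)
qed

end

section \<open>The levels of the Riesz kernel\<close>

text \<open>The shell constant, the growth factor \<open>6 ^ d\<close>, and the diameter bound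
  \<open>4 * d\<close> of \<open>rel_dist\<close> to the power d - s; the powers of the length go
  into \<theta>.\<close>

definition riesz_row_const :: "nat \<Rightarrow> real \<Rightarrow> real" where
  "riesz_row_const d s = 2 powr s / (1 - 2 powr (s - d)) * 6 ^ d * (4 * d) powr (d - s)"

text \<open>The constant of \<open>integral_sum_U_square_le\<close> for the smoothness constant of
  \<open>smooth_bound\<close>.\<close>

definition riesz_norm_const :: "nat \<Rightarrow> real \<Rightarrow> real" where
  "riesz_norm_const d s = 10 + 20 * (4 * real d * riesz_lip s) + (4 * real d * riesz_lip s)^2"

text \<open>In units of the edge length, 2 is the coordinate gap between opposite corner children
  and \<open>4 * d\<close> bounds their distance; \<open>(1/2) ^ d\<close> is the total mass of one
  chosen corner child from every enlarged cube.\<close>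

definition riesz_low_const :: "nat \<Rightarrow> real \<Rightarrow> real" where
  "riesz_low_const d s = (1/2) ^ d * (2 / (4 * real d) powr (s + 1))"

lemma riesz_row_const_pos:
  assumes "0 < d" "s < real d"
  shows "0 < riesz_row_const d s"
proof -
  have "2 powr (s - real d) < 1" using assms by (simp add: powr_less_one)
  then show ?thesis using assms by (simp add: riesz_row_const_def)
qed

lemma riesz_low_const_pos: "0 < d \<Longrightarrow> 0 < riesz_low_const d s" by (simp add: riesz_low_const_def)

locale riesz_cantor = cantor_tree dim \<alpha> n N r l
  for dim :: "'d::finite itself" and \<alpha> n N r l +
  fixes s :: real
  assumes s_pos: "0 < s" and s_less: "s < real CARD('d)" and \<alpha>_small: "\<alpha> \<le> 1 / (4 * real CARD('d))"
begin

lemma card_pos: "0 < CARD('d)" by simp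

text \<open>The enlarged cube of edge 2T times the length, for T = 2, around the center of a cube of
  generation \<open>r p - 1\<close>. Levels count from 0, and level 0 consists of the initial
  cube.\<close>

definition Z :: "nat \<Rightarrow> real ^ 'd \<Rightarrow> (real ^ 'd) set" where
  "Z p w = cube w (4 * l (r p))"

definition Y :: "nat \<Rightarrow> (real ^ 'd) set" where
  "Y p = (\<Union>w\<in>W (r p - 1). Z p w)"

definition rel :: "nat \<Rightarrow> real ^ 'd \<Rightarrow> real ^ 'd \<Rightarrow> bool" where
  "rel p x y \<longleftrightarrow> (\<exists>w\<in>W (r p - 1). x \<in> Z p w \<and> y \<in> Z p w)"

text \<open>Membership in \<open>Y (Suc p)\<close> excludes points in the gaps, so that lying in
  different cubes of the next level really gives the distance \<open>h p / 2\<close>. Level N has no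
  successor and collects all remaining pairs, however close.\<close>

definition sep :: "nat \<Rightarrow> real ^ 'd \<Rightarrow> real ^ 'd \<Rightarrow> bool" where
  "sep p x y \<longleftrightarrow> rel p x y \<and> (p < N \<longrightarrow> x \<in> Y (Suc p) \<and> y \<in> Y (Suc p) \<and> \<not> rel (Suc p) x y)"

text \<open>On \<open>Y p\<close> exactly one summand survives, by \<open>Z_unique\<close>. Written
  as a sum over indicators the map is measurable at once.\<close>

definition z :: "nat \<Rightarrow> real ^ 'd \<Rightarrow> real ^ 'd" where
  "z p x = (\<Sum>w\<in>W (r p - 1). indicator (Z p w) x *\<^sub>R w)"

text \<open>Edge length just before the jump to the next level: the spacing of the cubes
  \<open>Z (Suc p)\<close>.\<close>

definition h :: "nat \<Rightarrow> real" where
  "h p = L (r (Suc p) - 1)"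

definition \<theta> :: "nat \<Rightarrow> real" where
  "\<theta> p = cantor_theta CARD('d) s l (r p)"

lemma Z_measurable [measurable]: "Z p w \<in> sets borel" by (simp add: Z_def)

lemma Y_measurable [measurable]: "Y p \<in> sets borel" unfolding Y_def using finite_W by (intro sets.finite_UN) auto

lemma l_r_pos: "p \<le> N \<Longrightarrow> 0 < l (r p)" using r_bounds by (intro l_pos) auto

lemma h_pos: "p < N \<Longrightarrow> 0 < h p" unfolding h_def using r_bounds(2)[of "Suc p"] by (intro L_pos) auto

lemma r_Suc_ge: "p < N \<Longrightarrow> 1 \<le> r p \<and> r p \<le> r (Suc p) - 1 \<and> r (Suc p) - 1 \<le> n"
  using r_Suc[of p] r_bounds[of p] r_bounds(2)[of "Suc p"] by auto

lemma h_eq: "p < N \<Longrightarrow> h p = l (r (Suc p) - 1)"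
proof -
  assume "p < N"
  then have "r (Suc p) - 1 \<noteq> 0" using r_Suc_ge[of p] by linarith
  then show ?thesis by (simp only: h_def L_def if_False)
qed

lemma l_in_block: "p < N \<Longrightarrow> r p + i < r (Suc p) \<Longrightarrow> l (r p + i) = l (r p) / 2 ^ i"
proof (induction i)
  case (Suc i)
  then show ?case using l_half[of p "r p + i"] by simp
qed simp

lemma h_le: "p < N \<Longrightarrow> h p \<le> l (r p)"
  using l_in_block[of p "r (Suc p) - 1 - r p"] r_Suc_ge[of p] r_Suc[of p] l_r_pos[of p] h_eq[of p]
  by (simp add: divide_le_eq mult_le_cancel_left1)

text \<open>Each jump contributes a factor \<alpha>/2, and the halvings inside a block only
  help.\<close>

lemma l_decay: "p < q \<Longrightarrow> q \<le> N \<Longrightarrow> l (r q) \<le> (\<alpha> / 2) ^ (q - p) * h p"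
proof (induction q)
  case (Suc q)
  have q: "q < N" using Suc.prems by simp
  have "l (r (Suc q)) \<le> \<alpha> / 2 * h q" using l_jump[OF q] h_eq[OF q] by simp
  also have "h q \<le> (\<alpha> / 2) ^ (q - p) * h p"
  proof (cases "p = q")
    case False
    then show ?thesis using h_le[OF q] Suc by simp
  qed simp
  finally show ?case using \<alpha>_pos Suc.prems by (simp add: Suc_diff_le mult_left_mono)
qed simp

text \<open>The centers are \<open>h p\<close> apart in some coordinate, and each of the two cubes
  has half-width at most \<open>h p / 4\<close>.\<close>

lemma Z_separated:
  assumes p: "p < N" and w: "w \<in> W (r (Suc p) - 1)" "w' \<in> W (r (Suc p) - 1)" "w \<noteq> w'"
    and x: "x \<in> Z (Suc p) w" and x': "x' \<in> Z (Suc p) w'"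
  shows "h p / 2 \<le> norm (x - x')"
proof -
  obtain i where i: "h p \<le> \<bar>w $ i - w' $ i\<bar>"
    using W_separated[OF _ w] r_Suc_ge[OF p] unfolding h_def by blast
  have "\<bar>x $ i - w $ i\<bar> \<le> 4 * l (r (Suc p)) / 2" "\<bar>x' $ i - w' $ i\<bar> \<le> 4 * l (r (Suc p)) / 2"
    using x x' unfolding Z_def mem_cube by blast+
  moreover have "8 * l (r (Suc p)) \<le> h p" using jump_le2[OF p] by (simp add: h_def)
  ultimately have "h p / 2 \<le> \<bar>(x - x') $ i\<bar>" using i unfolding vector_minus_component by linarith
  then show ?thesis using component_le_norm_cart[of "x - x'" i] by linarith
qed

lemma Z_unique:
  assumes p: "p \<le> N" and w: "w \<in> W (r p - 1)" "w' \<in> W (r p - 1)" and x: "x \<in> Z p w" "x \<in> Z p w'"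
  shows "w = w'"
proof (cases p)
  case 0
  then show ?thesis using w by (simp add: r_0)
next
  case (Suc q)
  show ?thesis
  proof (rule ccontr)
    assume "w \<noteq> w'"
    then have "h q / 2 \<le> norm (x - x)" using Z_separated[of q w w' x x] p w x Suc by simp
    with h_pos[of q] Suc p show False by simp
  qed
qed

lemma child_subset_Z:
  assumes p: "p \<le> N" and v: "v \<in> sign_vectors (\<delta> (r p))"
  shows "cube (w + v) (l (r p)) \<subseteq> Z p w"
proof
  fix x assume "x \<in> cube (w + v) (l (r p))"
  then have x: "\<bar>x $ i - (w $ i + v $ i)\<bar> \<le> l (r p) / 2" for i by (simp add: mem_cube)
  have \<delta>: "\<delta> (r p) = 2 * l (r p) - l (r p) / 2" using p by (simp add: \<delta>_def)
  have v: "\<bar>v $ i\<bar> = 2 * l (r p) - l (r p) / 2" for i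
    using sign_vectors_abs[OF v] l_r_pos[OF p] \<delta> by simp
  have "\<bar>x $ i - w $ i\<bar> \<le> 2 * l (r p)" for i using x[of i] v[of i] by linarith
  then show "x \<in> Z p w" by (simp add: Z_def mem_cube)
qed

lemma W_r_parent:
  assumes p: "p \<le> N" and w: "w \<in> W (r p)"
  obtains u v where "u \<in> W (r p - 1)" "v \<in> sign_vectors (\<delta> (r p))" "w = u + v"
  using W_SucE[of w "r p - 1"] w r_bounds(1)[OF p] by (metis One_nat_def Suc_diff_le diff_Suc_1 le_numeral_extra(4) ordered_cancel_comm_monoid_diff_class.add_diff_inverse plus_1_eq_Suc)

lemma Z_nested:
  assumes pq: "p \<le> q" "q \<le> N" and w: "w \<in> W (r q - 1)"
  shows "\<exists>w'\<in>W (r p - 1). Z q w \<subseteq> Z p w'"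
proof (cases "p = q")
  case False
  then have lt: "r p < r q" using pq by (intro r_less) auto
  have "Z q w \<subseteq> cube w (L (r q - 1))" unfolding Z_def using pq by (intro cube_mono jump_le)
  moreover obtain w1 where w1: "w1 \<in> W (r p)" "cube w (L (r q - 1)) \<subseteq> cube w1 (L (r p))"
  proof -
    have "r p \<le> r q - 1" "r q - 1 \<le> n" using lt r_bounds(2)[of q] pq by auto
    from ancestor[OF this w] show ?thesis using that by blast
  qed
  moreover have p: "p \<le> N" using pq by simp
  then obtain u v where u: "u \<in> W (r p - 1)" "v \<in> sign_vectors (\<delta> (r p))" "w1 = u + v"
    using w1(1) by (rule W_r_parent)
  moreover have "L (r p) = l (r p)" using r_bounds(1)[OF p] by (simp add: L_def)
  ultimately show ?thesis using child_subset_Z[OF p u(2), of u] by (intro bexI[of _ u]) auto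
qed (use w in auto)

lemma rel_sym: "rel p x y \<Longrightarrow> rel p y x" by (auto simp: rel_def)

lemma rel_trans: "p \<le> N \<Longrightarrow> rel p x y \<Longrightarrow> rel p y t \<Longrightarrow> rel p x t"
  unfolding rel_def using Z_unique by blast

lemma rel_antimono: "p \<le> q \<Longrightarrow> q \<le> N \<Longrightarrow> rel q x y \<Longrightarrow> rel p x y"
  unfolding rel_def using Z_nested by blast

lemma rel_cong: "p \<le> q \<Longrightarrow> q \<le> N \<Longrightarrow> rel q x x' \<Longrightarrow> rel p x y \<longleftrightarrow> rel p x' y"
  using rel_antimono rel_sym rel_trans by (meson order_trans)

lemma Y_iff_rel: "x \<in> Y p \<longleftrightarrow> rel p x x" by (auto simp: Y_def rel_def)

lemma Y_decreasing: "p \<le> q \<Longrightarrow> q \<le> N \<Longrightarrow> Y q \<subseteq> Y p"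
  using rel_antimono by (auto simp: Y_iff_rel)

lemma rel_mem_Y: "rel p x y \<Longrightarrow> x \<in> Y p \<and> y \<in> Y p" by (auto simp: Y_def rel_def)

lemma sep_sym: "sep p x y \<longleftrightarrow> sep p y x" unfolding sep_def using rel_sym by blast

lemma AE_Y: "p \<le> N \<Longrightarrow> AE x in \<mu>. x \<in> Y p"
proof -
  assume p: "p \<le> N"
  have "X (r p) \<subseteq> Y p"
  proof
    fix x assume "x \<in> X (r p)"
    then obtain w where w: "w \<in> W (r p)" "x \<in> cube w (L (r p))" by (auto simp: X_def)
    obtain u v where u: "u \<in> W (r p - 1)" "v \<in> sign_vectors (\<delta> (r p))" "w = u + v"
      using p w(1) by (rule W_r_parent)
    moreover have "L (r p) = l (r p)" using r_bounds(1)[OF p] by (simp add: L_def)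
    ultimately show "x \<in> Y p" using child_subset_Z[OF p u(2), of u] w(2) by (auto simp: Y_def)
  qed
  with AE_X[OF r_bounds(2)[OF p]] show ?thesis by auto
qed

lemma z_eq: "p \<le> N \<Longrightarrow> w \<in> W (r p - 1) \<Longrightarrow> x \<in> Z p w \<Longrightarrow> z p x = w"
proof -
  assume *: "p \<le> N" "w \<in> W (r p - 1)" "x \<in> Z p w"
  have "z p x = (\<Sum>w'\<in>W (r p - 1). if w' = w then w else 0)"
    unfolding z_def using * Z_unique[OF *(1,2)] by (intro sum.cong) (auto simp: indicator_def)
  also have "\<dots> = w" using *(2) finite_W by simp
  finally show ?thesis .
qed

lemma rel_imp_z_eq: "p \<le> N \<Longrightarrow> rel p x y \<Longrightarrow> z p x = z p y"
  unfolding rel_def using z_eq by metis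

lemma rel_z: "p \<le> N \<Longrightarrow> x \<in> Y p \<Longrightarrow> rel p x (z p x)"
  using z_eq l_r_pos[of p] by (fastforce simp: Y_def rel_def Z_def intro: center_mem_cube)

lemma z_measurable': "z p \<in> \<mu> \<rightarrow>\<^sub>M \<mu>" unfolding z_def[abs_def] by measurable

lemma norm_le_of_components:
  fixes x :: "real ^ 'd"
  assumes "\<And>i. \<bar>x $ i\<bar> \<le> c"
  shows "norm x \<le> real CARD('d) * c"
proof -
  have "norm x \<le> (\<Sum>i\<in>UNIV. \<bar>x $ i\<bar>)" by (rule norm_le_l1_cart)
  also have "\<dots> \<le> (\<Sum>i\<in>(UNIV :: 'd set). c)" by (intro sum_mono assms)
  finally show ?thesis by simp
qed

lemma rel_dist: "rel p x y \<Longrightarrow> norm (y - x) \<le> 4 * real CARD('d) * l (r p)"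
proof -
  assume "rel p x y"
  then obtain w where "x \<in> Z p w" "y \<in> Z p w" by (auto simp: rel_def)
  then have b: "\<bar>x $ i - w $ i\<bar> \<le> 2 * l (r p)" "\<bar>y $ i - w $ i\<bar> \<le> 2 * l (r p)" for i
    unfolding Z_def mem_cube by auto
  have "\<bar>(y - x) $ i\<bar> \<le> 4 * l (r p)" for i using b[of i] unfolding vector_minus_component by linarith
  from norm_le_of_components[OF this] show ?thesis by simp
qed

lemma z_dist: "p \<le> N \<Longrightarrow> x \<in> Y p \<Longrightarrow> norm (x - z p x) \<le> 2 * real CARD('d) * l (r p)"
proof -
  assume p: "p \<le> N" "x \<in> Y p"
  then obtain w where "w \<in> W (r p - 1)" "x \<in> Z p w" by (auto simp: Y_def)
  then have "\<bar>(x - z p x) $ i\<bar> \<le> 2 * l (r p)" for i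
    using z_eq[OF p(1)] by (simp add: Z_def mem_cube)
  from norm_le_of_components[OF this] show ?thesis by simp
qed

lemma sep_dist: "p < N \<Longrightarrow> sep p x y \<Longrightarrow> h p / 2 \<le> norm (y - x)"
proof -
  assume p: "p < N" and "sep p x y"
  then have "x \<in> Y (Suc p)" "y \<in> Y (Suc p)" "\<not> rel (Suc p) x y" by (auto simp: sep_def)
  then obtain w w' where "w \<in> W (r (Suc p) - 1)" "w' \<in> W (r (Suc p) - 1)" "x \<in> Z (Suc p) w" "y \<in> Z (Suc p) w'" "w \<noteq> w'"
    by (auto simp: Y_def rel_def)
  then show ?thesis using Z_separated[OF p, of w w' x y] by (simp add: norm_minus_commute)
qed

text \<open>A point and its center of level q share a cube on every level up to q, and
  \<open>sep p\<close> looks only at levels p and p + 1.\<close>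

lemma sep_z:
  assumes "p < q" "q \<le> N" "x \<in> Y q"
  shows "sep p (z q x) y \<longleftrightarrow> sep p x y"
proof -
  have r: "rel q x (z q x)" using rel_z assms by blast
  have "z q x \<in> Y (Suc p)" "x \<in> Y (Suc p)" using rel_mem_Y[OF r] Y_decreasing[of "Suc p" q] assms by auto
  then show ?thesis
    unfolding sep_def using rel_cong[of p q x "z q x" y] rel_cong[of "Suc p" q x "z q x" y] r assms by auto
qed

lemma rel_measurable: "Measurable.pred (\<mu> \<Otimes>\<^sub>M \<mu>) (\<lambda>w. rel p (fst w) (snd w))"
  unfolding rel_def using finite_W by measurable

lemma sep_measurable: "Measurable.pred (\<mu> \<Otimes>\<^sub>M \<mu>) (\<lambda>w. sep p (fst w) (snd w))"
proof -
  note [measurable] = rel_measurable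
  show ?thesis unfolding sep_def by measurable
qed

definition k :: "'d \<Rightarrow> nat \<Rightarrow> real ^ 'd \<Rightarrow> real ^ 'd \<Rightarrow> real" where
  "k i p x y = (if sep p x y then riesz_kernel s (y - x) $ i else 0)"

definition S :: "nat \<Rightarrow> real ^ 'd \<Rightarrow> real ^ 'd \<Rightarrow> real" where
  "S p x y = (if sep p x y then norm (y - x) powr (- s) else 0)"

definition a :: "nat \<Rightarrow> real" where
  "a p = riesz_row_const CARD('d) s * (if p \<le> N then \<theta> p else 0)"

lemma \<theta>_pos: "p \<le> N \<Longrightarrow> 0 < \<theta> p"
  unfolding \<theta>_def cantor_theta_def by (intro divide_pos_pos) (use l_r_pos[of p] in auto)

lemma a_nonneg: "0 \<le> a p" using \<theta>_pos[of p] riesz_row_const_pos[OF card_pos s_less] by (auto simp: a_def)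

text \<open>Between jumps cubes are subdivided without gaps, so mass per volume does not
  change.\<close>

lemma density_block:
  assumes p: "p < N"
  shows "(1/2) ^ (CARD('d) * (r (Suc p) - 1)) / h p ^ CARD('d) = (1/2) ^ (CARD('d) * r p) / l (r p) ^ CARD('d)"
proof -
  define e where "e = r (Suc p) - 1 - r p"
  have e: "r (Suc p) - 1 = r p + e" "r p + e < r (Suc p)" using r_Suc_ge[OF p] r_Suc[OF p] by (auto simp: e_def)
  have "h p = l (r p) / 2 ^ e" unfolding h_eq[OF p] e(1) by (rule l_in_block[OF p e(2)])
  then have "h p ^ CARD('d) = l (r p) ^ CARD('d) * (1/2) ^ (CARD('d) * e)"
    by (simp add: power_divide power_mult[symmetric] mult.commute power_one_over)
  then show ?thesis unfolding e(1) by (simp add: distrib_left power_add)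
qed

text \<open>For p < N a ball of radius below \<open>h p / 2\<close> contains no separated point, and
  from that radius on generation \<open>r (Suc p) - 1\<close> is fine enough for
  \<open>growth_coarse\<close>. Level N relies on the density at all radii.\<close>

lemma sep_growth:
  assumes p: "p \<le> N" and \<rho>: "0 < \<rho>"
  shows "emeasure \<mu> {y\<in>{y. sep p x y}. norm (y - x) \<le> \<rho>}
    \<le> ennreal ((1/2) ^ (CARD('d) * r p) / l (r p) ^ CARD('d) * 6 ^ CARD('d) * \<rho> ^ CARD('d))"
proof -
  have ge: "measure \<mu> {y. norm (y - x) \<le> \<rho>} \<le> (1/2) ^ (CARD('d) * r p) / l (r p) ^ CARD('d) * (6 * \<rho>) ^ CARD('d)
    \<Longrightarrow> ?thesis"
  proof -
    assume *: "measure \<mu> {y. norm (y - x) \<le> \<rho>} \<le> (1/2) ^ (CARD('d) * r p) / l (r p) ^ CARD('d) * (6 * \<rho>) ^ CARD('d)"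
    have "emeasure \<mu> {y\<in>{y. sep p x y}. norm (y - x) \<le> \<rho>} \<le> emeasure \<mu> {y. norm (y - x) \<le> \<rho>}"
      by (intro emeasure_mono) auto
    also have "\<dots> = ennreal (measure \<mu> {y. norm (y - x) \<le> \<rho>})" by (rule \<mu>.emeasure_eq_measure)
    also have "\<dots> \<le> ennreal ((1/2) ^ (CARD('d) * r p) / l (r p) ^ CARD('d) * (6 * \<rho>) ^ CARD('d))"
      using * by (rule ennreal_leI)
    finally show ?thesis by (simp add: power_mult_distrib mult.assoc)
  qed
  show ?thesis
  proof (cases "p = N")
    case True
    then show ?thesis using growth_fine[OF \<rho>, of x] ge by (simp add: r_N)
  next
    case False
    then have p: "p < N" using p by simp
    show ?thesis
    proof (cases "h p / 2 \<le> \<rho>")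
      case True
      have "measure \<mu> {y. norm (y - x) \<le> \<rho>}
          \<le> (1/2) ^ (CARD('d) * (r (Suc p) - 1)) / h p ^ CARD('d) * (6 * \<rho>) ^ CARD('d)"
        unfolding h_def using r_Suc_ge[OF p] True by (intro growth_coarse) (auto simp: h_def)
      then show ?thesis unfolding density_block[OF p] by (rule ge)
    next
      case False
      then have "{y\<in>{y. sep p x y}. norm (y - x) \<le> \<rho>} = {}" using sep_dist[OF p] by fastforce
      then show ?thesis by (simp only: emeasure_empty zero_le)
    qed
  qed
qed

lemma row_bound:
  assumes p: "p \<le> N"
  shows "(\<integral>\<^sup>+ y. ennreal (S p x y) \<partial>\<mu>) \<le> ennreal (a p)"
proof -
  let ?G = "(1/2) ^ (CARD('d) * r p) / l (r p) ^ CARD('d) * 6 ^ CARD('d)"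
  have l: "0 < l (r p)" by (rule l_r_pos[OF p])
  have [measurable]: "{y. sep p x y} \<in> sets \<mu>"
    using measurable_compose[OF measurable_Pair1'[of x \<mu> \<mu>] sep_measurable[of p]] by (simp add: pred_def)
  have "(\<integral>\<^sup>+ y. ennreal (S p x y) \<partial>\<mu>) = (\<integral>\<^sup>+ y. ennreal (indicator {y. sep p x y} y * norm (y - x) powr (- s)) \<partial>\<mu>)"
    by (intro nn_integral_cong) (auto simp: S_def)
  also have "\<dots> \<le> ennreal (2 powr s / (1 - 2 powr (s - real CARD('d))) * ?G * (4 * real CARD('d) * l (r p)) powr (real CARD('d) - s))"
  proof (rule nn_integral_riesz_shells[OF s_pos s_less])
    show "0 < 4 * real CARD('d) * l (r p)" using l by simp
    show "0 \<le> ?G" using l by simp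
    show "0 \<le> norm (y - x) \<and> norm (y - x) \<le> 4 * real CARD('d) * l (r p)" if "y \<in> {y. sep p x y}" for y
      using that rel_dist[of p x y] by (auto simp: sep_def)
    show "emeasure \<mu> {y \<in> {y. sep p x y}. norm (y - x) \<le> \<rho>} \<le> ennreal (?G * \<rho> ^ CARD('d))" if "0 < \<rho>" for \<rho>
      using sep_growth[OF p that] .
  qed (auto simp: \<open>{y. sep p x y} \<in> sets \<mu>\<close>[simplified])
  also have "2 powr s / (1 - 2 powr (s - real CARD('d))) * ?G * (4 * real CARD('d) * l (r p)) powr (real CARD('d) - s) = a p"
  proof -
    have eq: "(4 * real CARD('d) * l (r p)) powr (real CARD('d) - s) = (4 * real CARD('d)) powr (real CARD('d) - s) * (l (r p) ^ CARD('d) / l (r p) powr s)"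
      using l by (simp add: powr_mult powr_diff powr_realpow)
    show ?thesis unfolding eq a_def riesz_row_const_def \<theta>_def cantor_theta_def using l p by simp
  qed
  finally show ?thesis .
qed

text \<open>By \<open>l_decay\<close> and \<open>sep_dist\<close>, moving x to its center is a shift
  by at most the fraction \<open>4 * d * (\<alpha> / 2) ^ (q - p)\<close> of the distance to y. The
  bound 1/(4d) on \<alpha> keeps it below one half, as the kernel estimate requires, and by
  \<open>sep_z\<close> the cutoff does not change.\<close>

lemma smooth_bound:
  assumes pq: "p < q" "q \<le> N" and x: "x \<in> Y q"
  shows "\<bar>k i p x y - k i p (z q x) y\<bar> \<le> 4 * real CARD('d) * riesz_lip s * (\<alpha> / 2) ^ (q - p) * S p x y"
proof (cases "sep p x y")
  case True
  have p: "p < N" using pq by simp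
  have h: "0 < h p" by (rule h_pos[OF p])
  have lip: "0 \<le> riesz_lip s" using s_pos by (simp add: riesz_lip_def)
  have u: "h p / 2 \<le> norm (y - x)" by (rule sep_dist[OF p True])
  have le: "norm (x - z q x) \<le> 2 * real CARD('d) * ((\<alpha> / 2) ^ (q - p) * h p)"
  proof (rule order_trans[OF z_dist[OF pq(2) x]])
    show "2 * real CARD('d) * l (r q) \<le> 2 * real CARD('d) * ((\<alpha> / 2) ^ (q - p) * h p)"
      by (intro mult_left_mono l_decay pq) auto
  qed
  have "(\<alpha> / 2) ^ (q - p) \<le> (\<alpha> / 2) ^ 1"
    using \<alpha>_pos \<alpha>_le pq by (intro power_decreasing) auto
  then have "2 * real CARD('d) * ((\<alpha> / 2) ^ (q - p) * h p) \<le> 2 * real CARD('d) * ((\<alpha> / 2) * h p)"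
    using h by (intro mult_left_mono mult_right_mono) auto
  also have "\<dots> = (real CARD('d) * \<alpha>) * h p" by simp
  also have "\<dots> \<le> (1 / 4) * h p" using \<alpha>_small h by (intro mult_right_mono) (auto simp: field_simps)
  finally have half: "norm ((y - x) - (y - z q x)) \<le> norm (y - x) / 2" using u le by (simp add: norm_minus_commute)
  have "\<bar>k i p x y - k i p (z q x) y\<bar> = \<bar>(riesz_kernel s (y - x) - riesz_kernel s (y - z q x)) $ i\<bar>"
    using True sep_z[OF pq x] by (simp add: k_def)
  also have "\<dots> \<le> norm (riesz_kernel s (y - x) - riesz_kernel s (y - z q x))" by (rule component_le_norm_cart)
  also have "\<dots> \<le> riesz_lip s * (norm ((y - x) - (y - z q x)) / norm (y - x)) * norm (y - x) powr (- s)"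
    using u h by (intro riesz_kernel_diff_le s_pos half) auto
  also have "\<dots> \<le> riesz_lip s * (4 * real CARD('d) * (\<alpha> / 2) ^ (q - p)) * norm (y - x) powr (- s)"
  proof (intro mult_right_mono mult_left_mono lip)
    have "norm ((y - x) - (y - z q x)) \<le> 2 * real CARD('d) * ((\<alpha> / 2) ^ (q - p) * h p)"
      using le by (simp add: norm_minus_commute)
    also have "\<dots> = 4 * real CARD('d) * (\<alpha> / 2) ^ (q - p) * (h p / 2)" by simp
    also have "\<dots> \<le> 4 * real CARD('d) * (\<alpha> / 2) ^ (q - p) * norm (y - x)"
      using u \<alpha>_pos by (intro mult_left_mono) auto
    finally show "norm ((y - x) - (y - z q x)) / norm (y - x) \<le> 4 * real CARD('d) * (\<alpha> / 2) ^ (q - p)"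
      using u h by (subst pos_divide_le_eq) auto
  qed auto
  finally show ?thesis using True by (simp add: S_def mult.commute mult.left_commute)
next
  case False
  then show ?thesis using sep_z[OF pq x] by (simp add: k_def S_def)
qed

section \<open>The pieces as a kernel tower\<close>

sublocale tower: kernel_tower \<mu> "k i" S z a "Suc N" "4 * real CARD('d) * riesz_lip s" "\<alpha> / 2" for i
proof
  have [measurable]: "(\<lambda>x :: real ^ 'd. x $ i) \<in> borel_measurable borel"
    by (intro borel_measurable_continuous_onI continuous_intros)
  show "space \<mu> = UNIV" by simp
  fix p q :: nat and x y :: "real ^ 'd"
  show "(\<lambda>(x, y). k i p x y) \<in> borel_measurable (\<mu> \<Otimes>\<^sub>M \<mu>)"
    unfolding k_def split_beta by (rule measurable_If[OF _ _ sep_measurable[unfolded pred_def]]) measurable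
  show "(\<lambda>(x, y). S p x y) \<in> borel_measurable (\<mu> \<Otimes>\<^sub>M \<mu>)"
    unfolding S_def split_beta by (rule measurable_If[OF _ _ sep_measurable[unfolded pred_def]]) measurable
  show "z p \<in> \<mu> \<rightarrow>\<^sub>M \<mu>" by (rule z_measurable')
  show "\<bar>k i p x y\<bar> \<le> S p x y"
    unfolding k_def S_def norm_riesz_kernel[symmetric] by (simp add: component_le_norm_cart)
  show "k i p y x = - k i p x y" using riesz_kernel_minus[of s "y - x"] by (simp add: k_def sep_sym[of p y x])
  show "S p y x = S p x y" by (simp add: S_def sep_sym[of p y x] norm_minus_commute)
  show "0 \<le> a p" by (rule a_nonneg)
  show "0 \<le> 4 * real CARD('d) * riesz_lip s" using s_pos by (simp add: riesz_lip_def)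
  show "0 \<le> \<alpha> / 2" "\<alpha> / 2 \<le> 1 / 2" using \<alpha>_pos \<alpha>_le by auto
  show "p < Suc N \<Longrightarrow> (\<integral>\<^sup>+ y. ennreal (S p x y) \<partial>\<mu>) \<le> ennreal (a p)"
    using row_bound[of p x] by simp
  show "p \<le> q \<Longrightarrow> q < Suc N \<Longrightarrow> k i q x y \<noteq> 0 \<Longrightarrow> z p x = z p y"
    using rel_antimono[of p q x y] rel_imp_z_eq[of p x y] by (auto simp: k_def sep_def split: if_splits)
  show "AE x in \<mu>. \<forall>y. \<bar>k i p x y - k i p (z q x) y\<bar> \<le> 4 * real CARD('d) * riesz_lip s * (\<alpha> / 2) ^ (q - p) * S p x y"
    if pq: "p < q" "q < Suc N"
  proof -
    have "AE x in \<mu>. x \<in> Y q" using AE_Y[of q] pq by simp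
    then show ?thesis by eventually_elim (use pq smooth_bound in auto)
  qed
qed

lemma S_bounded: "p < N \<Longrightarrow> S p x y \<le> (\<Sum>p<N. (h p / 2) powr (- s))"
proof -
  assume p: "p < N"
  have "S p x y \<le> (h p / 2) powr (- s)"
    using sep_dist[OF p, of x y] h_pos[OF p] s_pos by (auto simp: S_def intro!: powr_mono2')
  also have "\<dots> \<le> (\<Sum>p<N. (h p / 2) powr (- s))" using p by (intro member_le_sum) auto
  finally show ?thesis .
qed

text \<open>The tower without its last level: the separation bounds \<open>S p\<close> for p < N,
  whereas \<open>S N\<close> is unbounded near the diagonal.\<close>

sublocale btower: bounded_kernel_tower \<mu> "k i" S z a N "4 * real CARD('d) * riesz_lip s" "\<alpha> / 2" "\<Sum>p<N. (h p / 2) powr (- s)" for i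
proof (intro_locales)
  show "kernel_tower_axioms \<mu> (k i) S z a N (4 * real CARD('d) * riesz_lip s) (\<alpha> / 2)"
    using tower.kernel_tower_axioms unfolding kernel_tower_def kernel_tower_axioms_def
    by (meson less_SucI)
  show "bounded_kernel_tower_axioms S N (\<Sum>p<N. (h p / 2) powr (- s))" by unfold_locales (rule S_bounded)
qed

end

section \<open>Principal values and truncations\<close>

context riesz_cantor
begin

lemma rel_0: "x \<in> Y 0 \<Longrightarrow> y \<in> Y 0 \<Longrightarrow> rel 0 x y" by (auto simp: Y_def rel_def r_0)

lemma sep_unique:
  assumes "p \<le> N" "q \<le> N" "sep p x y" "sep q x y"
  shows "p = q"
proof -
  have *: "\<not> p < q" if "q \<le> N" "sep p x y" "sep q x y" for p q
  proof
    assume "p < q"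
    then have "\<not> rel (Suc p) x y" using that by (auto simp: sep_def)
    moreover have "rel (Suc p) x y" using rel_antimono[of "Suc p" q x y] that \<open>p < q\<close> by (auto simp: sep_def)
    ultimately show False by blast
  qed
  show ?thesis using *[of q p] *[of p q] assms by linarith
qed

text \<open>The level sought is the last one on which the two points share a cube.\<close>

lemma sep_ex:
  assumes "x \<in> Y N" "y \<in> Y N"
  obtains p where "p \<le> N" "sep p x y"
proof -
  define p where "p = Max {p. p \<le> N \<and> rel p x y}"
  have Y: "x \<in> Y q" "y \<in> Y q" if "q \<le> N" for q using Y_decreasing[OF that] assms by auto
  have "0 \<in> {p. p \<le> N \<and> rel p x y}" using rel_0 Y[of 0] by auto
  then have "p \<in> {p. p \<le> N \<and> rel p x y}" unfolding p_def by (intro Max_in) auto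
  then have p: "p \<le> N" "rel p x y" by auto
  moreover have "\<not> rel (Suc p) x y" if "p < N"
  proof
    assume "rel (Suc p) x y"
    then have "Suc p \<in> {p. p \<le> N \<and> rel p x y}" using that by simp
    then have "Suc p \<le> p" unfolding p_def[symmetric] by (subst p_def) (rule Max_ge, auto)
    then show False by simp
  qed
  ultimately have "sep p x y" using Y[of "Suc p"] by (auto simp: sep_def)
  with p show thesis using that by blast
qed

lemma sum_sep_eq:
  fixes g :: "nat \<Rightarrow> real"
  assumes "p \<le> N" "sep p x y"
  shows "(\<Sum>q<Suc N. if sep q x y then g q else 0) = g p"
proof -
  have "(\<Sum>q<Suc N. if sep q x y then g q else 0) = (\<Sum>q<Suc N. if q = p then g p else 0)"
    using assms sep_unique[of p] by (intro sum.cong) (auto simp: less_Suc_eq_le)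
  then show ?thesis using assms by simp
qed

lemma sum_k_eq:
  assumes "x \<in> Y N" "y \<in> Y N"
  shows "(\<Sum>p<Suc N. k i p x y) = riesz_kernel s (y - x) $ i"
proof -
  obtain p where p: "p \<le> N" "sep p x y" using assms by (rule sep_ex)
  show ?thesis unfolding k_def by (rule sum_sep_eq[OF p])
qed

lemma sum_S_eq:
  assumes "x \<in> Y N" "y \<in> Y N"
  shows "(\<Sum>p<Suc N. S p x y) = norm (y - x) powr (- s)"
proof -
  obtain p where p: "p \<le> N" "sep p x y" using assms by (rule sep_ex)
  show ?thesis unfolding S_def by (rule sum_sep_eq[OF p])
qed

lemma vec_nth_measurable [measurable]: "(\<lambda>x :: real ^ 'd. x $ i) \<in> borel_measurable borel"
  by (intro borel_measurable_continuous_onI continuous_intros)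

text \<open>All N + 1 row sums are finite, level N included because s < d. So the principal value is
  an absolutely convergent integral.\<close>

lemma integrable_riesz_kernel:
  assumes x: "x \<in> Y N"
  shows "integrable \<mu> (\<lambda>y. riesz_kernel s (y - x))"
proof (rule Bochner_Integration.integrable_bound)
  show "integrable \<mu> (\<lambda>y. \<Sum>p<Suc N. S p x y)"
    by (intro Bochner_Integration.integrable_sum tower.integrable_s) auto
  show "AE y in \<mu>. norm (riesz_kernel s (y - x)) \<le> norm (\<Sum>p<Suc N. S p x y)"
    using AE_Y[OF order_refl] by eventually_elim (simp only: sum_S_eq[OF x] norm_riesz_kernel real_norm_def abs_of_nonneg powr_ge_zero order_refl)
qed measurable

lemma integral_vec_nth: "integrable M f \<Longrightarrow> (LINT x|M. f x) $ i = (LINT x|M. f x $ i)"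
  for f :: "'b \<Rightarrow> real ^ 'd" by (rule integral_bounded_linear[OF bounded_linear_vec_nth, symmetric])

lemma riesz_trunc_tendsto:
  assumes x: "x \<in> Y N"
  shows "((\<lambda>\<epsilon>. riesz_trunc s \<mu> \<epsilon> x) \<longlongrightarrow> (LINT y|\<mu>. riesz_kernel s (y - x))) (at_right 0)"
proof (rule tendsto_at_right_sequentially[of 0 1])
  fix e :: "nat \<Rightarrow> real" assume e: "\<And>n. 0 < e n" "e \<longlonglongrightarrow> 0"
  show "(\<lambda>n. riesz_trunc s \<mu> (e n) x) \<longlonglongrightarrow> (LINT y|\<mu>. riesz_kernel s (y - x))"
    unfolding riesz_trunc_def set_lebesgue_integral_def
  proof (rule integral_dominated_convergence)
    show "integrable \<mu> (\<lambda>y. norm (riesz_kernel s (y - x)))"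
      using integrable_riesz_kernel[OF x] by (rule integrable_norm)
    show "AE y in \<mu>. (\<lambda>n. indicat_real {y. e n < norm (y - x)} y *\<^sub>R riesz_kernel s (y - x)) \<longlonglongrightarrow> riesz_kernel s (y - x)"
    proof (intro always_eventually allI)
      fix y
      show "(\<lambda>n. indicat_real {y. e n < norm (y - x)} y *\<^sub>R riesz_kernel s (y - x)) \<longlonglongrightarrow> riesz_kernel s (y - x)"
      proof (cases "y = x")
        case False
        then have "\<forall>\<^sub>F n in sequentially. e n < norm (y - x)" using order_tendstoD(2)[OF e(2)] by simp
        then have "\<forall>\<^sub>F n in sequentially. indicat_real {y. e n < norm (y - x)} y *\<^sub>R riesz_kernel s (y - x) = riesz_kernel s (y - x)"
          by eventually_elim simp
        then show ?thesis by (rule tendsto_eventually)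
      qed (simp add: riesz_kernel_def)
    qed
    show "AE y in \<mu>. norm (indicat_real {y. e n < norm (y - x)} y *\<^sub>R riesz_kernel s (y - x)) \<le> norm (riesz_kernel s (y - x))" for n
      by (intro always_eventually allI) (auto simp: indicator_def)
    show "(\<lambda>y. indicat_real {y. e n < norm (y - x)} y *\<^sub>R riesz_kernel s (y - x)) \<in> borel_measurable \<mu>" for n
      by measurable
  qed measurable
qed simp

lemma AE_riesz_defined: "AE x in \<mu>. riesz_defined_at s \<mu> x"
  using AE_Y[OF order_refl] by eventually_elim (auto simp: riesz_defined_at_def intro: riesz_trunc_tendsto)

lemma riesz_eq:
  assumes "x \<in> Y N"
  shows "riesz s \<mu> x = (LINT y|\<mu>. riesz_kernel s (y - x))"
  unfolding riesz_def by (rule tendsto_Lim[OF _ riesz_trunc_tendsto[OF assms]]) simp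

lemma riesz_component:
  assumes x: "x \<in> Y N"
  shows "riesz s \<mu> x $ i = (\<Sum>p<Suc N. tower.u i p x)"
proof -
  have "riesz s \<mu> x $ i = (LINT y|\<mu>. riesz_kernel s (y - x) $ i)"
    unfolding riesz_eq[OF x] by (rule integral_vec_nth[OF integrable_riesz_kernel[OF x]])
  also have "\<dots> = (LINT y|\<mu>. (\<Sum>p<Suc N. k i p x y))"
  proof (rule integral_cong_AE)
    show "AE y in \<mu>. riesz_kernel s (y - x) $ i = (\<Sum>p<Suc N. k i p x y)"
      using AE_Y[OF order_refl] by eventually_elim (rule sum_k_eq[OF x, symmetric])
    show "(\<lambda>y. \<Sum>p<Suc N. k i p x y) \<in> borel_measurable \<mu>"
      by (intro borel_measurable_sum tower.sections) auto
  qed measurable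
  also have "\<dots> = (\<Sum>p<Suc N. tower.u i p x)"
    unfolding tower.u_def by (intro Bochner_Integration.integral_sum tower.integrable_k) auto
  finally show ?thesis .
qed

lemma riesz_trunc_op_measurable:
  assumes [measurable]: "f \<in> borel_measurable \<mu>"
  shows "riesz_trunc_op s \<mu> \<epsilon> f \<in> borel_measurable \<mu>"
proof -
  have "(\<lambda>x. \<integral>y. indicat_real {w. norm (snd w - fst w) > \<epsilon>} (x, y) *\<^sub>R (f y *\<^sub>R riesz_kernel s (y - x)) \<partial>\<mu>) \<in> borel_measurable \<mu>"
    by measurable
  then show ?thesis
    unfolding riesz_trunc_op_def[abs_def] set_lebesgue_integral_def by (simp add: indicator_def)
qed

text \<open>The function 1 has norm 1, as \<mu> is a probability measure, and Fatou's lemma lets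
  \<epsilon> tend to 0. This carries the upper bound from the operator to \<open>riesz\<close> and
  the lower bound back.\<close>

lemma L2_enorm_riesz_le_opnorm: "L2_enorm \<mu> (riesz s \<mu>) \<le> riesz_opnorm s \<mu>"
proof (cases "riesz_opnorm s \<mu>")
  case (real C)
  have m: "(\<lambda>x. riesz_trunc s \<mu> \<epsilon> x) \<in> borel_measurable \<mu>" for \<epsilon>
    using riesz_trunc_op_measurable[of "\<lambda>_. 1" \<epsilon>] by (simp add: riesz_trunc_op_def[abs_def] riesz_trunc_def[abs_def])
  have one: "L2_enorm \<mu> (\<lambda>_. 1 :: real) \<le> 1" using emeasure_\<mu>_UNIV by (simp add: L2_enorm_def)
  have trunc: "(\<integral>\<^sup>+ x. ennreal ((norm (riesz_trunc s \<mu> \<epsilon> x))^2) \<partial>\<mu>) \<le> ennreal (C^2)" if \<epsilon>: "0 < \<epsilon>" for \<epsilon>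
  proof -
    have "L2_enorm \<mu> (riesz_trunc_op s \<mu> \<epsilon> (\<lambda>_. 1)) \<le> riesz_opnorm s \<mu>"
      unfolding riesz_opnorm_def using \<epsilon> one by (intro SUP_upper2[of \<epsilon>] SUP_upper) auto
    then have "L2_enorm \<mu> (riesz_trunc s \<mu> \<epsilon>) \<le> ennreal C"
      using real by (simp add: riesz_trunc_op_def[abs_def] riesz_trunc_def[abs_def])
    then show ?thesis using L2_enorm_le_iff[of C \<mu> "riesz_trunc s \<mu> \<epsilon>"] real by simp
  qed
  define e :: "nat \<Rightarrow> real" where "e n = 1 / Suc n" for n
  have e: "e \<longlonglongrightarrow> 0" "\<And>n. 0 < e n" unfolding e_def[abs_def] using LIMSEQ_inverse_real_of_nat by (simp_all add: inverse_eq_divide)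
  have lim: "AE x in \<mu>. ennreal ((norm (riesz s \<mu> x))^2) = liminf (\<lambda>n. ennreal ((norm (riesz_trunc s \<mu> (e n) x))^2))"
    using AE_Y[OF order_refl]
  proof eventually_elim
    case (elim x)
    have "filterlim e (at_right 0) sequentially"
      using e(1) less_imp_neq[OF e(2)] e(2) by (fastforce simp: filterlim_at intro!: always_eventually)
    then have "(\<lambda>n. riesz_trunc s \<mu> (e n) x) \<longlonglongrightarrow> riesz s \<mu> x"
      unfolding riesz_eq[OF elim] by (rule filterlim_compose[OF riesz_trunc_tendsto[OF elim]])
    then have "(\<lambda>n. ennreal ((norm (riesz_trunc s \<mu> (e n) x))^2)) \<longlonglongrightarrow> ennreal ((norm (riesz s \<mu> x))^2)"
      by (intro tendsto_ennrealI tendsto_power tendsto_norm)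
    then show ?case by (intro lim_imp_Liminf[symmetric]) auto
  qed
  have "(\<integral>\<^sup>+ x. ennreal ((norm (riesz s \<mu> x))^2) \<partial>\<mu>) = (\<integral>\<^sup>+ x. liminf (\<lambda>n. ennreal ((norm (riesz_trunc s \<mu> (e n) x))^2)) \<partial>\<mu>)"
    by (rule nn_integral_cong_AE[OF lim])
  also have "\<dots> \<le> liminf (\<lambda>n. \<integral>\<^sup>+ x. ennreal ((norm (riesz_trunc s \<mu> (e n) x))^2) \<partial>\<mu>)"
    by (intro nn_integral_liminf measurable_compose[OF m]) measurable
  also have "\<dots> \<le> liminf (\<lambda>n :: nat. ennreal (C^2))"
    using trunc e(2) by (intro Liminf_mono always_eventually allI) auto
  also have "\<dots> = ennreal (C^2)" by (simp add: Liminf_const)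
  finally show ?thesis using L2_enorm_le_iff[of C \<mu> "riesz s \<mu>"] real by simp
qed simp

text \<open>P is the last level whose diameter bound exceeds \<epsilon>. That diameter bound is
  below the gap of each earlier level, since \<alpha> is at most 1/(4d), so earlier pieces survive
  whole; later pieces live within distance \<epsilon> and vanish. In the first alternative
  \<epsilon> is at least the diameter bound of the initial cube.\<close>

lemma partial_sum_of_trunc:
  assumes \<epsilon>: "0 < \<epsilon>"
  obtains "\<And>x y. x \<in> Y N \<Longrightarrow> y \<in> Y N \<Longrightarrow> \<not> \<epsilon> < norm (y - x)"
  | P where "P \<le> N" "\<And>x y i. x \<in> Y N \<Longrightarrow> y \<in> Y N \<Longrightarrow>
      indicat_real {y. \<epsilon> < norm (y - x)} y * riesz_kernel s (y - x) $ i
      = (\<Sum>p<P. k i p x y) + indicat_real {y. \<epsilon> < norm (y - x)} y * k i P x y"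
proof (cases "\<exists>p\<le>N. \<epsilon> < 4 * real CARD('d) * l (r p)")
  case False
  have "\<not> \<epsilon> < norm (y - x)" if "x \<in> Y N" "y \<in> Y N" for x y
  proof -
    have "x \<in> Y 0" "y \<in> Y 0" using Y_decreasing[of 0 N] that by auto
    from rel_dist[OF rel_0[OF this]] show ?thesis using False by force
  qed
  then show thesis using that(1) by blast
next
  case True
  define P where "P = Max {p. p \<le> N \<and> \<epsilon> < 4 * real CARD('d) * l (r p)}"
  have "P \<in> {p. p \<le> N \<and> \<epsilon> < 4 * real CARD('d) * l (r p)}" unfolding P_def using True by (intro Max_in) auto
  then have P: "P \<le> N" "\<epsilon> < 4 * real CARD('d) * l (r P)" by auto
  have below: "4 * real CARD('d) * l (r p) \<le> \<epsilon>" if "P < p" "p \<le> N" for p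
  proof (rule ccontr)
    assume "\<not> ?thesis"
    then have "p \<le> P" unfolding P_def using that by (intro Max_ge) auto
    with that show False by simp
  qed
  have above: "\<epsilon> < norm (y - x)" if "p < P" "sep p x y" for p x y
  proof -
    have p: "p < N" using that P by simp
    have "l (r P) \<le> (\<alpha> / 2) ^ (P - p) * h p" using l_decay[of p P] that P by simp
    also have "\<dots> \<le> (\<alpha> / 2) ^ 1 * h p"
      using \<alpha>_pos \<alpha>_le that h_pos[OF p] by (intro mult_right_mono power_decreasing) auto
    finally have "4 * real CARD('d) * l (r P) \<le> 4 * real CARD('d) * (\<alpha> / 2 * h p)" by (intro mult_left_mono) auto
    also have "\<dots> = 2 * ((real CARD('d) * \<alpha>) * h p)" by simp
    also have "\<dots> \<le> 2 * ((1 / 4) * h p)"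
      using \<alpha>_small h_pos[OF p] by (intro mult_left_mono mult_right_mono) (auto simp: field_simps)
    finally show ?thesis using sep_dist[OF p that(2)] P(2) by linarith
  qed
  show thesis
  proof (rule that(2)[OF P(1)])
    fix x y i assume xy: "x \<in> Y N" "y \<in> Y N"
    then obtain p where p: "p \<le> N" "sep p x y" by (rule sep_ex)
    have k0: "k i q x y = 0" if "q \<noteq> p" "q \<le> N" for q
      using sep_unique[OF p(1) that(2) p(2)] that by (auto simp: k_def)
    have kp: "k i p x y = riesz_kernel s (y - x) $ i" using p by (simp add: k_def)
    consider "p < P" | "p = P" | "P < p" by linarith
    then show "indicat_real {y. \<epsilon> < norm (y - x)} y * riesz_kernel s (y - x) $ i
        = (\<Sum>p<P. k i p x y) + indicat_real {y. \<epsilon> < norm (y - x)} y * k i P x y"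
    proof cases
      case 1
      have "(\<Sum>q<P. k i q x y) = (\<Sum>q<P. if q = p then k i p x y else 0)" using k0 P(1) by (intro sum.cong) auto
      then show ?thesis using 1 above[OF 1 p(2)] k0[of P] P(1) kp by simp
    next
      case 2
      have "(\<Sum>q<P. k i q x y) = 0" using k0 P(1) 2 by (intro sum.neutral) auto
      then show ?thesis using 2 kp by simp
    next
      case 3
      have "(\<Sum>q<P. k i q x y) = 0" using k0 P(1) 3 by (intro sum.neutral) auto
      moreover have "norm (y - x) \<le> \<epsilon>" using rel_dist[of p x y] p below[OF 3 p(1)] by (auto simp: sep_def)
      ultimately show ?thesis by simp
    qed
  qed
qed

text \<open>As P \<le> N, the untouched pieces form a partial sum of the bounded tower. The cut
  piece need not be smooth any more, but Schur's test asks only for the majorant \<open>S P\<close>,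
  and this works for P = N too.\<close>

lemma component_bound:
  assumes \<epsilon>: "0 < \<epsilon>" and f [measurable]: "f \<in> borel_measurable \<mu>"
    and f2: "(\<integral>\<^sup>+ x. ennreal ((f x)^2) \<partial>\<mu>) \<le> 1"
    and E_pos: "0 < E" and E: "(\<Sum>p<Suc N. (a p)^2) \<le> E"
  shows "(\<integral>\<^sup>+ x. ennreal ((riesz_trunc_op s \<mu> \<epsilon> f x $ i)^2) \<partial>\<mu>) \<le> ennreal (2 * (riesz_norm_const CARD('d) s + 1) * E)"
proof -
  let ?I = "\<lambda>x y. indicat_real {y. \<epsilon> < norm (y - x)} y"
  have f_sq: "integrable \<mu> (\<lambda>x. (f x)^2)" using f2 by (intro integrableI_nonneg) (auto simp: le_less_trans)
  have f_1: "(LINT x|\<mu>. (f x)^2) \<le> 1" using f2 f_sq by (simp add: nn_integral_eq_integral ennreal_le_1)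
  have f_int: "integrable \<mu> f" using integral_Cauchy_Schwarz(1)[of f \<mu> "\<lambda>_. 1"] f_sq by simp
  have uc: "0 \<le> riesz_norm_const CARD('d) s" using s_pos by (simp add: riesz_norm_const_def riesz_lip_def)
  have int: "integrable \<mu> (\<lambda>y. ?I x y *\<^sub>R (f y *\<^sub>R riesz_kernel s (y - x)))" for x
  proof (rule Bochner_Integration.integrable_bound)
    show "integrable \<mu> (\<lambda>y. \<epsilon> powr (- s) * f y)" using f_int by simp
    show "AE y in \<mu>. norm (?I x y *\<^sub>R (f y *\<^sub>R riesz_kernel s (y - x))) \<le> norm (\<epsilon> powr (- s) * f y)"
    proof (intro always_eventually allI)
      fix y
      have "\<epsilon> < norm (y - x) \<Longrightarrow> norm (y - x) powr (- s) \<le> \<epsilon> powr (- s)"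
        using \<epsilon> s_pos by (intro powr_mono2') auto
      then show "norm (?I x y *\<^sub>R (f y *\<^sub>R riesz_kernel s (y - x))) \<le> norm (\<epsilon> powr (- s) * f y)"
        by (auto simp: norm_riesz_kernel abs_mult indicator_def mult.commute mult_left_mono)
    qed
  qed measurable
  have comp: "riesz_trunc_op s \<mu> \<epsilon> f x $ i = (LINT y|\<mu>. (?I x y * riesz_kernel s (y - x) $ i) * f y)" for x
    unfolding riesz_trunc_op_def set_lebesgue_integral_def
    by (subst integral_vec_nth[OF int]) (simp add: mult.commute mult.left_commute)
  show ?thesis
  proof (rule partial_sum_of_trunc[OF \<epsilon>])
    assume zero: "\<And>x y. x \<in> Y N \<Longrightarrow> y \<in> Y N \<Longrightarrow> \<not> \<epsilon> < norm (y - x)"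
    have "AE x in \<mu>. riesz_trunc_op s \<mu> \<epsilon> f x $ i = 0" using AE_Y[OF order_refl]
    proof eventually_elim
      case (elim x)
      have "AE y in \<mu>. (?I x y * riesz_kernel s (y - x) $ i) * f y = 0"
        using AE_Y[OF order_refl] by eventually_elim (use zero[OF elim] in simp)
      then show ?case unfolding comp by (rule integral_eq_zero_AE)
    qed
    then have "(\<integral>\<^sup>+ x. ennreal ((riesz_trunc_op s \<mu> \<epsilon> f x $ i)^2) \<partial>\<mu>) = (\<integral>\<^sup>+ x. 0 \<partial>\<mu>)"
      by (intro nn_integral_cong_AE) (auto elim: eventually_mono)
    then show ?thesis by simp
  next
    fix P assume P: "P \<le> N" and dec: "\<And>x y i. x \<in> Y N \<Longrightarrow> y \<in> Y N \<Longrightarrow>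
      ?I x y * riesz_kernel s (y - x) $ i = (\<Sum>p<P. k i p x y) + ?I x y * k i P x y"
    define V where "V x = (LINT y|\<mu>. ?I x y * k i P x y * f y)" for x
    define t where "t x = (\<Sum>p<P. tower.U i p f x)" for x
    have "(\<Sum>p<N. (a p)^2) \<le> (\<Sum>p<Suc N. (a p)^2)" by simp
    with E have EN: "(\<Sum>p<N. (a p)^2) \<le> E" by linarith
    have intk: "integrable \<mu> (\<lambda>y. k i p x y * f y)" if "p < P" for p x
      by (rule btower.integrable_k_f[OF f f_sq f_1 E_pos EN]) (use that P in simp)
    have eq: "AE x in \<mu>. riesz_trunc_op s \<mu> \<epsilon> f x $ i = t x + V x" using AE_Y[OF order_refl]
    proof eventually_elim
      case (elim x)
      have kP [measurable]: "k i P x \<in> borel_measurable \<mu>" using P by (intro tower.sections) auto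
      have iV: "integrable \<mu> (\<lambda>y. ?I x y * k i P x y * f y)"
      proof (rule Bochner_Integration.integrable_bound)
        show "integrable \<mu> (\<lambda>y. \<epsilon> powr (- s) * f y)" using f_int by simp
        show "AE y in \<mu>. norm (?I x y * k i P x y * f y) \<le> norm (\<epsilon> powr (- s) * f y)"
        proof (intro always_eventually allI)
          fix y
          have "\<bar>?I x y * k i P x y\<bar> \<le> \<epsilon> powr (- s)"
          proof (cases "\<epsilon> < norm (y - x)")
            case True
            have "\<bar>k i P x y\<bar> \<le> norm (riesz_kernel s (y - x))" by (simp add: k_def component_le_norm_cart)
            also have "\<dots> \<le> \<epsilon> powr (- s)"
              unfolding norm_riesz_kernel using True \<epsilon> s_pos by (intro powr_mono2') auto
            finally show ?thesis by (simp add: abs_mult indicator_def)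
          qed simp
          then show "norm (?I x y * k i P x y * f y) \<le> norm (\<epsilon> powr (- s) * f y)"
            by (simp add: abs_mult mult_right_mono)
        qed
      qed measurable
      have "riesz_trunc_op s \<mu> \<epsilon> f x $ i = (LINT y|\<mu>. (\<Sum>p<P. k i p x y * f y) + ?I x y * k i P x y * f y)"
        unfolding comp
      proof (rule integral_cong_AE)
        show "AE y in \<mu>. ?I x y * riesz_kernel s (y - x) $ i * f y = (\<Sum>p<P. k i p x y * f y) + ?I x y * k i P x y * f y"
          using AE_Y[OF order_refl]
          by eventually_elim (simp only: dec[OF elim] distrib_right sum_distrib_right)
        show "(\<lambda>y. (\<Sum>p<P. k i p x y * f y) + ?I x y * k i P x y * f y) \<in> borel_measurable \<mu>"
          using P by (intro borel_measurable_add borel_measurable_sum borel_measurable_times tower.sections) auto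
      qed measurable
      also have "\<dots> = (LINT y|\<mu>. (\<Sum>p<P. k i p x y * f y)) + V x"
        unfolding V_def by (intro Bochner_Integration.integral_add Bochner_Integration.integrable_sum intk iV) auto
      also have "(LINT y|\<mu>. (\<Sum>p<P. k i p x y * f y)) = t x"
        unfolding t_def tower.U_def by (intro Bochner_Integration.integral_sum intk) auto
      finally show ?case .
    qed
    have PN: "P < Suc N" using P by simp
    have a_le: "(a p)^2 \<le> E" if "p \<le> N" for p
      using member_le_sum[of p "{..<Suc N}" "\<lambda>p. (a p)^2"] that E by simp
    have t_meas [measurable]: "t \<in> borel_measurable \<mu>"
      unfolding t_def[abs_def] using P by (intro borel_measurable_sum tower.U_measurable) auto
    have t_sq: "integrable \<mu> (\<lambda>x. (t x)^2)"
      unfolding t_def using P by (intro \<mu>.bdd_fun_integrable \<mu>.bdd_fun_intros btower.U_bounded[OF f f_sq f_1 E_pos EN]) auto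
    have t: "(\<integral>\<^sup>+ x. ennreal ((t x)^2) \<partial>\<mu>) \<le> ennreal (riesz_norm_const CARD('d) s * E)"
    proof -
      have "(LINT x|\<mu>. (t x)^2) \<le> riesz_norm_const CARD('d) s * E"
        unfolding t_def riesz_norm_const_def by (rule btower.integral_sum_U_square_le[OF f f_sq f_1 E_pos EN P])
      then show ?thesis by (simp add: nn_integral_eq_integral[OF t_sq] ennreal_leI)
    qed
    have V: "(\<integral>\<^sup>+ x. ennreal ((V x)^2) \<partial>\<mu>) \<le> ennreal E"
    proof -
      have "ennreal ((V x)^2) \<le> (\<integral>\<^sup>+ y. ennreal (S P x y) * ennreal \<bar>f y\<bar> \<partial>\<mu>)^2" for x
      proof -
        \<comment> \<open>Where the integrand is not integrable, \<open>V x\<close> is 0 by default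
          and the bound is trivial.\<close>
        have "ennreal \<bar>V x\<bar> \<le> (\<integral>\<^sup>+ y. ennreal \<bar>?I x y * k i P x y * f y\<bar> \<partial>\<mu>)"
          unfolding V_def by (cases "integrable \<mu> (\<lambda>y. ?I x y * k i P x y * f y)")
            (use integral_norm_bound_ennreal[of \<mu> "\<lambda>y. ?I x y * k i P x y * f y"] in \<open>auto simp: not_integrable_integral_eq\<close>)
        also have "\<dots> \<le> (\<integral>\<^sup>+ y. ennreal (S P x y) * ennreal \<bar>f y\<bar> \<partial>\<mu>)"
        proof (intro nn_integral_mono)
          fix y
          have "\<bar>?I x y * k i P x y * f y\<bar> \<le> \<bar>k i P x y\<bar> * \<bar>f y\<bar>"
            by (auto simp: abs_mult indicator_def)
          also have "\<dots> \<le> S P x y * \<bar>f y\<bar>"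
            using tower.k_le_s[of P i x y] P by (intro mult_right_mono) auto
          finally show "ennreal \<bar>?I x y * k i P x y * f y\<bar> \<le> ennreal (S P x y) * ennreal \<bar>f y\<bar>"
            by (subst ennreal_mult[symmetric]) (auto simp: S_def intro: ennreal_leI)
        qed
        finally have "(ennreal \<bar>V x\<bar>)^2 \<le> (\<integral>\<^sup>+ y. ennreal (S P x y) * ennreal \<bar>f y\<bar> \<partial>\<mu>)^2"
          by (rule power_mono) simp
        then show ?thesis by (simp add: ennreal_power)
      qed
      then have "(\<integral>\<^sup>+ x. ennreal ((V x)^2) \<partial>\<mu>) \<le> (\<integral>\<^sup>+ x. (\<integral>\<^sup>+ y. ennreal (S P x y) * ennreal \<bar>f y\<bar> \<partial>\<mu>)^2 \<partial>\<mu>)"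
        by (intro nn_integral_mono) auto
      also have "\<dots> \<le> (ennreal (a P))^2 * (\<integral>\<^sup>+ y. (ennreal \<bar>f y\<bar>)^2 \<partial>\<mu>)"
      proof (rule Schur_test_nn_integral)
        show "(\<lambda>(x, y). ennreal (S P x y)) \<in> borel_measurable (\<mu> \<Otimes>\<^sub>M \<mu>)"
          using measurable_compose[OF tower.s_measurable[OF PN] measurable_ennreal] by (simp add: split_beta')
        show "(\<integral>\<^sup>+ x. ennreal (S P x y) \<partial>\<mu>) \<le> ennreal (a P)" for y
          using row_bound[OF P, of y] tower.s_sym[of P y] P by simp
      qed (use row_bound[OF P] in \<open>auto intro: \<mu>.sigma_finite_measure_axioms\<close>)
      also have "(\<integral>\<^sup>+ y. (ennreal \<bar>f y\<bar>)^2 \<partial>\<mu>) \<le> 1" using f2 by (simp add: ennreal_power)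
      also have "(ennreal (a P))^2 * 1 \<le> ennreal E"
        using a_le[OF P] a_nonneg by (simp add: ennreal_power ennreal_leI)
      finally show ?thesis by (simp add: mult_left_mono)
    qed
    have V_meas: "V \<in> borel_measurable \<mu>"
    proof -
      have [measurable]: "(\<lambda>w. k i P (fst w) (snd w)) \<in> borel_measurable (borel \<Otimes>\<^sub>M borel)"
        using tower.k_measurable[OF PN, of i]
        unfolding measurable_cong_sets[OF sets_pair_measure_cong[OF sets_\<mu> sets_\<mu>] refl] by (simp add: split_beta')
      have "(\<lambda>x. \<integral>y. indicat_real {w. norm (snd w - fst w) > \<epsilon>} (x, y) * k i P x y * f y \<partial>\<mu>) \<in> borel_measurable \<mu>"
        by measurable
      then show ?thesis unfolding V_def[abs_def] by (simp add: indicator_def)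
    qed
    have "(\<integral>\<^sup>+ x. ennreal ((riesz_trunc_op s \<mu> \<epsilon> f x $ i)^2) \<partial>\<mu>)
        \<le> (\<integral>\<^sup>+ x. 2 * ennreal ((t x)^2) + 2 * ennreal ((V x)^2) \<partial>\<mu>)"
    proof (rule nn_integral_mono_AE)
      show "AE x in \<mu>. ennreal ((riesz_trunc_op s \<mu> \<epsilon> f x $ i)^2) \<le> 2 * ennreal ((t x)^2) + 2 * ennreal ((V x)^2)"
        using eq
      proof eventually_elim
        case (elim x)
        have "(t x + V x)^2 \<le> 2 * (t x)^2 + 2 * (V x)^2"
          using zero_le_power2[of "t x - V x"] by (simp add: power2_eq_square algebra_simps)
        then have "ennreal ((t x + V x)^2) \<le> ennreal (2 * (t x)^2 + 2 * (V x)^2)" by (rule ennreal_leI)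
        then show ?case using elim by (simp add: ennreal_plus ennreal_mult)
      qed
    qed
    also have "\<dots> = 2 * (\<integral>\<^sup>+ x. ennreal ((t x)^2) \<partial>\<mu>) + 2 * (\<integral>\<^sup>+ x. ennreal ((V x)^2) \<partial>\<mu>)"
      using V_meas by (subst nn_integral_add) (auto simp: nn_integral_cmult)
    also have "\<dots> \<le> 2 * ennreal (riesz_norm_const CARD('d) s * E) + 2 * ennreal E"
      by (intro add_mono mult_left_mono t V) auto
    also have "\<dots> = ennreal (2 * (riesz_norm_const CARD('d) s + 1) * E)"
    proof -
      have two: "2 * ennreal c = ennreal (2 * c)" for c by (simp add: ennreal_mult')
      have "2 * (riesz_norm_const CARD('d) s + 1) * E = 2 * (riesz_norm_const CARD('d) s * E) + 2 * E" by (simp add: algebra_simps)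
      then show ?thesis unfolding two using uc E_pos by (simp add: ennreal_plus)
    qed
    finally show ?thesis .
  qed
qed

end

section \<open>Norm estimates\<close>

context riesz_cantor
begin

lemma a_eq: "p \<le> N \<Longrightarrow> a p = riesz_row_const CARD('d) s * \<theta> p" by (simp add: a_def)

lemma sum_a_sq: "(\<Sum>p<Suc N. (a p)^2) = (riesz_row_const CARD('d) s)^2 * (\<Sum>p<Suc N. (\<theta> p)^2)"
  unfolding sum_distrib_left by (intro sum.cong refl) (auto simp: a_eq power_mult_distrib)

lemma sum_\<theta>_sq_pos: "0 < (\<Sum>p<Suc N. (\<theta> p)^2)"
proof (rule sum_pos)
  fix p assume "p \<in> {..<Suc N}"
  then show "0 < (\<theta> p)^2" using \<theta>_pos[of p] by (intro zero_less_power) simp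
qed auto

lemma riesz_opnorm_le:
  "riesz_opnorm s \<mu> \<le> ennreal (sqrt (real CARD('d) * (2 * (riesz_norm_const CARD('d) s + 1))) * riesz_row_const CARD('d) s
      * sqrt (\<Sum>p<Suc N. (\<theta> p)^2))"
proof -
  define E where "E = (\<Sum>p<Suc N. (a p)^2)"
  define C where "C = sqrt (real CARD('d) * (2 * (riesz_norm_const CARD('d) s + 1))) * riesz_row_const CARD('d) s * sqrt (\<Sum>p<Suc N. (\<theta> p)^2)"
  define T where "T = (\<Sum>p<Suc N. (\<theta> p)^2)"
  have T: "0 < T" unfolding T_def by (rule sum_\<theta>_sq_pos)
  have uc: "0 \<le> riesz_norm_const CARD('d) s" using s_pos by (simp add: riesz_norm_const_def riesz_lip_def)
  have E_eq: "E = (riesz_row_const CARD('d) s)^2 * T" unfolding E_def T_def by (rule sum_a_sq)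
  have E_pos: "0 < E" unfolding E_eq using riesz_row_const_pos[OF card_pos s_less] T by simp
  have C: "0 \<le> C" "C^2 = real CARD('d) * (2 * (riesz_norm_const CARD('d) s + 1) * E)"
    using uc riesz_row_const_pos[OF card_pos s_less] T unfolding C_def T_def[symmetric] E_eq by (simp_all add: power_mult_distrib)
  have "L2_enorm \<mu> (riesz_trunc_op s \<mu> \<epsilon> f) \<le> ennreal C"
    if \<epsilon>: "0 < \<epsilon>" and f: "f \<in> borel_measurable \<mu>" "L2_enorm \<mu> f \<le> 1" for \<epsilon> f
  proof -
    have f2: "(\<integral>\<^sup>+ x. ennreal ((f x)^2) \<partial>\<mu>) \<le> 1"
      using f(2) L2_enorm_le_iff[of 1 \<mu> f] by simp
    note [measurable] = riesz_trunc_op_measurable[OF f(1), of \<epsilon>]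
    have "(\<integral>\<^sup>+ x. ennreal ((norm (riesz_trunc_op s \<mu> \<epsilon> f x))^2) \<partial>\<mu>)
        = (\<integral>\<^sup>+ x. (\<Sum>i\<in>UNIV. ennreal ((riesz_trunc_op s \<mu> \<epsilon> f x $ i)^2)) \<partial>\<mu>)"
      by (intro nn_integral_cong) (simp add: norm_vec_def L2_set_def sum_nonneg)
    also have "\<dots> = (\<Sum>i\<in>UNIV. \<integral>\<^sup>+ x. ennreal ((riesz_trunc_op s \<mu> \<epsilon> f x $ i)^2) \<partial>\<mu>)"
      by (rule nn_integral_sum) measurable
    also have "\<dots> \<le> (\<Sum>i\<in>(UNIV :: 'd set). ennreal (2 * (riesz_norm_const CARD('d) s + 1) * E))"
      using E_pos by (intro sum_mono component_bound \<epsilon> f f2) (auto simp: E_def)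
    also have "\<dots> = ennreal (C^2)"
      unfolding C(2) sum_constant ennreal_of_nat_eq_real_of_nat by (rule ennreal_mult'[symmetric]) simp
    finally show ?thesis using L2_enorm_le_iff[OF C(1), of \<mu> "riesz_trunc_op s \<mu> \<epsilon> f"] by simp
  qed
  then show ?thesis unfolding riesz_opnorm_def C_def[symmetric] by (intro SUP_least) auto
qed

text \<open>The quadratic form of an antisymmetric kernel is zero: exchanging the variables equates
  it with its negative.\<close>

lemma integral_U_swap_zero:
  assumes p: "p \<le> N" and \<phi>: "\<phi> \<in> borel_measurable \<mu>" "\<And>x. \<bar>\<phi> x\<bar> \<le> B"
  shows "(LINT x|\<mu>. \<phi> x * tower.U i p \<phi> x) = 0"
proof -
  interpret P: pair_sigma_finite \<mu> \<mu> ..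
  have p': "p < Suc N" using p by simp
  have g: "integrable \<mu> \<phi>" using \<phi> by (intro \<mu>.integrable_const_bound[of _ B]) auto
  have 1: "(LINT x|\<mu>. \<phi> x * tower.U i p \<phi> x) = (LINT x|\<mu>. (LINT y|\<mu>. \<phi> x * k i p x y * \<phi> y))"
    by (simp add: tower.U_def mult.assoc)
  also have "\<dots> = (LINT y|\<mu>. (LINT x|\<mu>. \<phi> x * k i p x y * \<phi> y))"
    by (rule P.Fubini_integral[symmetric]) (rule tower.integrable_pair(1)[OF p' g \<phi>])
  also have "\<dots> = (LINT y|\<mu>. (LINT x|\<mu>. - (\<phi> y * k i p y x * \<phi> x)))"
  proof (intro Bochner_Integration.integral_cong refl)
    fix x y show "\<phi> x * k i p x y * \<phi> y = - (\<phi> y * k i p y x * \<phi> x)"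
      using tower.k_antisym[OF p', of i y x] by simp
  qed
  also have "\<dots> = - (LINT y|\<mu>. (LINT x|\<mu>. \<phi> y * k i p y x * \<phi> x))" by simp
  finally show ?thesis using 1 by simp
qed

text \<open>Cauchy-Schwarz against \<phi>, whose norm is at most 1. Once the sign of the remaining
  interaction is known, a single pair of opposite corner children in each cube already contributes a
  multiple of \<theta>.\<close>

lemma integral_u_sq_ge:
  assumes p: "p \<le> N"
  shows "(riesz_low_const CARD('d) s * \<theta> p)^2 \<le> (LINT x|\<mu>. (tower.u i p x)^2)"
proof -
  have p': "p < Suc N" using p by simp
  define lp where "lp = l (r p)"
  have lp: "0 < lp" unfolding lp_def by (rule l_r_pos[OF p])
  define A where "A w = Z p w \<inter> {x. x $ i < w $ i}" for w :: "real ^ 'd"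
  define \<phi> where "\<phi> = (indicator (\<Union>w\<in>W (r p - 1). A w) :: real ^ 'd \<Rightarrow> real)"
  define \<psi> where "\<psi> = (\<lambda>x. 1 - \<phi> x)"
  \<comment> \<open>Offset of the corner child with all signs positive: with T = 2, \<delta> is 3/2
    of the edge. \<open>Q w\<close> and \<open>Q' w\<close> are opposite corner children, each at
    distance \<open>lp\<close> from the hyperplane that halves \<open>Z p w\<close>.\<close>
  define v where "v = (\<chi> j :: 'd. 3 / 2 * lp)"
  define G where "G = (if p < N then Y (Suc p) else UNIV)"
  \<comment> \<open>Lower bound for the kernel component between \<open>Q w\<close> and
    \<open>Q' w\<close>: a coordinate gap of at least \<open>2 * lp\<close> over a distance of at
    most \<open>4 * d * lp\<close>.\<close>
  define m where "m = 2 * lp / (4 * real CARD('d) * lp) powr (s + 1)"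
  define M where "M = (1/2 :: real) ^ (CARD('d) * r p)"
  define Q where "Q w = cube (w - v) lp" for w :: "real ^ 'd"
  define Q' where "Q' w = cube (w + v) lp" for w :: "real ^ 'd"
  have [measurable]: "A w \<in> sets borel" for w
    unfolding A_def by measurable
  have [measurable]: "(\<Union>w\<in>W (r p - 1). A w) \<in> sets borel" using finite_W by (intro sets.finite_UN) auto
  have \<phi>_meas [measurable]: "\<phi> \<in> borel_measurable borel" unfolding \<phi>_def by measurable
  have \<psi>_meas [measurable]: "\<psi> \<in> borel_measurable borel" unfolding \<psi>_def by measurable
  have \<phi>_bd: "\<bar>\<phi> x\<bar> \<le> 1" "\<bar>\<psi> x\<bar> \<le> 1" "0 \<le> \<phi> x" "0 \<le> \<psi> x" for x
    by (auto simp: \<phi>_def \<psi>_def indicator_def)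
  have m: "0 \<le> m" using lp by (simp add: m_def)
  have \<delta>: "\<delta> (r p) = 3 / 2 * lp" using p by (simp add: \<delta>_def lp_def)
  have v: "v \<in> sign_vectors (\<delta> (r p))" "- v \<in> sign_vectors (\<delta> (r p))"
    unfolding \<delta> by (auto simp: sign_vectors_def v_def)
  have QZ: "Q w \<subseteq> Z p w" "Q' w \<subseteq> Z p w" for w
    using child_subset_Z[OF p v(1), of w] child_subset_Z[OF p v(2), of w]
    by (auto simp: Q_def Q'_def lp_def)
  have Qi: "x $ i \<le> w $ i - lp" if "x \<in> Q w" for x w
  proof -
    have "\<bar>x $ i - (w $ i - 3 / 2 * lp)\<bar> \<le> lp / 2" using that by (auto simp: Q_def mem_cube v_def)
    then show ?thesis by linarith
  qed
  have Q'i: "w $ i + lp \<le> x $ i" if "x \<in> Q' w" for x w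
  proof -
    have "\<bar>x $ i - (w $ i + 3 / 2 * lp)\<bar> \<le> lp / 2" using that by (auto simp: Q'_def mem_cube v_def)
    then show ?thesis by linarith
  qed
  have meas_Q: "measure \<mu> (Q w) = M" "measure \<mu> (Q' w) = M" if w: "w \<in> W (r p - 1)" for w
  proof -
    have j: "r p = Suc (r p - 1)" using r_bounds(1)[OF p] by simp
    have "w + v \<in> W (r p)" "w - v \<in> W (r p)"
      using W_SucI[OF w, of v] W_SucI[OF w, of "- v"] v j by (metis, metis add_uminus_conv_diff)
    moreover have "L (r p) = lp" using r_bounds(1)[OF p] by (simp add: L_def lp_def)
    ultimately show "measure \<mu> (Q w) = M" "measure \<mu> (Q' w) = M"
      using measure_\<mu>_cube[OF r_bounds(2)[OF p]] unfolding Q_def Q'_def M_def by metis+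
  qed
  have AE_G: "AE x in \<mu>. x \<in> G" unfolding G_def using AE_Y[of "Suc p"] by auto
  \<comment> \<open>For x in a left half, a related y that \<psi> does not annihilate lies in the
    right half of the same cube, so the i-th coordinate of y - x is nonnegative.\<close>
  have K_nonneg: "0 \<le> k i p x y * \<psi> y" if x: "x \<in> A w" "w \<in> W (r p - 1)" for x y w
  proof (cases "sep p x y \<and> \<psi> y \<noteq> 0")
    case True
    then obtain w' where w': "w' \<in> W (r p - 1)" "x \<in> Z p w'" "y \<in> Z p w'" by (auto simp: sep_def rel_def)
    have "w' = w" using Z_unique[OF p w'(1) x(2) w'(2)] x(1) by (auto simp: A_def)
    moreover have "y \<notin> A w" using True x(2) by (auto simp: \<psi>_def \<phi>_def indicator_def split: if_splits)
    ultimately have "x $ i \<le> y $ i" using x(1) w' by (auto simp: A_def)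
    then show ?thesis using True \<phi>_bd(4)[of y] by (simp add: k_def riesz_kernel_def)
  next
    case False
    then show ?thesis by (auto simp: k_def)
  qed
  have K_lower: "m \<le> k i p x y * \<psi> y" if w: "w \<in> W (r p - 1)" and x: "x \<in> Q w" "x \<in> G" and y: "y \<in> Q' w" "y \<in> G" for x y w
  proof -
    have rel: "rel p x y" unfolding rel_def using w x(1) y(1) QZ(1)[of w] QZ(2)[of w] by blast
    have gap: "2 * lp \<le> y $ i - x $ i" using Qi[OF x(1)] Q'i[OF y(1)] by linarith
    \<comment> \<open>Two points of one cube of the next level differ by at most
      \<open>lp / 2\<close> in each coordinate, less than the gap \<open>2 * lp\<close>.\<close>
    have "\<not> rel (Suc p) x y" if pN: "p < N"
    proof
      assume "rel (Suc p) x y"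
      then obtain w' where "x \<in> Z (Suc p) w'" "y \<in> Z (Suc p) w'" by (auto simp: rel_def)
      then have "\<bar>x $ i - w' $ i\<bar> \<le> 4 * l (r (Suc p)) / 2" "\<bar>y $ i - w' $ i\<bar> \<le> 4 * l (r (Suc p)) / 2"
        unfolding Z_def mem_cube by blast+
      moreover have "8 * l (r (Suc p)) \<le> lp" using jump_le2[OF pN] h_le[OF pN] by (simp add: h_def lp_def)
      ultimately show False using gap lp by linarith
    qed
    then have sep: "sep p x y" using rel x y by (auto simp: sep_def G_def)
    have "y \<notin> A w'" if "w' \<in> W (r p - 1)" for w'
    proof
      assume "y \<in> A w'"
      then have "w' = w" using Z_unique[OF p that w, of y] QZ(2) y by (auto simp: A_def)
      then show False using \<open>y \<in> A w'\<close> Q'i[OF y(1)] lp by (auto simp: A_def)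
    qed
    then have "\<psi> y = 1" by (auto simp: \<psi>_def \<phi>_def indicator_def)
    moreover have "m \<le> riesz_kernel s (y - x) $ i"
    proof -
      have pos: "0 < norm (y - x)"
        using gap lp component_le_norm_cart[of "y - x" i] unfolding vector_minus_component by linarith
      have "norm (y - x) powr (s + 1) \<le> (4 * real CARD('d) * lp) powr (s + 1)"
        using rel_dist[OF rel] s_pos by (intro powr_mono2) (auto simp: lp_def)
      then have "2 * lp / (4 * real CARD('d) * lp) powr (s + 1) \<le> (y $ i - x $ i) / norm (y - x) powr (s + 1)"
        using gap lp pos by (intro frac_le) auto
      then show ?thesis by (simp add: m_def riesz_kernel_def)
    qed
    ultimately show ?thesis using sep by (simp add: k_def)
  qed
  have U_\<psi>: "integrable \<mu> (\<lambda>y. k i p x y * \<psi> y)" for x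
  proof (rule Bochner_Integration.integrable_bound[OF tower.integrable_k[OF p']])
    show "AE y in \<mu>. norm (k i p x y * \<psi> y) \<le> norm (k i p x y)"
      using \<phi>_bd(2) by (intro always_eventually allI) (simp add: abs_mult mult_left_le)
    have [measurable]: "k i p x \<in> borel_measurable \<mu>" by (rule tower.sections[OF p'])
    show "(\<lambda>y. k i p x y * \<psi> y) \<in> borel_measurable \<mu>" by measurable
  qed
  have U_\<phi>: "integrable \<mu> (\<lambda>y. k i p x y * \<phi> y)" for x
    using Bochner_Integration.integrable_diff[OF tower.integrable_k[OF p', of i x] U_\<psi>[of x]]
    by (simp add: \<psi>_def algebra_simps)
  have U_split: "tower.u i p x = tower.U i p \<phi> x + tower.U i p \<psi> x" for x
    unfolding tower.U_def tower.u_def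
    by (subst Bochner_Integration.integral_add[symmetric, OF U_\<phi> U_\<psi>]) (simp add: \<psi>_def algebra_simps)
  have U_bd: "\<bar>tower.U i p g x\<bar> \<le> a p" if g: "\<And>y. \<bar>g y\<bar> \<le> 1" for g x
  proof -
    have "\<bar>tower.U i p g x\<bar> \<le> (LINT y|\<mu>. \<bar>k i p x y * g y\<bar>)"
      unfolding tower.U_def by (rule integral_abs_bound)
    also have "\<dots> \<le> (LINT y|\<mu>. S p x y)"
    proof (intro integral_mono' tower.integrable_s p')
      fix y
      have "\<bar>k i p x y\<bar> * \<bar>g y\<bar> \<le> S p x y * 1"
        using tower.k_le_s[OF p', of i x y] g[of y] by (intro mult_mono) auto
      then show "\<bar>k i p x y * g y\<bar> \<le> S p x y" by (simp add: abs_mult)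
    qed (auto simp: S_def)
    also have "\<dots> \<le> a p" by (rule tower.integral_s_le[OF p'])
    finally show ?thesis .
  qed
  have bdd_fun: "\<mu>.bdd_fun \<phi>" "\<mu>.bdd_fun (tower.U i p \<phi>)" "\<mu>.bdd_fun (tower.U i p \<psi>)" "\<mu>.bdd_fun (tower.u i p)"
    using \<phi>_bd U_bd[of \<phi>] U_bd[of \<psi>] tower.abs_u_le[OF p']
    by (auto intro!: \<mu>.bdd_funI tower.U_measurable tower.u_measurable p' intro: \<mu>.bdd_funI[of _ 1])
  have "(LINT x|\<mu>. \<phi> x * tower.u i p x) = (LINT x|\<mu>. \<phi> x * tower.U i p \<phi> x) + (LINT x|\<mu>. \<phi> x * tower.U i p \<psi> x)"
    unfolding U_split distrib_left
    by (intro Bochner_Integration.integral_add \<mu>.bdd_fun_integrable \<mu>.bdd_fun_mult bdd_fun)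
  also have "(LINT x|\<mu>. \<phi> x * tower.U i p \<phi> x) = 0"
    by (rule integral_U_swap_zero[OF p _ \<phi>_bd(1)]) simp
  finally have u_\<psi>: "(LINT x|\<mu>. \<phi> x * tower.u i p x) = (LINT x|\<mu>. \<phi> x * tower.U i p \<psi> x)" by simp
  have ptw: "AE x in \<mu>. (\<Sum>w\<in>W (r p - 1). indicator (Q w) x * (m * M)) \<le> \<phi> x * tower.U i p \<psi> x"
    using AE_G
  proof eventually_elim
    case (elim x)
    show ?case
    proof (cases "\<exists>w\<in>W (r p - 1). x \<in> A w")
      case True
      then obtain w where w: "w \<in> W (r p - 1)" "x \<in> A w" by blast
      have \<phi>1: "\<phi> x = 1" unfolding \<phi>_def by (rule indicator_simps(1)) (use w in blast)
      have uniq: "w' = w" if "w' \<in> W (r p - 1)" "x \<in> Q w'" for w'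
        using Z_unique[OF p that(1) w(1), of x] QZ(1)[of w'] that(2) w(2) unfolding A_def by blast
      have "(\<Sum>w\<in>W (r p - 1). indicator (Q w) x * (m * M)) = (\<Sum>w'\<in>W (r p - 1). if w' = w then indicator (Q w) x * (m * M) else 0)"
        using uniq by (intro sum.cong) (auto simp: indicator_def)
      also have "\<dots> = indicator (Q w) x * (m * M)" using w(1) finite_W by simp
      also have "\<dots> \<le> tower.U i p \<psi> x"
      proof (cases "x \<in> Q w")
        case True
        have "m * M = (LINT y|\<mu>. m * indicator (Q' w) y)" using meas_Q(2)[OF w(1)] by (simp add: Q'_def)
        also have "\<dots> \<le> (LINT y|\<mu>. k i p x y * \<psi> y)"
        proof (rule integral_mono_AE)
          show "integrable \<mu> (\<lambda>y. m * indicator (Q' w) y)"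
            by (intro integrable_mult_right integrable_real_indicator) (auto simp: Q'_def \<mu>.emeasure_finite less_top[symmetric])
          show "AE y in \<mu>. m * indicator (Q' w) y \<le> k i p x y * \<psi> y" using AE_G
          proof eventually_elim
            fix y assume y: "y \<in> G"
            show "m * indicator (Q' w) y \<le> k i p x y * \<psi> y"
              using K_lower[OF w(1) True elim _ y] K_nonneg[OF w(2,1), of y] by (cases "y \<in> Q' w") auto
          qed
        qed (rule U_\<psi>)
        finally show ?thesis using True by (simp add: tower.U_def)
      next
        case False
        have "0 \<le> tower.U i p \<psi> x"
          unfolding tower.U_def using K_nonneg[OF w(2,1)] by (intro integral_nonneg_AE always_eventually allI)
        with False show ?thesis by simp
      qed
      finally show ?thesis using \<phi>1 by simp
    next
      case False
      then have \<phi>0: "\<phi> x = 0" unfolding \<phi>_def by (intro indicator_simps(2)) blast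
      have "x \<notin> Q w" if "w \<in> W (r p - 1)" for w
        using False that QZ(1)[of w] Qi[of x w] lp by (force simp: A_def)
      then have "(\<Sum>w\<in>W (r p - 1). indicator (Q w) x * (m * M)) = 0" by (intro sum.neutral) auto
      then show ?thesis using \<phi>0 by simp
    qed
  qed
  \<comment> \<open>One child of mass M out of each of the \<open>2 ^ (d * (r p - 1))\<close> cubes
    makes total mass \<open>(1/2) ^ d\<close>, and \<open>m * M\<close> is a constant times
    \<theta>.\<close>
  have "riesz_low_const CARD('d) s * \<theta> p = (\<Sum>w\<in>W (r p - 1). M * (m * M))"
  proof -
    have j: "r p = Suc (r p - 1)" using r_bounds(1)[OF p] by simp
    have "real (card (W (r p - 1))) = 2 ^ (CARD('d) * (r p - 1))" using r_bounds(2)[OF p] by (subst card_W) auto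
    moreover have "M = (1/2) ^ CARD('d) * (1/2) ^ (CARD('d) * (r p - 1))"
      unfolding M_def by (subst j) (simp add: power_add)
    ultimately have "real (card (W (r p - 1))) * M = (1/2) ^ CARD('d)" by (simp add: power_one_over)
    then have sum: "(\<Sum>w\<in>W (r p - 1). M * (m * M)) = (1/2) ^ CARD('d) * (m * M)" by (simp add: mult.assoc[symmetric])
    have mM: "m * M = 2 / (4 * real CARD('d)) powr (s + 1) * \<theta> p"
    proof -
      have "(4 * real CARD('d) * lp) powr (s + 1) = (4 * real CARD('d)) powr (s + 1) * (lp powr s * lp)"
        using lp by (simp add: powr_mult powr_add)
      then show ?thesis using lp unfolding m_def M_def \<theta>_def cantor_theta_def lp_def[symmetric] by simp
    qed
    show ?thesis by (subst sum, subst mM) (simp only: riesz_low_const_def mult.assoc)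
  qed
  also have "\<dots> = (LINT x|\<mu>. (\<Sum>w\<in>W (r p - 1). indicator (Q w) x * (m * M)))"
  proof -
    have i: "integrable \<mu> (\<lambda>x. indicator (Q w) x * (m * M))" for w
      by (intro integrable_mult_left integrable_real_indicator) (auto simp: Q_def \<mu>.emeasure_finite less_top[symmetric])
    have "(LINT x|\<mu>. (\<Sum>w\<in>W (r p - 1). indicator (Q w) x * (m * M))) = (\<Sum>w\<in>W (r p - 1). \<integral>x. indicator (Q w) x * (m * M) \<partial>\<mu>)"
      by (rule Bochner_Integration.integral_sum) (rule i)
    also have "\<dots> = (\<Sum>w\<in>W (r p - 1). M * (m * M))"
    proof (intro sum.cong refl)
      fix w assume w: "w \<in> W (r p - 1)"
      have "(LINT x|\<mu>. indicator (Q w) x * (m * M)) = measure \<mu> (Q w) * (m * M)" by (simp add: Q_def)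
      then show "(LINT x|\<mu>. indicator (Q w) x * (m * M)) = M * (m * M)" using meas_Q(1)[OF w] by simp
    qed
    finally show ?thesis by simp
  qed
  also have "\<dots> \<le> (LINT x|\<mu>. \<phi> x * tower.U i p \<psi> x)"
  proof (rule integral_mono_AE[OF _ _ ptw])
    show "integrable \<mu> (\<lambda>x. \<Sum>w\<in>W (r p - 1). indicator (Q w) x * (m * M))"
      by (intro Bochner_Integration.integrable_sum integrable_mult_left integrable_real_indicator)
        (auto simp: Q_def \<mu>.emeasure_finite less_top[symmetric])
  qed (intro \<mu>.bdd_fun_integrable \<mu>.bdd_fun_mult bdd_fun)
  finally have low: "riesz_low_const CARD('d) s * \<theta> p \<le> (LINT x|\<mu>. \<phi> x * tower.u i p x)" unfolding u_\<psi> .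
  also have "\<dots> \<le> (LINT x|\<mu>. \<bar>\<phi> x * tower.u i p x\<bar>)"
    by (intro integral_mono integrable_abs \<mu>.bdd_fun_integrable \<mu>.bdd_fun_mult bdd_fun) simp
  finally have "(riesz_low_const CARD('d) s * \<theta> p)^2 \<le> (LINT x|\<mu>. \<bar>\<phi> x * tower.u i p x\<bar>)^2"
    using riesz_low_const_pos[OF card_pos, of s] \<theta>_pos[OF p] by (intro power_mono) auto
  also have "\<dots> \<le> (LINT x|\<mu>. (\<phi> x)^2) * (LINT x|\<mu>. (tower.u i p x)^2)"
    by (intro integral_Cauchy_Schwarz \<mu>.bdd_fun_integrable \<mu>.bdd_fun_power2 \<mu>.bdd_fun_measurable bdd_fun)
  also have "\<dots> \<le> 1 * (LINT x|\<mu>. (tower.u i p x)^2)"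
  proof (rule mult_right_mono)
    have "(LINT x|\<mu>. (\<phi> x)^2) \<le> (LINT x|\<mu>. 1)"
      by (intro integral_mono \<mu>.bdd_fun_integrable \<mu>.bdd_fun_power2 bdd_fun)
        (auto simp: \<phi>_def indicator_def intro: \<mu>.bdd_funI[of _ 1])
    then show "(LINT x|\<mu>. (\<phi> x)^2) \<le> 1" using emeasure_\<mu>_UNIV by (simp add: measure_def)
  qed simp
  finally show ?thesis by simp
qed

text \<open>A single coordinate suffices. The cross terms cost at most
  \<open>8 * d * riesz_lip s * \<alpha>\<close> times the squared row constant times the sum of
  squares, which the assumption makes at most half of the diagonal; the final 1/2 rounds down the
  root of 1/2.\<close>

lemma L2_enorm_riesz_ge:
  assumes \<alpha>: "16 * real CARD('d) * riesz_lip s * \<alpha> * (riesz_row_const CARD('d) s)^2 \<le> (riesz_low_const CARD('d) s)^2"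
  shows "ennreal (riesz_low_const CARD('d) s / 2 * sqrt (\<Sum>p<Suc N. (\<theta> p)^2)) \<le> L2_enorm \<mu> (riesz s \<mu>)"
proof -
  define \<Sigma> where "\<Sigma> = (\<Sum>p<Suc N. (\<theta> p)^2)"
  have \<Sigma>: "0 < \<Sigma>" unfolding \<Sigma>_def by (rule sum_\<theta>_sq_pos)
  obtain i :: 'd where True by simp
  define R where "R x = (\<Sum>p<Suc N. tower.u i p x)" for x
  have bR: "\<mu>.bdd_fun R" unfolding R_def[abs_def]
  proof (intro \<mu>.bdd_fun_sum)
    fix p assume "p \<in> {..<Suc N}"
    then show "\<mu>.bdd_fun (tower.u i p)"
      using tower.abs_u_le[of p] by (intro \<mu>.bdd_funI[of _ "a p"] tower.u_measurable) auto
  qed simp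
  have "(\<Sum>p<Suc N. (riesz_low_const CARD('d) s * \<theta> p)^2) - 4 * (4 * real CARD('d) * riesz_lip s) * (\<alpha> / 2) * (\<Sum>p<Suc N. (a p)^2)
      \<le> (LINT x|\<mu>. (R x)^2)" unfolding R_def
    by (rule tower.integral_sum_u_square_ge) (auto intro!: integral_u_sq_ge simp: measure_def emeasure_\<mu>_UNIV)
  moreover have "(\<Sum>p<Suc N. (riesz_low_const CARD('d) s * \<theta> p)^2) = (riesz_low_const CARD('d) s)^2 * \<Sigma>"
    unfolding \<Sigma>_def power_mult_distrib sum_distrib_left by (rule refl)
  moreover have "4 * (4 * real CARD('d) * riesz_lip s) * (\<alpha> / 2) * (\<Sum>p<Suc N. (a p)^2) \<le> (riesz_low_const CARD('d) s)^2 / 2 * \<Sigma>"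
  proof -
    have "4 * (4 * real CARD('d) * riesz_lip s) * (\<alpha> / 2) * (\<Sum>p<Suc N. (a p)^2)
        = (16 * real CARD('d) * riesz_lip s * \<alpha> * (riesz_row_const CARD('d) s)^2) / 2 * \<Sigma>"
      unfolding sum_a_sq \<Sigma>_def[symmetric] by simp
    also have "\<dots> \<le> (riesz_low_const CARD('d) s)^2 / 2 * \<Sigma>"
      using \<alpha> \<Sigma> by (intro mult_right_mono divide_right_mono) auto
    finally show ?thesis .
  qed
  ultimately have "(riesz_low_const CARD('d) s)^2 / 2 * \<Sigma> \<le> (LINT x|\<mu>. (R x)^2)" by linarith
  moreover have "(riesz_low_const CARD('d) s / 2 * sqrt \<Sigma>)^2 \<le> (riesz_low_const CARD('d) s)^2 / 2 * \<Sigma>"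
    using \<Sigma> by (simp add: power_mult_distrib power_divide)
  ultimately have "ennreal ((riesz_low_const CARD('d) s / 2 * sqrt \<Sigma>)^2) \<le> ennreal (LINT x|\<mu>. (R x)^2)"
    by (intro ennreal_leI) linarith
  also have "\<dots> = (\<integral>\<^sup>+ x. ennreal ((R x)^2) \<partial>\<mu>)"
    by (rule nn_integral_eq_integral[symmetric]) (auto intro!: \<mu>.bdd_fun_integrable \<mu>.bdd_fun_power2 bR)
  also have "\<dots> \<le> (\<integral>\<^sup>+ x. ennreal ((norm (riesz s \<mu> x))^2) \<partial>\<mu>)"
  proof (rule nn_integral_mono_AE)
    show "AE x in \<mu>. ennreal ((R x)^2) \<le> ennreal ((norm (riesz s \<mu> x))^2)" using AE_Y[OF order_refl]
    proof eventually_elim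
      case (elim x)
      have "\<bar>R x\<bar> \<le> norm (riesz s \<mu> x)"
        unfolding R_def riesz_component[OF elim, symmetric] by (rule component_le_norm_cart)
      then show ?case by (intro ennreal_leI power2_le_iff_abs_le[THEN iffD2]) auto
    qed
  qed
  finally show ?thesis
    unfolding \<Sigma>_def[symmetric] using L2_enorm_ge_iff[of "riesz_low_const CARD('d) s / 2 * sqrt \<Sigma>" \<mu> "riesz s \<mu>"] riesz_low_const_pos[OF card_pos, of s] \<Sigma> by simp
qed

text \<open>At a generation without a jump the length halves, so \<theta> is multiplied by
  \<open>2 powr (s - d)\<close> and its square by \<gamma> < 1. An index shift bounds the non-jump
  part by \<gamma> times the whole sum, which is then absorbed.\<close>

lemma sum_theta_sq_bounds:
  defines "t \<equiv> cantor_theta CARD('d) s l" and "\<gamma> \<equiv> 4 powr (s - real CARD('d))"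
  shows "(\<Sum>p<Suc N. (\<theta> p)^2) \<le> (\<Sum>j=1..n. (t j)^2)"
    and "(\<Sum>j=1..n. (t j)^2) \<le> 1 / (1 - \<gamma>) * (\<Sum>p<Suc N. (\<theta> p)^2)"
proof -
  define J where "J = r ` {..<Suc N}"
  have inj: "inj_on r {..<Suc N}"
    using r_less by (intro inj_onI) (metis lessThan_iff less_Suc_eq_le less_irrefl nat_neq_iff)
  have eq: "(\<Sum>p<Suc N. (\<theta> p)^2) = (\<Sum>j\<in>J. (t j)^2)"
    unfolding J_def sum.reindex[OF inj] by (simp add: \<theta>_def t_def)
  have J: "J \<subseteq> {1..n}" unfolding J_def using r_bounds by (auto simp: less_Suc_eq_le)
  show "(\<Sum>p<Suc N. (\<theta> p)^2) \<le> (\<Sum>j=1..n. (t j)^2)" unfolding eq using J by (intro sum_mono2) auto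
  have \<gamma>: "0 \<le> \<gamma>" "\<gamma> < 1" using s_less by (auto simp: \<gamma>_def powr_less_one)
  have step: "(t j)^2 = \<gamma> * (t (j - 1))^2" "j - 1 \<in> {1..n}" if j: "j \<in> {1..n} - J" for j
  proof -
    obtain i where i: "j = Suc i" using j by (cases j) auto
    have J_eq: "J = r ` {..N}" by (simp add: J_def lessThan_Suc_atMost)
    have *: "1 \<le> i" "l (Suc i) = l i / 2" using nonjump[of i] j i J_eq by auto
    then show "j - 1 \<in> {1..n}" using i j by auto
    have "0 < l i" using * i j by (intro l_pos) auto
    then have "t j = t i * (2 powr s * (1/2) ^ CARD('d))"
      unfolding t_def cantor_theta_def i *(2) by (simp add: powr_divide power_add)
    moreover have "(2 powr s * (1/2) ^ CARD('d))^2 = \<gamma>"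
    proof -
      have "2 powr s * (1/2) ^ CARD('d) = 2 powr (s - real CARD('d))"
        by (simp add: powr_diff powr_realpow power_one_over)
      moreover have "(2 powr (s - real CARD('d)))^2 = (2 * 2) powr (s - real CARD('d))"
        unfolding power2_eq_square by (rule powr_mult[symmetric])
      ultimately show ?thesis by (simp add: \<gamma>_def)
    qed
    ultimately show "(t j)^2 = \<gamma> * (t (j - 1))^2" using i by (simp add: power_mult_distrib)
  qed
  have "(\<Sum>j=1..n. (t j)^2) = (\<Sum>j\<in>J. (t j)^2) + (\<Sum>j\<in>{1..n} - J. (t j)^2)"
    using J by (intro sum.subset_diff[of J, THEN trans]) (auto simp: add.commute)
  also have "(\<Sum>j\<in>{1..n} - J. (t j)^2) = \<gamma> * (\<Sum>j\<in>{1..n} - J. (t (j - 1))^2)"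
    unfolding sum_distrib_left using step by (intro sum.cong) auto
  also have "(\<Sum>j\<in>{1..n} - J. (t (j - 1))^2) = (\<Sum>j\<in>(\<lambda>j. j - 1) ` ({1..n} - J). (t j)^2)"
    by (subst sum.reindex) (auto simp: inj_on_def)
  also have "\<dots> \<le> (\<Sum>j=1..n. (t j)^2)" using step(2) by (intro sum_mono2) auto
  finally have "(\<Sum>j=1..n. (t j)^2) \<le> (\<Sum>j\<in>J. (t j)^2) + \<gamma> * (\<Sum>j=1..n. (t j)^2)"
    using \<gamma> by (simp add: mult_left_mono)
  then have "(1 - \<gamma>) * (\<Sum>j=1..n. (t j)^2) \<le> (\<Sum>j\<in>J. (t j)^2)" by (simp add: algebra_simps)
  then show "(\<Sum>j=1..n. (t j)^2) \<le> 1 / (1 - \<gamma>) * (\<Sum>p<Suc N. (\<theta> p)^2)"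
    unfolding eq using \<gamma> by (simp add: field_simps)
qed

end

context riesz_cantor
begin

theorem riesz_bounds:
  fixes \<Theta> :: real
  defines "\<Theta> \<equiv> sqrt (\<Sum>j=1..n. (cantor_theta CARD('d) s l j)^2)"
    and "c \<equiv> riesz_low_const CARD('d) s / 2 * sqrt (1 - 4 powr (s - real CARD('d)))"
    and "C \<equiv> sqrt (real CARD('d) * (2 * (riesz_norm_const CARD('d) s + 1))) * riesz_row_const CARD('d) s"
  assumes \<alpha>: "16 * real CARD('d) * riesz_lip s * \<alpha> * (riesz_row_const CARD('d) s)^2 \<le> (riesz_low_const CARD('d) s)^2"
  shows "ennreal (c * \<Theta>) \<le> L2_enorm \<mu> (riesz s \<mu>)" "L2_enorm \<mu> (riesz s \<mu>) \<le> ennreal (C * \<Theta>)"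
    "ennreal (c * \<Theta>) \<le> riesz_opnorm s \<mu>" "riesz_opnorm s \<mu> \<le> ennreal (C * \<Theta>)"
proof -
  define T where "T = (\<Sum>p<Suc N. (\<theta> p)^2)"
  define \<gamma> where "\<gamma> = 4 powr (s - real CARD('d))"
  have \<gamma>: "\<gamma> < 1" using s_less by (simp add: \<gamma>_def powr_less_one)
  have low: "0 < riesz_low_const CARD('d) s" by (rule riesz_low_const_pos[OF card_pos, of s])
  have norm: "0 \<le> riesz_norm_const CARD('d) s" using s_pos by (simp add: riesz_norm_const_def riesz_lip_def)
  have C: "0 \<le> C" using norm riesz_row_const_pos[OF card_pos s_less] by (simp add: C_def)
  have "sqrt T \<le> \<Theta>" unfolding T_def \<Theta>_def using sum_theta_sq_bounds(1) by (rule real_sqrt_le_mono)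
  then have "C * sqrt T \<le> C * \<Theta>" using C by (rule mult_left_mono)
  then show op: "riesz_opnorm s \<mu> \<le> ennreal (C * \<Theta>)"
    using riesz_opnorm_le unfolding C_def[symmetric] T_def[symmetric] by (meson ennreal_leI order_trans)
  have "(1 - \<gamma>) * (\<Sum>j=1..n. (cantor_theta CARD('d) s l j)^2) \<le> T"
    using sum_theta_sq_bounds(2) \<gamma> unfolding T_def[symmetric] \<gamma>_def[symmetric] by (simp add: field_simps)
  then have "sqrt (1 - \<gamma>) * \<Theta> \<le> sqrt T"
    unfolding \<Theta>_def real_sqrt_mult[symmetric] by (rule real_sqrt_le_mono)
  then have "riesz_low_const CARD('d) s / 2 * (sqrt (1 - \<gamma>) * \<Theta>) \<le> riesz_low_const CARD('d) s / 2 * sqrt T"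
    using low by (intro mult_left_mono) auto
  then have "c * \<Theta> \<le> riesz_low_const CARD('d) s / 2 * sqrt T" by (simp only: c_def \<gamma>_def mult.assoc)
  then show low: "ennreal (c * \<Theta>) \<le> L2_enorm \<mu> (riesz s \<mu>)"
    using L2_enorm_riesz_ge[OF \<alpha>] unfolding T_def[symmetric] by (meson ennreal_leI order_trans)
  show "L2_enorm \<mu> (riesz s \<mu>) \<le> ennreal (C * \<Theta>)" "ennreal (c * \<Theta>) \<le> riesz_opnorm s \<mu>"
    using L2_enorm_riesz_le_opnorm op low by (meson order_trans)+
qed

end

section \<open>Choice of the parameters and identification of the measure\<close>

theorem theorem2p2:
  fixes s :: real
  assumes "0 < s" and "s < real CARD('d::finite)"
  shows "\<exists>\<alpha> T c C :: real. 0 < \<alpha> \<and> \<alpha> < 1/2 \<and> 1 < T \<and> T < 1 / (2 * \<alpha>) \<and> 0 < c \<and> 0 < C \<and>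
    (\<forall>(n::nat) (\<sigma> :: nat \<Rightarrow> real).
       1 \<le> n \<and> (\<forall>j\<in>{1..n}. 0 < \<sigma> j) \<and> (\<forall>j. 1 \<le> j \<and> j < n \<longrightarrow> 2 * \<sigma> (j + 1) \<le> \<sigma> j) \<longrightarrow>
       (let \<mu> = (cantor_measure \<alpha> T n \<sigma> :: (real ^ 'd) measure);
            \<Theta> = sqrt (\<Sum>j=1..n. (cantor_theta CARD('d) s (reg_length \<alpha> n \<sigma>) j)\<^sup>2)
        in (AE x in \<mu>. riesz_defined_at s \<mu> x) \<and>
           ennreal (c * \<Theta>) \<le> L2_enorm \<mu> (riesz s \<mu>) \<and>
           L2_enorm \<mu> (riesz s \<mu>) \<le> ennreal (C * \<Theta>) \<and>
           ennreal (c * \<Theta>) \<le> riesz_opnorm s \<mu> \<and>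
           riesz_opnorm s \<mu> \<le> ennreal (C * \<Theta>)))"
proof -
  define d where "d = real CARD('d)"
  define low where "low = riesz_low_const CARD('d) s"
  define row where "row = riesz_row_const CARD('d) s"
  define lip where "lip = riesz_lip s"
  \<comment> \<open>The first term ensures the bound 1/(4d) required for smoothness and \<alpha>
    \<le> 1/8, which leaves room for T = 2; the second is the smallness condition of
    \<open>riesz_bounds\<close> solved for \<alpha>. Both depend on d and s alone.\<close>
  define \<alpha> where "\<alpha> = min (1 / (8 * d)) (low^2 / (16 * d * lip * row^2))"
  define c where "c = low / 2 * sqrt (1 - 4 powr (s - d))"
  define C where "C = sqrt (d * (2 * (riesz_norm_const CARD('d) s + 1))) * row"
  have d: "1 \<le> d" by (simp add: d_def Suc_leI)
  have low: "0 < low" unfolding low_def by (rule riesz_low_const_pos) simp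
  have row: "0 < row" unfolding row_def by (rule riesz_row_const_pos) (use assms in auto)
  have lip: "0 < lip" using assms by (simp add: lip_def riesz_lip_def add_pos_nonneg)
  have norm: "0 \<le> riesz_norm_const CARD('d) s" using assms by (simp add: riesz_norm_const_def riesz_lip_def)
  have "0 < low^2" "0 < 16 * d * lip * row^2" using low d lip row by simp_all
  then have "0 < low^2 / (16 * d * lip * row^2)" by (rule divide_pos_pos)
  then have \<alpha>_pos: "0 < \<alpha>" using d by (simp add: \<alpha>_def)
  have "\<alpha> \<le> 1 / (8 * d)" by (simp add: \<alpha>_def)
  also have "\<dots> \<le> 1 / (4 * d)" using d by (intro frac_le) auto
  finally have \<alpha>_d: "\<alpha> \<le> 1 / (4 * d)" .
  have "\<alpha> \<le> 1 / (8 * d)" by (simp add: \<alpha>_def)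
  also have "\<dots> \<le> 1 / 8" using d by (intro frac_le) auto
  finally have \<alpha>_8: "\<alpha> \<le> 1 / 8" .
  have "\<alpha> \<le> low^2 / (16 * d * lip * row^2)" by (simp add: \<alpha>_def)
  then have \<alpha>_low: "16 * d * lip * \<alpha> * row^2 \<le> low^2"
    using \<open>0 < 16 * d * lip * row^2\<close> by (simp add: pos_le_divide_eq mult.commute mult.left_commute)
  have c: "0 < c" using low assms by (simp add: c_def d_def powr_less_one)
  have C: "0 < C" using norm row d by (simp add: C_def)
  have T: "2 < 1 / (2 * \<alpha>)" using \<alpha>_pos \<alpha>_8 by (simp add: field_simps)
  have main: "(AE x in \<mu>. riesz_defined_at s \<mu> x) \<and> ennreal (c * \<Theta>) \<le> L2_enorm \<mu> (riesz s \<mu>)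
      \<and> L2_enorm \<mu> (riesz s \<mu>) \<le> ennreal (C * \<Theta>) \<and> ennreal (c * \<Theta>) \<le> riesz_opnorm s \<mu> \<and> riesz_opnorm s \<mu> \<le> ennreal (C * \<Theta>)"
    if n: "1 \<le> n" and \<sigma>: "\<forall>j\<in>{1..n}. 0 < \<sigma> j"
      and \<mu>: "\<mu> = (cantor_measure \<alpha> 2 n \<sigma> :: (real ^ 'd) measure)"
      and \<Theta>: "\<Theta> = sqrt (\<Sum>j=1..n. (cantor_theta CARD('d) s (reg_length \<alpha> n \<sigma>) j)^2)" for n \<sigma> \<mu> \<Theta>
  proof -
    define r where "r = reg_index \<alpha> n \<sigma>"
    define l where "l = reg_length \<alpha> n \<sigma>"
    obtain N where N: "r N = n" "\<And>p. p < N \<Longrightarrow> r p < r (Suc p)" "range r = r ` {..N}"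
      "\<And>j. 1 \<le> j \<Longrightarrow> j \<le> n \<Longrightarrow> 0 < l j"
      "\<And>p j. p < N \<Longrightarrow> r p \<le> j \<Longrightarrow> Suc j < r (Suc p) \<Longrightarrow> l (Suc j) = l j / 2"
      "\<And>p. p < N \<Longrightarrow> l (r (Suc p)) \<le> \<alpha> / 2 * l (r (Suc p) - 1)"
      unfolding r_def l_def by (rule reg_length_structure[OF n \<alpha>_pos \<sigma>]) blast
    interpret R: riesz_cantor "TYPE('d)" \<alpha> n N r l s
      by unfold_locales (use \<alpha>_pos \<alpha>_8 \<alpha>_d assms N in \<open>auto simp: r_def d_def\<close>)
    obtain j where j: "n = Suc j" using n by (cases n) auto
    have \<delta>: "R.\<delta> i = (if i \<in> range r then 2 * l i - l i / 2 else l i / 2)" for i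
      unfolding N(3) by (rule R.\<delta>_def)
    have half: "l (Suc i) = l i / 2" if "Suc i \<le> n" "Suc i \<notin> range r" for i
      using R.nonjump(2)[of i] that unfolding N(3) .
    have "cantor_cubes \<alpha> 2 n \<sigma> (Suc j) = (\<lambda>w. cube w (l (Suc j))) ` (centers R.\<delta> (Suc j) :: (real ^ 'd) set)"
      by (rule cantor_cubes_eq_centers[where T=2 and n=n and \<alpha>=\<alpha> and \<sigma>=\<sigma> and \<delta>=R.\<delta> and j=j, folded r_def l_def])
        (use \<delta> half N(4) in \<open>auto simp: j\<close>)
    then have cubes: "cantor_cubes \<alpha> 2 n \<sigma> n = (\<lambda>w. cube w (l n)) ` (centers R.\<delta> n :: (real ^ 'd) set)"
      unfolding j .
    have "0 \<le> l n" using R.l_n_pos by simp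
    \<comment> \<open>The measure is defined by a sum over the set of cubes; distinct centers give
      distinct cubes, so it can be rewritten as a sum over centers.\<close>
    then have inj: "inj_on (\<lambda>w. cube w (l n)) (centers R.\<delta> n :: (real ^ 'd) set)"
      by (auto simp: inj_on_def cube_eq_iff)
    have "\<mu> = R.\<mu>" unfolding \<mu> cantor_measure_def R.\<mu>_def cubes sum.reindex[OF inj] o_def
      using \<open>0 \<le> l n\<close> by (simp add: measure_lborel_cube)
    then show ?thesis
      using R.AE_riesz_defined R.riesz_bounds[OF \<alpha>_low[unfolded low_def row_def lip_def d_def]]
      unfolding \<Theta> c_def C_def low_def row_def d_def l_def by blast
  qed
  show ?thesis
    by (rule exI[of _ \<alpha>], rule exI[of _ 2], rule exI[of _ c], rule exI[of _ C])
      (use \<alpha>_pos \<alpha>_8 T c C main in \<open>auto simp: Let_def\<close>)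
qed

end
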